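(* Let $k$ be an algebraically closed field of characteristic $0$. Let $C$ be a genus $2$ curve over $k$ with classical invariants $(J_2,J_4,J_6,J_{10})$ such that $J_2\neq 0$, and let $i_1,i_2,i_3$ be the corresponding absolute invariants. i) If $\mathrm{Aut}(C)\cong D_8$, then $C$ is isomorphic over $k$ to the genus $2$ curve $$Y^2=X^5+X^3+tX,\qquad t=-\frac34\cdot\frac{345i_1^2+50i_1i_2-90i_2-1296i_1}{2925i_1^2+250i_1i_2-9450i_2-54000i_1+139968}.$$ ii) If $\mathrm{Aut}(C)\cong D_{12}$, then $C$ is isomorphic over $k$ to the genus $2$ curve $$Y^2=X^6+X^3+t,\qquad t=\frac14\cdot\frac{540i_1^2+100i_1i_2-1782i_1+45i_2}{2700i_1^2+1000i_1i_2+204525i_1+40950i_2-708588}.$$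
   Context: Curves are smooth projective; a genus $2$ curve given by an affine equation means its smooth projective model. $\mathrm{Aut}(C):=\mathrm{Aut}(k(C)/k)$. $D_8$ and $D_{12}$ are the dihedral groups of order $8$ and $12$ respectively. Classical invariants: for a binary sextic $f(X,Z)=a_6X^6+a_5X^5Z+\dots+a_0Z^6$ over $k$, factored as $f=\prod_{m=1}^6(z_mX-x_mZ)$, put $(m\,n):=x_mz_n-x_nz_m$. Then $$J_2=\sum_{15}(12)^2(34)^2(56)^2,\qquad J_4=\sum_{10}(12)^2(23)^2(31)^2(45)^2(56)^2(64)^2,$$ $$J_6=\sum_{60}(12)^2(23)^2(31)^2(45)^2(56)^2(64)^2(14)^2(25)^2(36)^2,\qquad J_{10}=\prod_{m<n}(m\,n)^2,$$ where the sums run over all distinct expressions obtained by permuting the indices $1,\dots,6$ (with $15$, $10$, $60$ terms respectively). Thus $J_{2i}$ is a homogeneous polynomial of degree $2i$ in $a_0,\dots,a_6$, and $J_{10}$ is the discriminant of the sextic. For a genus $2$ curve $C: Y^2=f(X,1)$ the tuple $(J_2,J_4,J_6,J_{10})$ of $f$ is the tuple of classical invariants of $C$, well defined up to replacing $J_{2i}$ by $c^{2i}J_{2i}$, $c\in k^*$ (a quintic in $X$ is regarded as a sextic with $a_6=0$). The absolute invariants, defined when $J_2\ne0$, are $$i_1=144\frac{J_4}{J_2^2},\qquad i_2=-1728\frac{J_2J_4-3J_6}{J_2^3},\qquad i_3=486\frac{J_{10}}{J_2^5};$$ two genus $2$ curves over $k$ with $J_2\neq0$ are isomorphic if and only if they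 have the same $(i_1,i_2,i_3)$. *)

theory Defs
  imports
    "HOL-Computational_Algebra.Computational_Algebra"
    "HOL-Combinatorics.Permutations"
    "HOL-Algebra.QuotRing"
begin

text \<open>
  A curve \<open>C: Y\<^sup>2 = f(X)\<close> is given by the polynomial \<open>f\<close>. The smooth projective model of this
  equation has genus 2 exactly when \<open>f\<close> has degree 5 or 6 and no repeated roots.
\<close>

definition genus2 :: "'k::{alg_closed_field, field_char_0} poly \<Rightarrow> bool" where
  "genus2 f \<longleftrightarrow> degree f \<in> {5, 6} \<and> squarefree f"

text \<open>
  \<open>k(C) = k(X)[Y] / (Y\<^sup>2 - f)\<close>: the pair \<open>(a, b)\<close> with \<open>a, b \<in> k(X)\<close> stands for \<open>a + b Y\<close>.
\<close>

definition function_field :: "'k::field poly \<Rightarrow> ('k poly fract \<times> 'k poly fract) ring" where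
  "function_field f = \<lparr>
     carrier = UNIV,
     mult = (\<lambda>(a, b) (c, d). (a * c + to_fract f * (b * d), a * d + b * c)),
     one = (1, 0),
     zero = (0, 0),
     add = (\<lambda>(a, b) (c, d). (a + c, b + d))\<rparr>"

definition const :: "'k::field \<Rightarrow> 'k poly fract \<times> 'k poly fract" where
  "const c = (to_fract [:c:], 0)"

text \<open>
  Smooth projective curves are isomorphic over \<open>k\<close> iff their function fields are isomorphic
  as extensions of \<open>k\<close>.
\<close>

definition function_field_isos ::
  "'k::field poly \<Rightarrow> 'k poly \<Rightarrow>
    ('k poly fract \<times> 'k poly fract \<Rightarrow> 'k poly fract \<times> 'k poly fract) set" where
  "function_field_isos f g =
     {\<phi> \<in> ring_iso (function_field f) (function_field g). \<forall>c. \<phi> (const c) = const c}"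

definition curve_isomorphic :: "'k::field poly \<Rightarrow> 'k poly \<Rightarrow> bool" where
  "curve_isomorphic f g \<longleftrightarrow> function_field_isos f g \<noteq> {}"

definition Aut ::
  "'k::field poly \<Rightarrow> ('k poly fract \<times> 'k poly fract \<Rightarrow> 'k poly fract \<times> 'k poly fract) monoid" where
  "Aut f = \<lparr>carrier = function_field_isos f f, mult = (\<circ>), one = id\<rparr>"

text \<open>
  The dihedral group of order \<open>2 n\<close>; the pair \<open>(i, b)\<close> stands for \<open>r\<^sup>i s\<^sup>b\<close> with
  \<open>r\<^sup>n = s\<^sup>2 = 1\<close> and \<open>s r = r\<^sup>-\<^sup>1 s\<close>.
\<close>

definition dihedral_group :: "nat \<Rightarrow> (int \<times> bool) monoid" where
  "dihedral_group n = \<lparr>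
     carrier = {0..<int n} \<times> UNIV,
     mult = (\<lambda>(i, b) (j, c). ((if b then i - j else i + j) mod int n, b \<noteq> c)),
     one = (0, False)\<rparr>"

definition bracket :: "(nat \<Rightarrow> 'k::field) \<Rightarrow> (nat \<Rightarrow> 'k) \<Rightarrow> nat \<Rightarrow> nat \<Rightarrow> 'k" where
  "bracket x z m n = x m * z n - x n * z m"

text \<open>
  Since \<open>(m n)\<^sup>2 = (n m)\<^sup>2\<close>, a product of distinct squared brackets is encoded by the set \<open>E\<close> of
  the unordered pairs \<open>{m, n}\<close> that occur in it. The distinct expressions obtained from it by
  permuting the indices are then the elements of \<open>permuted E\<close>.
\<close>

definition permuted :: "nat set set \<Rightarrow> nat set set set" where
  "permuted E = {(\<lambda>e. p ` e) ` E |p. p permutes {1..6}}"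

definition expr :: "(nat \<Rightarrow> 'k::field) \<Rightarrow> (nat \<Rightarrow> 'k) \<Rightarrow> nat set set \<Rightarrow> 'k" where
  "expr x z E = (\<Prod>e\<in>E. (bracket x z (Min e) (Max e))\<^sup>2)"

definition inv2 :: "(nat \<Rightarrow> 'k::field) \<Rightarrow> (nat \<Rightarrow> 'k) \<Rightarrow> 'k" where
  "inv2 x z = (\<Sum>E\<in>permuted {{1,2},{3,4},{5,6}}. expr x z E)"

definition inv4 :: "(nat \<Rightarrow> 'k::field) \<Rightarrow> (nat \<Rightarrow> 'k) \<Rightarrow> 'k" where
  "inv4 x z = (\<Sum>E\<in>permuted {{1,2},{2,3},{3,1},{4,5},{5,6},{6,4}}. expr x z E)"

definition inv6 :: "(nat \<Rightarrow> 'k::field) \<Rightarrow> (nat \<Rightarrow> 'k) \<Rightarrow> 'k" where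
  "inv6 x z =
     (\<Sum>E\<in>permuted {{1,2},{2,3},{3,1},{4,5},{5,6},{6,4},{1,4},{2,5},{3,6}}. expr x z E)"

definition inv10 :: "(nat \<Rightarrow> 'k::field) \<Rightarrow> (nat \<Rightarrow> 'k) \<Rightarrow> 'k" where
  "inv10 x z = (\<Prod>m\<in>{1..6}. \<Prod>n\<in>{m<..6}. (bracket x z m n)\<^sup>2)"

text \<open>
  The sextic form is dehomogenised at \<open>Z = 1\<close>, so \<open>z\<^sub>m X - x\<^sub>m Z\<close> becomes \<open>[:- x m, z m:]\<close>, and a
  quintic has one factor with \<open>z\<^sub>m = 0\<close>. The invariants do not depend on the factorisation
  chosen; as invariants of the curve \<open>Y\<^sup>2 = f(X)\<close> they are determined only up to the weighted
  scaling by \<open>c\<close>.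
\<close>

definition classical_invariants :: "'k::field poly \<Rightarrow> 'k \<Rightarrow> 'k \<Rightarrow> 'k \<Rightarrow> 'k \<Rightarrow> bool" where
  "classical_invariants f J2 J4 J6 J10 \<longleftrightarrow>
     (\<exists>x z c. f = (\<Prod>m\<in>{1..6::nat}. [:- x m, z m:]) \<and> c \<noteq> 0 \<and>
        J2 = c ^ 2 * inv2 x z \<and> J4 = c ^ 4 * inv4 x z \<and>
        J6 = c ^ 6 * inv6 x z \<and> J10 = c ^ 10 * inv10 x z)"

lemma to_fract_nonsquare:
  fixes f :: "'k::alg_closed_field poly"
  assumes "squarefree f" "degree f > 0" "a\<^sup>2 = to_fract f * b\<^sup>2"
  shows "b = 0"
proof (rule ccontr)
  assume b: "b \<noteq> 0"
  have f0: "f \<noteq> 0" using assms(2) by auto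
  obtain p q where q: "q \<noteq> 0" "a / b = to_fract p / to_fract q"
    by (metis Fract_conv_to_fract Fract_cases)
  have "(to_fract p / to_fract q)\<^sup>2 = to_fract f"
    using assms(3) b unfolding q(2)[symmetric] by (simp add: power_divide)
  hence "to_fract p * to_fract p = to_fract f * (to_fract q * to_fract q)"
    using q(1) by (simp add: power2_eq_square field_simps)
  hence eq: "p * p = f * (q * q)"
    by (simp only: to_fract_mult[symmetric] to_fract_eq_iff)
  hence p: "p \<noteq> 0" using f0 q(1) by auto
  obtain r where r: "poly f r = 0" using alg_closed_imp_poly_has_root[OF assms(2)] by blast
  have "\<not> [:- r, 1:] ^ 2 dvd f"
    using squarefreeD[OF assms(1), of "[:- r, 1:]"] by (auto simp: is_unit_iff_degree)
  hence "Polynomial.order r f < 2" using f0 by (simp add: Polynomial.order_divides)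
  moreover have "Polynomial.order r f \<noteq> 0" using r f0 by (simp add: Polynomial.order_root)
  ultimately have "Polynomial.order r f = 1" by simp
  moreover have "Polynomial.order r (p * p) = Polynomial.order r (f * (q * q))" using eq by simp
  ultimately have "2 * Polynomial.order r p = 1 + 2 * Polynomial.order r q"
    using p q(1) f0 by (simp add: Polynomial.order_mult)
  thus False by presburger
qed

lemma function_field_cring: "cring (function_field f)" (is "cring ?K")
proof (intro cringI abelian_groupI comm_monoidI)
  fix u assume "u \<in> carrier ?K"
  show "\<exists>v\<in>carrier ?K. v \<oplus>\<^bsub>?K\<^esub> u = \<zero>\<^bsub>?K\<^esub>"
    by (rule bexI[of _ "(- fst u, - snd u)"]) (auto simp: function_field_def split: prod.splits)
qed (auto simp: function_field_def algebra_simps)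

lemma function_field_field:
  fixes f :: "'k::alg_closed_field poly"
  assumes "squarefree f" "degree f > 0"
  shows "field (function_field f)"
proof -
  let ?K = "function_field f"
  interpret cring ?K by (rule function_field_cring)
  show ?thesis
  proof (rule cring_fieldI2)
    show "\<zero>\<^bsub>?K\<^esub> \<noteq> \<one>\<^bsub>?K\<^esub>" by (simp add: function_field_def)
    fix u assume u: "u \<in> carrier ?K" "u \<noteq> \<zero>\<^bsub>?K\<^esub>"
    obtain a b where ab: "u = (a, b)" by fastforce
    define n where "n = a\<^sup>2 - to_fract f * b\<^sup>2"
    have n: "n \<noteq> 0"
      using to_fract_nonsquare[OF assms, of a b] u(2)
      by (auto simp: n_def ab function_field_def)
    have "a * (a / n) + to_fract f * (b * (- b / n)) = (a\<^sup>2 - to_fract f * b\<^sup>2) / n"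
      by (simp add: diff_divide_distrib power2_eq_square)
    also have "\<dots> = 1" using n by (simp add: n_def)
    finally have "a * (a / n) + to_fract f * (b * (- b / n)) = 1" .
    hence "u \<otimes>\<^bsub>?K\<^esub> (a / n, - b / n) = \<one>\<^bsub>?K\<^esub>"
      using n by (simp add: ab function_field_def mult.commute)
    thus "\<exists>v\<in>carrier ?K. u \<otimes>\<^bsub>?K\<^esub> v = \<one>\<^bsub>?K\<^esub>"
      by (auto simp: function_field_def)
  qed
qed

lemma Y_squared:
  "(0, 1) \<otimes>\<^bsub>function_field f\<^esub> (0, 1) = (to_fract f, 0)"
  by (simp add: function_field_def)

lemma group_Aut: "group (Aut f)"
proof (rule groupI)
  fix \<phi> assume \<phi>: "\<phi> \<in> carrier (Aut f)"
  hence bij: "bij \<phi>"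
    by (simp add: Aut_def function_field_isos_def ring_iso_def function_field_def)
  define \<psi> where "\<psi> = inv_into UNIV \<phi>"
  have inv: "\<psi> (\<phi> u) = u" "\<phi> (\<psi> u) = u" for u
    using bij by (simp_all add: \<psi>_def bij_is_inj surj_f_inv_f bij_is_surj)
  have "\<psi> \<in> ring_iso (function_field f) (function_field f)"
    using \<phi> ring_iso_set_sym[OF cring.axioms(1)[OF function_field_cring], of \<phi> f "function_field f"]
    by (simp add: Aut_def function_field_isos_def \<psi>_def function_field_def)
  moreover have "\<psi> (const c) = const c" for c
    using \<phi> inv(1)[of "const c"] by (simp add: Aut_def function_field_isos_def)
  ultimately show "\<exists>\<psi>\<in>carrier (Aut f). \<psi> \<otimes>\<^bsub>Aut f\<^esub> \<phi> = \<one>\<^bsub>Aut f\<^esub>"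
    using inv by (intro bexI[of _ \<psi>]) (auto simp: Aut_def function_field_isos_def)
qed (auto simp: Aut_def function_field_isos_def ring_iso_set_trans intro: ring_iso_set_refl)

lemma group_dihedral_group:
  assumes "n > 0"
  shows "group (dihedral_group n)"
proof (rule groupI)
  fix u assume u: "u \<in> carrier (dihedral_group n)"
  obtain i b where ib: "u = (i, b)" by fastforce
  show "\<exists>v\<in>carrier (dihedral_group n). v \<otimes>\<^bsub>dihedral_group n\<^esub> u = \<one>\<^bsub>dihedral_group n\<^esub>"
    using assms
    by (intro bexI[of _ "((if b then i else - i) mod int n, b)"])
       (auto simp: dihedral_group_def ib mod_simps)
qed (use assms in \<open>auto simp: dihedral_group_def mod_simps algebra_simps split: if_splits\<close>)

lemma order_dihedral_group: "Coset.order (dihedral_group n) = 2 * n"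
  by (simp add: Coset.order_def dihedral_group_def card_cartesian_product)

end

theory Submission
  imports Defs
begin

text \<open>
  An automorphism of the function field pulls the differentials \<open>dX/Y\<close> and \<open>X dX/Y\<close> back to
  differentials without poles. Expanding along \<open>X = a + s\<^sup>2\<close> and \<open>X = s\<^sup>-\<^sup>2\<close>, one finds that
  these have the form \<open>R dX/Y\<close> with \<open>deg R \<le> 1\<close>; the quotient of the two pullbacks, which is
  the image of \<open>X\<close>, is therefore a Moebius transformation, and the automorphisms are the pairs
  \<open>(A, e)\<close> such that the substitution \<open>A\<close> multiplies the sextic by \<open>e\<^sup>2\<close>.

  In \<open>D\<^sub>8\<close> the hyperelliptic involution, being central, is a square, and \<open>D\<^sub>1\<^sub>2\<close> has an element
  of order 3. Diagonalising the corresponding \<open>A\<close> makes the sextic odd, respectively a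
  polynomial in \<open>X\<^sup>3\<close>, and a scaling leads to one parameter \<open>t\<close>. In terms of \<open>t\<close> the numerator
  and the denominator of the two formulas have a common factor \<open>(9 - 100 t)\<^sup>2\<close>, respectively
  \<open>(1 + 50 t)\<^sup>2\<close>, whose zeros are the parameters of curves with more automorphisms.
\<close>

subsection \<open>Evaluation of rational functions\<close>

text \<open>Points of the curve are not constructed. A point is replaced by a ring homomorphism from
  the function field to Laurent series in s, and orders of differentials become subdegrees. The even
  substitutions a + s^2 and s^-2 make f a square along every test branch, and a parity argument
  makes up for the doubled parameter.

  The invariants are sums over permuted brackets of an arbitrary factorisation. Each summand is a
  regular graph on six vertices; by regularity a change of coordinates, of the order of the roots or
  of the scaling of the factors acts by one weighted scalar. Hence the roots of a normal form may
  replace those of f.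

  Both families pass through the curves Y^2 = X^6 + 1 and Y^2 = X^5 + X, whose groups have order 24
  and 48. In each family one of them is lost in the scaling to one parameter, as b = 0, and the
  other sits at the double zero of the denominator, t = 9/100 or t = -1/50. The formulas read 0/0
  there.\<close>

definition eval_poly :: "('k::zero \<Rightarrow> 'l::comm_semiring_0) \<Rightarrow> 'l \<Rightarrow> 'k poly \<Rightarrow> 'l" where
  "eval_poly h u p = poly (map_poly h p) u"

definition repr :: "'k::field poly fract \<Rightarrow> 'k poly \<times> 'k poly" where
  "repr q = (SOME (a, b). b \<noteq> 0 \<and> q = to_fract a / to_fract b)"

text \<open>The value can depend on the representative chosen by \<open>repr\<close>;
  \<open>ev_quotient\<close> removes this dependence once \<open>u\<close> is a root of no non-zero
  polynomial.\<close>

definition eval_fract :: "('k::field \<Rightarrow> 'l::field) \<Rightarrow> 'l \<Rightarrow> 'k poly fract \<Rightarrow> 'l" where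
  "eval_fract h u q = eval_poly h u (fst (repr q)) / eval_poly h u (snd (repr q))"

lemma fract_poly_cases:
  fixes q :: "'k::field poly fract"
  obtains a b where "b \<noteq> 0" "q = to_fract a / to_fract b"
  by (metis Fract_conv_to_fract Fract_cases)

lemma repr:
  "snd (repr q) \<noteq> 0" "to_fract (fst (repr q)) / to_fract (snd (repr q)) = q"
proof -
  obtain a b where "b \<noteq> 0" "q = to_fract a / to_fract b" by (rule fract_poly_cases)
  hence "\<exists>x. case x of (a, b) \<Rightarrow> b \<noteq> 0 \<and> q = to_fract a / to_fract b" by blast
  hence "case repr q of (a, b) \<Rightarrow> b \<noteq> 0 \<and> q = to_fract a / to_fract b"
    unfolding repr_def by (rule someI_ex)
  thus "snd (repr q) \<noteq> 0" "to_fract (fst (repr q)) / to_fract (snd (repr q)) = q"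
    by (cases "repr q"; simp)+
qed

locale const_embedding =
  fixes h :: "'k::field \<Rightarrow> 'l::field"
  assumes h_add: "h (a + b) = h a + h b"
    and h_mult: "h (a * b) = h a * h b"
    and h_1: "h 1 = 1"
begin

lemma h_0 [simp]: "h 0 = 0"
  by (metis add.right_neutral add_cancel_right_right h_add)

lemma h_minus: "h (- a) = - h a"
  using h_add[of a "- a"] by (simp add: eq_neg_iff_add_eq_0 add.commute)

lemma h_eq_0_iff [simp]: "h a = 0 \<longleftrightarrow> a = 0"
  using h_mult[of a "inverse a"] h_1 by (cases "a = 0") auto

lemma eval_poly_0 [simp]: "eval_poly h u 0 = 0"
  by (simp add: eval_poly_def)

lemma eval_poly_pCons [simp]: "eval_poly h u (pCons a p) = h a + u * eval_poly h u p"
  by (simp add: eval_poly_def map_poly_pCons)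

lemma eval_poly_1 [simp]: "eval_poly h u 1 = 1"
  by (simp add: one_pCons h_1)

lemma eval_poly_add: "eval_poly h u (p + q) = eval_poly h u p + eval_poly h u q"
  by (induction p q rule: poly_induct2) (simp_all add: h_add algebra_simps)

lemma eval_poly_smult: "eval_poly h u (smult c p) = h c * eval_poly h u p"
  by (induction p) (simp_all add: h_mult algebra_simps)

lemma eval_poly_mult: "eval_poly h u (p * q) = eval_poly h u p * eval_poly h u q"
  by (induction p) (simp_all add: eval_poly_add eval_poly_smult algebra_simps)

lemma eval_poly_prod: "eval_poly h u (\<Prod>i\<in>A. p i) = (\<Prod>i\<in>A. eval_poly h u (p i))"
  by (induction A rule: infinite_finite_induct) (simp_all add: eval_poly_mult)

lemma eval_poly_sum: "eval_poly h u (\<Sum>i\<in>A. p i) = (\<Sum>i\<in>A. eval_poly h u (p i))"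
  by (induction A rule: infinite_finite_induct) (simp_all add: eval_poly_add)

end

text \<open>Over an algebraically closed field it is enough to avoid the constants: a non-zero
  polynomial splits into linear factors, none of which vanishes at \<open>u\<close>. Evaluation at
  \<open>u\<close> then extends to an embedding of the field k(X). It is applied to Laurent series
  and to Moebius transforms of X.\<close>

locale transcendental_point = const_embedding h
  for h :: "'k::alg_closed_field \<Rightarrow> 'l::field" +
  fixes u :: 'l
  assumes u: "u \<noteq> h c"
begin

abbreviation "ev \<equiv> eval_fract h u"

lemma eval_poly_eq_0_iff [simp]: "eval_poly h u p = 0 \<longleftrightarrow> p = 0"
proof -
  have "eval_poly h u p \<noteq> 0" if "p \<noteq> 0" for p
    using that
  proof (induction "degree p" arbitrary: p rule: less_induct)
    case less
    show ?case
    proof (cases "degree p = 0")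
      case True
      then obtain c where "p = [:c:]" by (rule degree_eq_zeroE)
      thus ?thesis using less.prems by simp
    next
      case False
      then obtain r where "poly p r = 0" using alg_closed_imp_poly_has_root[of p] by blast
      then obtain q where q: "p = [:- r, 1:] * q" by (auto simp: poly_eq_0_iff_dvd dvd_def)
      have "eval_poly h u [:- r, 1:] \<noteq> 0"
        using u[of r] by (simp add: h_minus h_1)
      moreover have "q \<noteq> 0" "degree q < degree p"
        using less.prems unfolding q by (auto simp: degree_mult_eq simp del: mult_pCons_left)
      ultimately show ?thesis using less.hyps[of q] by (simp add: q eval_poly_mult del: mult_pCons_left)
    qed
  qed
  thus ?thesis by auto
qed

lemma ev_quotient:
  assumes "b \<noteq> 0"
  shows "ev (to_fract a / to_fract b) = eval_poly h u a / eval_poly h u b"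
proof -
  define q where "q = to_fract a / to_fract b"
  have "to_fract (fst (repr q) * b) = to_fract (a * snd (repr q))"
    using assms repr[of q] q_def by (simp add: frac_eq_eq)
  hence "eval_poly h u (fst (repr q)) * eval_poly h u b = eval_poly h u a * eval_poly h u (snd (repr q))"
    by (metis eval_poly_mult to_fract_eq_iff)
  thus ?thesis
    using assms repr(1)[of q] by (simp add: eval_fract_def q_def[symmetric] frac_eq_eq)
qed

lemma ev_to_fract [simp]: "ev (to_fract p) = eval_poly h u p"
  using ev_quotient[of 1 p] by simp

lemma ev_0 [simp]: "ev 0 = 0" and ev_1 [simp]: "ev 1 = 1"
  using ev_to_fract[of 0] ev_to_fract[of 1] by (simp_all del: ev_to_fract)

lemma ev_mult: "ev (p * q) = ev p * ev q"
proof -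
  obtain a b where "b \<noteq> 0" "p = to_fract a / to_fract b" by (rule fract_poly_cases)
  moreover obtain c d where "d \<noteq> 0" "q = to_fract c / to_fract d" by (rule fract_poly_cases)
  ultimately show ?thesis
    using ev_quotient[of "b * d" "a * c"] by (simp add: ev_quotient eval_poly_mult)
qed

lemma ev_add: "ev (p + q) = ev p + ev q"
proof -
  obtain a b where ab: "b \<noteq> 0" "p = to_fract a / to_fract b" by (rule fract_poly_cases)
  obtain c d where cd: "d \<noteq> 0" "q = to_fract c / to_fract d" by (rule fract_poly_cases)
  have "p + q = to_fract (a * d + c * b) / to_fract (b * d)"
    using ab cd by (simp add: add_frac_eq)
  thus ?thesis
    using ab cd ev_quotient[of "b * d" "a * d + c * b"]
    by (simp add: ev_quotient eval_poly_mult eval_poly_add add_frac_eq)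
qed

lemma ev_eq_0_iff [simp]: "ev q = 0 \<longleftrightarrow> q = 0"
  using repr[of q] by (auto simp: eval_fract_def)

lemma ev_divide: "ev (p / q) = ev p / ev q"
proof (cases "q = 0")
  case False
  thus ?thesis using ev_mult[of "p / q" q] by (simp add: field_simps)
qed simp

lemma ev_power: "ev (q ^ n) = ev q ^ n"
  by (induction n) (simp_all add: ev_mult)

end

text \<open>Constants and X generate k(X); composites of substitutions are identified in this
  way.\<close>

lemma (in transcendental_point) ev_unique:
  assumes add: "\<And>p q. g (p + q) = g p + g q" and mult: "\<And>p q. g (p * q) = g p * g q"
    and const: "\<And>c. g (to_fract [:c:]) = h c" and X: "g (to_fract [:0, 1:]) = u"
  shows "g q = ev q"
proof -
  have poly: "g (to_fract p) = eval_poly h u p" for p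
  proof (induction p)
    case 0
    show ?case by (metis add add.right_neutral add_cancel_right_right eval_poly_0 to_fract_0)
  next
    case (pCons a p)
    have "to_fract (pCons a p) = to_fract [:a:] + to_fract [:0, 1:] * to_fract p"
      by (simp flip: to_fract_add to_fract_mult)
    thus ?case by (simp only: add mult const X pCons.IH eval_poly_pCons)
  qed
  obtain a b where ab: "b \<noteq> 0" "q = to_fract a / to_fract b" by (rule fract_poly_cases)
  have "g q * eval_poly h u b = eval_poly h u a"
    using mult[of q "to_fract b"] ab by (simp add: poly)
  thus ?thesis
    by (simp add: ab(2) ev_quotient[OF ab(1)] ab(1) nonzero_eq_divide_eq)
qed

subsection \<open>Differentials without poles\<close>

lemma square_free_order_le_1:
  fixes f :: "'k::field poly"
  assumes "squarefree f" "f \<noteq> 0"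
  shows "Polynomial.order a f \<le> 1"
proof -
  have "\<not> [:- a, 1:] ^ 2 dvd f"
    using squarefreeD[OF assms(1), of "[:- a, 1:]"] by (auto simp: is_unit_iff_degree)
  thus ?thesis using assms(2) by (simp add: Polynomial.order_divides)
qed

text \<open>Take a denominator of least degree: a common root could be cancelled, giving a smaller
  one. Absence of common roots is the form of coprimality that the order arguments use.\<close>

lemma fract_poly_cases_coprime:
  fixes q :: "'k::field poly fract"
  obtains a b where "b \<noteq> 0" "q = to_fract a / to_fract b" "\<And>r. poly b r = 0 \<Longrightarrow> poly a r \<noteq> 0"
proof -
  define P where "P b \<longleftrightarrow> b \<noteq> 0 \<and> (\<exists>a. q = to_fract a / to_fract b)" for b
  have "\<exists>b. P b" unfolding P_def by (rule fract_poly_cases[of q]) blast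
  then obtain b where b: "P b" "\<And>b'. P b' \<Longrightarrow> degree b \<le> degree b'"
    using ex_has_least_nat[of P _ degree] by blast
  then obtain a where a: "b \<noteq> 0" "q = to_fract a / to_fract b" by (auto simp: P_def)
  have "poly a r \<noteq> 0" if r: "poly b r = 0" for r
  proof
    assume "poly a r = 0"
    then obtain a' where a': "a = [:- r, 1:] * a'" by (auto simp: poly_eq_0_iff_dvd dvd_def)
    obtain b' where b': "b = [:- r, 1:] * b'" using r by (auto simp: poly_eq_0_iff_dvd dvd_def)
    have b'0: "b' \<noteq> 0" using a(1) b' by auto
    have "q = to_fract a' / to_fract b'"
      unfolding a(2) a' b' to_fract_mult by (rule mult_divide_mult_cancel_left) simp
    hence "degree b \<le> degree b'" using b(2)[of b'] b'0 by (auto simp: P_def)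
    thus False using b'0 unfolding b' by (simp add: degree_mult_eq del: mult_pCons_left)
  qed
  thus ?thesis using that a by blast
qed

section \<open>Orders along Laurent series branches\<close>

global_interpretation fls_const: const_embedding fls_const
  by standard (simp_all add: fls_plus_const)

lemma fls_transcendental:
  assumes "\<And>c. u \<noteq> fls_const c"
  shows "transcendental_point fls_const u"
  using assms by unfold_locales

lemma fls_subdegree_neq_0_imp_transcendental:
  assumes "fls_subdegree (u - fls_const a) \<noteq> 0"
  shows "transcendental_point fls_const u"
proof (rule fls_transcendental)
  fix c show "u \<noteq> fls_const c" using assms by (metis fls_const_subdegree fls_minus_const)
qed

text \<open>In Horner form the term with the higher power of the pole strictly dominates the
  constant, so nothing cancels.\<close>

lemma fls_subdegree_eval_poly_pole:
  fixes u :: "'k::alg_closed_field fls"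
  assumes "fls_subdegree u < 0"
  shows "fls_subdegree (eval_poly fls_const u p) = int (degree p) * fls_subdegree u"
proof -
  interpret transcendental_point fls_const u
    using assms fls_subdegree_neq_0_imp_transcendental[of u 0] by simp
  show ?thesis
  proof (induction p)
    case (pCons a p)
    show ?case
    proof (cases "p = 0")
      case False
      have u0: "u \<noteq> 0" using assms by auto
      hence *: "fls_subdegree (u * eval_poly fls_const u p) = int (Suc (degree p)) * fls_subdegree u"
        using False pCons.IH by (simp add: algebra_simps)
      moreover have "int (Suc (degree p)) * fls_subdegree u < 0"
        using assms by (simp add: mult_pos_neg del: of_nat_Suc)
      ultimately have "fls_subdegree (u * eval_poly fls_const u p) < fls_subdegree (fls_const a)"
        by simp
      hence "fls_subdegree (fls_const a + u * eval_poly fls_const u p) =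
          fls_subdegree (u * eval_poly fls_const u p)"
        using u0 False by (intro fls_subdegree_add_eq2) auto
      thus ?thesis using * False by simp
    qed simp
  qed simp
qed

text \<open>For r different from a the series u - r has order 0, since u tends to a; so among the
  linear factors only X - a contributes.\<close>

lemma fls_subdegree_eval_poly_point:
  fixes u :: "'k::alg_closed_field fls"
  assumes pos: "fls_subdegree (u - fls_const a) > 0" and p: "p \<noteq> 0"
  shows "fls_subdegree (eval_poly fls_const u p) =
    int (Polynomial.order a p) * fls_subdegree (u - fls_const a)"
proof -
  interpret transcendental_point fls_const u
    using pos fls_subdegree_neq_0_imp_transcendental[of u a] by simp
  show ?thesis using p
  proof (induction "degree p" arbitrary: p rule: less_induct)
    case less
    show ?case
    proof (cases "degree p = 0")
      case True
      then obtain c where c: "p = [:c:]" by (rule degree_eq_zeroE)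
      have "Polynomial.order a p = 0" using less.prems c by (intro order_0I) auto
      thus ?thesis using c by simp
    next
      case False
      then obtain r where "poly p r = 0" using alg_closed_imp_poly_has_root[of p] by blast
      then obtain q where q: "p = [:- r, 1:] * q" by (auto simp: poly_eq_0_iff_dvd dvd_def)
      have q0: "q \<noteq> 0" "degree q < degree p"
        using less.prems unfolding q by (auto simp: degree_mult_eq simp del: mult_pCons_left)
      have lin: "fls_subdegree (u - fls_const r) =
          int (Polynomial.order a [:- r, 1:]) * fls_subdegree (u - fls_const a)"
      proof (cases "r = a")
        case True
        thus ?thesis using order_power_n_n[of a 1] by simp
      next
        case False
        have "fls_subdegree ((u - fls_const a) + fls_const (a - r)) = fls_subdegree (fls_const (a - r))"
          using False pos by (intro fls_subdegree_add_eq2) auto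
        moreover have "(u - fls_const a) + fls_const (a - r) = u - fls_const r"
          by (simp flip: fls_minus_const)
        moreover have "Polynomial.order a [:- r, 1:] = 0" using False by (intro order_0I) auto
        ultimately show ?thesis by simp
      qed
      have ur: "u - fls_const r \<noteq> 0" using transcendental_point.u[OF transcendental_point_axioms] by auto
      have "eval_poly fls_const u p = (u - fls_const r) * eval_poly fls_const u q"
        by (simp add: q fls_const.eval_poly_mult del: mult_pCons_left)
      moreover have "Polynomial.order a p = Polynomial.order a [:- r, 1:] + Polynomial.order a q"
        unfolding q using q0 by (intro order_mult) (simp del: mult_pCons_left)
      ultimately have "fls_subdegree (eval_poly fls_const u p) =
          int (Polynomial.order a [:- r, 1:]) * fls_subdegree (u - fls_const a) +
          int (Polynomial.order a q) * fls_subdegree (u - fls_const a)"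
        "Polynomial.order a p = Polynomial.order a [:- r, 1:] + Polynomial.order a q"
        using lin less.hyps[OF q0(2,1)] ur q0 by simp_all
      thus ?thesis by (simp add: distrib_right)
    qed
  qed
qed

text \<open>Split off the even power of the variable. What remains has a non-zero constant term,
  whose square root in k extends to a root of the power series.\<close>

lemma fls_has_sqrt:
  fixes g :: "'k::{alg_closed_field, field_char_0} fls"
  assumes "even (fls_subdegree g)"
  shows "\<exists>v. v\<^sup>2 = g"
proof (cases "g = 0")
  case False
  define s where "s = fls_base_factor_to_fps g"
  obtain m where m: "fls_subdegree g = 2 * m" using assms by blast
  have s0: "s $ 0 \<noteq> 0" using False unfolding s_def by (rule fls_base_factor_to_fps_base)
  have "\<exists>r. r ^ 2 = s $ 0" using nth_root_exists[of 2 "s $ 0"] by auto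
  then obtain r where r: "r ^ 2 = s $ 0" by blast
  have "fps_radical (\<lambda>_ _. r) (Suc 1) s ^ (Suc 1) = s"
    using power_radical[OF s0, of "\<lambda>_ _. r" 1] r by (simp add: numeral_2_eq_2)
  then obtain t where t: "t * t = s" by (auto simp: power2_eq_square)
  have "fls_shift (- m) (fps_to_fls t) ^ 2 = fls_shift (- m - m) (fps_to_fls (t * t))"
    by (simp add: power2_eq_square fls_shifted_times_simps fls_times_fps_to_fls)
  also have "\<dots> = g"
    using fls_conv_base_factor_to_fps_shift_subdegree[of g] by (simp add: t m s_def)
  finally show ?thesis by blast
qed (auto intro: exI[of _ 0])

text \<open>
  The forms \<open>dX/Y\<close> and \<open>X dX/Y\<close> have no poles: along any branch \<open>(u, v)\<close> of the curve they
  are power series.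
\<close>

lemma holomorphic_differentials:
  fixes f :: "'k::{alg_closed_field, field_char_0} poly"
  assumes f: "genus2 f" and v: "v\<^sup>2 = eval_poly fls_const u f" and u: "\<And>c. u \<noteq> fls_const c"
  shows "fls_subdegree (fls_deriv u / v) \<ge> 0" "fls_subdegree (u * (fls_deriv u / v)) \<ge> 0"
proof -
  interpret transcendental_point fls_const u using u by (rule fls_transcendental)
  have f0: "f \<noteq> 0" using f by (auto simp: genus2_def)
  have v0: "v \<noteq> 0" using v f0 by auto
  have u0: "u \<noteq> 0" using u[of 0] by auto
  have du: "fls_deriv u \<noteq> 0" using u by (auto simp: fls_deriv_eq_0_iff)
  have sv: "2 * fls_subdegree v = fls_subdegree (eval_poly fls_const u f)"
    using fls_subdegree_pow[of v 2] v by simp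
  have d1: "fls_subdegree (fls_deriv u / v) = fls_subdegree (fls_deriv u) - fls_subdegree v"
    using du v0 by (rule fls_divide_subdegree)
  have d2: "fls_subdegree (u * (fls_deriv u / v)) = fls_subdegree u + (fls_subdegree (fls_deriv u) - fls_subdegree v)"
    using du v0 u0 d1 by (subst fls_subdegree_mult) auto
  have "fls_subdegree (fls_deriv u) - fls_subdegree v \<ge> 0 \<and>
      fls_subdegree u + (fls_subdegree (fls_deriv u) - fls_subdegree v) \<ge> 0"
  proof (cases "fls_subdegree u < 0")
    case True
    have "fls_subdegree (fls_deriv u) = fls_subdegree u - 1" using True by (intro fls_subdegree_deriv) simp
    moreover have "2 * fls_subdegree v = int (degree f) * fls_subdegree u"
      using sv fls_subdegree_eval_poly_pole[OF True, of f] by simp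
    moreover have "degree f = 5 \<or> degree f = 6" using f by (auto simp: genus2_def)
    ultimately have "fls_subdegree (fls_deriv u) = fls_subdegree u - 1"
      "2 * fls_subdegree v = 5 * fls_subdegree u \<or> 2 * fls_subdegree v = 6 * fls_subdegree u" by auto
    \<comment> \<open>For degree 5 the equation for \<open>v\<close> forces the order of
      \<open>u\<close> to be even, hence at most -2; this is what the second inequality
      needs.\<close>
    thus ?thesis using True by presburger
  next
    case False
    define a where "a = fls_nth u 0"
    define m where "m = fls_subdegree (u - fls_const a)"
    have "u - fls_const a \<noteq> 0" using u by simp
    hence m: "m > 0" unfolding m_def using False
      by (intro fls_subdegree_greaterI) (auto simp: a_def)
    have "fls_deriv (u - fls_const a) = fls_deriv u" by simp
    hence "fls_subdegree (fls_deriv u) = m - 1"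
      using m fls_subdegree_deriv[of "u - fls_const a"] unfolding m_def by simp
    moreover have "2 * fls_subdegree v = int (Polynomial.order a f) * m"
      using sv fls_subdegree_eval_poly_point[of u a f] m f0 unfolding m_def by simp
    moreover have "Polynomial.order a f = 0 \<or> Polynomial.order a f = 1"
      using square_free_order_le_1[of f a] f f0 by (auto simp: genus2_def)
    ultimately have "fls_subdegree (fls_deriv u) = m - 1" "2 * fls_subdegree v = 0 \<or> 2 * fls_subdegree v = m"
      by auto
    \<comment> \<open>At a root a of f the equation \<open>2 * fls_subdegree v = m\<close> makes m
      even, so m - 1 >= m / 2.\<close>
    thus ?thesis using False m by presburger
  qed
  thus "fls_subdegree (fls_deriv u / v) \<ge> 0" "fls_subdegree (u * (fls_deriv u / v)) \<ge> 0"
    using d1 d2 by simp_all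
qed

text \<open>The even substitutions make the order of every polynomial even, so f has a square root
  along each of them, also at the roots of f and, for odd degree, at infinity. Ramified and
  unramified points are treated alike.\<close>

definition branch_x :: "'k::field fls \<Rightarrow> bool" where
  "branch_x \<xi> \<longleftrightarrow> \<xi> = fls_X_inv ^ 2 \<or> (\<exists>a. \<xi> = fls_const a + fls_X ^ 2)"

lemma branch_x_cases:
  fixes \<xi> :: "'k::{alg_closed_field, field_char_0} fls"
  assumes "branch_x \<xi>"
  shows "transcendental_point fls_const \<xi>" "even (fls_subdegree (eval_poly fls_const \<xi> p))"
    "fls_deriv \<xi> \<noteq> 0"
proof -
  obtain a where *: "fls_subdegree (\<xi> - fls_const a) \<noteq> 0" "even (fls_subdegree (eval_poly fls_const \<xi> p))"
  proof (cases "\<xi> = fls_X_inv ^ 2")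
    case True
    thus ?thesis using that[of 0] fls_subdegree_eval_poly_pole[of \<xi> p] by simp
  next
    case False
    then obtain a where "\<xi> = fls_const a + fls_X ^ 2" using assms by (auto simp: branch_x_def)
    thus ?thesis using that[of a] fls_subdegree_eval_poly_point[of \<xi> a p] by (cases "p = 0") auto
  qed
  show t: "transcendental_point fls_const \<xi>" using *(1) by (rule fls_subdegree_neq_0_imp_transcendental)
  show "even (fls_subdegree (eval_poly fls_const \<xi> p))" by fact
  show "fls_deriv \<xi> \<noteq> 0"
    using transcendental_point.u[OF t] by (auto simp: fls_deriv_eq_0_iff)
qed

lemma fls_subdegree_add_nonneg:
  assumes "fls_subdegree (w :: 'k::group_add fls) \<ge> 0" "fls_subdegree w' \<ge> 0"
  shows "fls_subdegree (w + w') \<ge> 0"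
  using fls_plus_subdegree[of w w'] assms by (cases "w + w' = 0") auto

text \<open>Both square roots \<open>\<eta>\<close> and \<open>- \<eta>\<close> are allowed, so P dX
  and Q Y dX are separately free of poles. The finite branches then force P and Q f to be
  polynomials, and the branch at infinity bounds their degrees: no non-zero P remains, and Q Y dX =
  R dX/Y with deg R <= 1.\<close>

lemma regular_differential_form:
  fixes f :: "'k::{alg_closed_field, field_char_0} poly"
  assumes f: "genus2 f"
    and reg: "\<And>\<xi> \<eta>. branch_x \<xi> \<Longrightarrow> \<eta>\<^sup>2 = eval_poly fls_const \<xi> f \<Longrightarrow>
      fls_subdegree ((eval_fract fls_const \<xi> P + eval_fract fls_const \<xi> Q * \<eta>) * fls_deriv \<xi>) \<ge> 0"
  shows "P = 0 \<and> (\<exists>R. degree R \<le> 1 \<and> Q = to_fract R / to_fract f)"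
proof -
  have f0: "f \<noteq> 0" using f by (auto simp: genus2_def)
  have sub2: "fls_subdegree (2 * w) = fls_subdegree w" for w :: "'k fls"
    by (cases "w = 0") (simp_all add: fls_subdegree_of_nat[of 2, simplified])
  have parts: "fls_subdegree (eval_fract fls_const \<xi> P * fls_deriv \<xi>) \<ge> 0"
      "fls_subdegree (eval_fract fls_const \<xi> Q * \<eta> * fls_deriv \<xi>) \<ge> 0"
    if \<xi>: "branch_x \<xi>" and \<eta>: "\<eta>\<^sup>2 = eval_poly fls_const \<xi> f" for \<xi> \<eta>
  proof -
    let ?P = "eval_fract fls_const \<xi> P" and ?Q = "eval_fract fls_const \<xi> Q"
    have r1: "fls_subdegree ((?P + ?Q * \<eta>) * fls_deriv \<xi>) \<ge> 0" using reg[OF \<xi> \<eta>] .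
    have r2: "fls_subdegree ((?P + ?Q * (- \<eta>)) * fls_deriv \<xi>) \<ge> 0" using reg[OF \<xi>, of "- \<eta>"] \<eta> by simp
    have "(?P + ?Q * \<eta>) * fls_deriv \<xi> + (?P + ?Q * (- \<eta>)) * fls_deriv \<xi> = 2 * (?P * fls_deriv \<xi>)"
      by (simp add: algebra_simps)
    thus "fls_subdegree (?P * fls_deriv \<xi>) \<ge> 0"
      using fls_subdegree_add_nonneg[OF r1 r2] sub2 by simp
    have "fls_subdegree (- ((?P + ?Q * (- \<eta>)) * fls_deriv \<xi>)) \<ge> 0" using r2 by simp
    moreover have "(?P + ?Q * \<eta>) * fls_deriv \<xi> + - ((?P + ?Q * (- \<eta>)) * fls_deriv \<xi>) = 2 * (?Q * \<eta> * fls_deriv \<xi>)"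
      by (simp add: algebra_simps)
    ultimately show "fls_subdegree (?Q * \<eta> * fls_deriv \<xi>) \<ge> 0"
      using fls_subdegree_add_nonneg[OF r1] sub2 by metis
  qed
  have sqrt: "\<exists>\<eta>. \<eta>\<^sup>2 = eval_poly fls_const \<xi> f" if "branch_x \<xi>" for \<xi>
    using fls_has_sqrt branch_x_cases(2)[OF that] by blast
  have deriv_pole: "fls_subdegree (fls_deriv (fls_X_inv ^ 2 :: 'k fls)) = -3"
    using fls_subdegree_deriv[of "fls_X_inv ^ 2 :: 'k fls"] by simp
  have deriv_point: "fls_subdegree (fls_deriv (fls_const a + fls_X ^ 2 :: 'k fls)) = 1" for a
    using fls_subdegree_deriv[of "fls_X ^ 2 :: 'k fls"] by simp
  have pole: "branch_x (fls_X_inv ^ 2)" and point: "branch_x (fls_const a + fls_X ^ 2)" for a :: 'k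
    by (auto simp: branch_x_def)
  have sub_fract: "fls_subdegree (eval_fract fls_const \<xi> (to_fract n / to_fract d)) =
      fls_subdegree (eval_poly fls_const \<xi> n) - fls_subdegree (eval_poly fls_const \<xi> d)"
    if "branch_x \<xi>" "n \<noteq> 0" "d \<noteq> 0" for \<xi> and n d :: "'k poly"
  proof -
    interpret transcendental_point fls_const \<xi> using branch_x_cases(1)[OF that(1)] .
    show ?thesis using that by (simp add: ev_quotient fls_divide_subdegree)
  qed
  have sub_pole: "fls_subdegree (eval_poly fls_const (fls_X_inv ^ 2) p) = - 2 * int (degree p)" for p :: "'k poly"
    using fls_subdegree_eval_poly_pole[of "fls_X_inv ^ 2" p] by simp
  have sub_point: "fls_subdegree (eval_poly fls_const (fls_const a + fls_X ^ 2) p) = 2 * int (Polynomial.order a p)"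
    if "p \<noteq> 0" for p :: "'k poly" and a
    using fls_subdegree_eval_poly_point[OF _ that, of "fls_const a + fls_X ^ 2" a] by simp
  have const: "degree d = 0"
    if d: "d \<noteq> 0" "n \<noteq> 0" "\<And>r. poly d r = 0 \<Longrightarrow> poly n r \<noteq> 0" "\<And>a. Polynomial.order a d \<le> Polynomial.order a n"
    for n d :: "'k poly"
  proof (rule ccontr)
    assume "degree d \<noteq> 0"
    then obtain r where r: "poly d r = 0" using alg_closed_imp_poly_has_root[of d] by auto
    hence "Polynomial.order r d \<noteq> 0" "Polynomial.order r n = 0"
      using d by (auto simp: order_root)
    thus False using d(4)[of r] by simp
  qed

  have "P = 0"
  proof (rule ccontr)
    assume P: "P \<noteq> 0"
    obtain n d where nd: "d \<noteq> 0" "P = to_fract n / to_fract d" "\<And>r. poly d r = 0 \<Longrightarrow> poly n r \<noteq> 0"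
      using fract_poly_cases_coprime[of P] by blast
    have n0: "n \<noteq> 0" using P nd by auto
    have sub: "fls_subdegree (eval_poly fls_const \<xi> n) - fls_subdegree (eval_poly fls_const \<xi> d) + fls_subdegree (fls_deriv \<xi>) \<ge> 0"
      if b: "branch_x \<xi>" for \<xi>
    proof -
      interpret transcendental_point fls_const \<xi> using branch_x_cases(1)[OF b] .
      obtain \<eta> where "\<eta>\<^sup>2 = eval_poly fls_const \<xi> f" using sqrt[OF b] by blast
      from parts(1)[OF b this] show ?thesis
        using P branch_x_cases(3)[OF b] sub_fract[OF b n0 nd(1)] by (simp add: nd(2)[symmetric])
    qed
    \<comment> \<open>The derivative of a + s^2 contributes only 1, while a pole of n / d would
      contribute at most -2.\<close>
    have "Polynomial.order a d \<le> Polynomial.order a n" for a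
      using sub[OF point[of a]] sub_point[OF n0, of a] sub_point[OF nd(1), of a] deriv_point[of a] by linarith
    hence "degree d = 0" using const nd n0 by blast
    thus False using sub[OF pole] sub_pole[of n] sub_pole[of d] deriv_pole by simp
  qed
  moreover have "\<exists>R. degree R \<le> 1 \<and> Q = to_fract R / to_fract f"
  proof (cases "Q = 0")
    case True
    thus ?thesis by (intro exI[of _ 0]) simp
  next
    case False
    \<comment> \<open>Q f is the factor in front of dX/Y, because Q Y dX = (Q f) dX/Y.\<close>
    obtain n d where nd: "d \<noteq> 0" "Q * to_fract f = to_fract n / to_fract d" "\<And>r. poly d r = 0 \<Longrightarrow> poly n r \<noteq> 0"
      using fract_poly_cases_coprime[of "Q * to_fract f"] by blast
    have n0: "n \<noteq> 0" using False nd f0 by auto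
    have Q: "Q = to_fract n / to_fract (d * f)" using nd(2) f0 nd(1) by (simp add: field_simps)
    have sub: "2 * (fls_subdegree (eval_poly fls_const \<xi> n) - fls_subdegree (eval_poly fls_const \<xi> d)
        + fls_subdegree (fls_deriv \<xi>)) \<ge> fls_subdegree (eval_poly fls_const \<xi> f)"
      if b: "branch_x \<xi>" for \<xi>
    proof -
      interpret transcendental_point fls_const \<xi> using branch_x_cases(1)[OF b] .
      obtain \<eta> where \<eta>: "\<eta>\<^sup>2 = eval_poly fls_const \<xi> f" using sqrt[OF b] by blast
      have \<eta>0: "\<eta> \<noteq> 0" using \<eta> f0 by auto
      have "2 * fls_subdegree \<eta> = fls_subdegree (eval_poly fls_const \<xi> f)"
        using fls_subdegree_pow[of \<eta> 2] \<eta> by simp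
      moreover have "fls_subdegree (ev Q * \<eta> * fls_deriv \<xi>) =
          fls_subdegree (eval_poly fls_const \<xi> n) - fls_subdegree (eval_poly fls_const \<xi> (d * f)) +
          fls_subdegree \<eta> + fls_subdegree (fls_deriv \<xi>)"
        using False \<eta>0 branch_x_cases(3)[OF b] sub_fract[OF b n0, of "d * f", folded Q] nd(1) f0
        by simp
      moreover have "fls_subdegree (eval_poly fls_const \<xi> (d * f)) =
          fls_subdegree (eval_poly fls_const \<xi> d) + fls_subdegree (eval_poly fls_const \<xi> f)"
        using nd(1) f0 by (simp add: fls_const.eval_poly_mult)
      moreover note parts(2)[OF b \<eta>]
      ultimately show ?thesis by presburger
    qed
    have "Polynomial.order a d \<le> Polynomial.order a n" for a
      using sub[OF point[of a]] sub_point[OF n0, of a] sub_point[OF nd(1), of a] sub_point[OF f0, of a]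
        deriv_point[of a] by presburger
    hence d0: "degree d = 0" using const nd n0 by blast
    then obtain c where c: "d = [:c:]" by (rule degree_eq_zeroE)
    have "degree f \<le> 6" using f by (auto simp: genus2_def)
    \<comment> \<open>At infinity the bound reads 2 (-2 deg n - 3) >= -2 deg f >= -12.\<close>
    hence "degree n \<le> 1" using sub[OF pole] sub_pole[of n] sub_pole[of d] sub_pole[of f] deriv_pole d0 by simp
    moreover have "Q = to_fract (smult (inverse c) n) / to_fract f"
    proof -
      have "to_fract (smult (inverse c) n) * to_fract (d * f) = to_fract n * to_fract f"
        using nd(1) c by (simp flip: to_fract_mult)
      thus ?thesis using Q nd(1) f0 by (simp add: frac_eq_eq)
    qed
    ultimately show ?thesis by (intro exI[of _ "smult (inverse c) n"]) (simp add: degree_smult_le le_trans[OF degree_smult_le])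
  qed
  ultimately show ?thesis by blast
qed

subsection \<open>Factored binary sextics\<close>

lemma linear_factorisation:
  fixes f :: "'k::alg_closed_field poly"
  assumes "f \<noteq> 0" "degree f \<le> n"
  shows "\<exists>c x z. c \<noteq> 0 \<and> f = smult c (\<Prod>m\<in>{1..n}. [:- x m, z m:])"
  using assms
proof (induction n arbitrary: f)
  case 0
  then obtain c where "f = [:c:]" by (auto elim: degree_eq_zeroE)
  thus ?case using 0 by (intro exI[of _ c]) auto
next
  case (Suc n)
  have step: "\<exists>c x z. c \<noteq> 0 \<and> [:- x0, z0:] * g = smult c (\<Prod>m\<in>{1..Suc n}. [:- x m, z m:])"
    if "g \<noteq> 0" "degree g \<le> n" for x0 z0 :: 'k and g
  proof -
    obtain c x z where c: "c \<noteq> 0" "g = smult c (\<Prod>m\<in>{1..n}. [:- x m, z m:])"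
      using Suc.IH[OF \<open>g \<noteq> 0\<close> \<open>degree g \<le> n\<close>] by blast
    have "(\<Prod>m\<in>{1..n}. [:- x m, z m:]) =
        (\<Prod>m\<in>{1..n}. [:- (x(Suc n := x0)) m, (z(Suc n := z0)) m:])"
      by (intro prod.cong) auto
    hence "[:- x0, z0:] * g = smult c (\<Prod>m\<in>{1..Suc n}. [:- (x(Suc n := x0)) m, (z(Suc n := z0)) m:])"
      unfolding c(2) by (simp add: mult.commute del: mult_pCons_left mult_pCons_right)
    thus ?thesis using c(1) by blast
  qed
  show ?case
  proof (cases "degree f \<le> n")
    case True
    \<comment> \<open>The point with x = -1 and z = 0 contributes the factor 1: the missing degree
      is a root at infinity.\<close>
    thus ?thesis using step[of f "- 1" 0] Suc.prems by (simp add: one_pCons[symmetric])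
  next
    case False
    then obtain r where "poly f r = 0" using alg_closed_imp_poly_has_root[of f] by auto
    then obtain q where q: "f = [:- r, 1:] * q" by (auto simp: poly_eq_0_iff_dvd dvd_def)
    have "q \<noteq> 0" using Suc.prems(1) q by auto
    moreover from this have "degree q \<le> n"
      using Suc.prems(2) unfolding q by (simp add: degree_mult_eq del: mult_pCons_left)
    ultimately show ?thesis using step[of q r 1] q by simp
  qed
qed

lemma sextic_factorisation:
  fixes f :: "'k::alg_closed_field poly"
  assumes "f \<noteq> 0" "degree f \<le> 6"
  obtains x z where "f = (\<Prod>m\<in>{1..6::nat}. [:- x m, z m:])"
proof -
  obtain c x z where c: "f = smult c (\<Prod>m\<in>{1..6::nat}. [:- x m, z m:])"
    using linear_factorisation[OF assms] by blast
  have split: "(\<Prod>m\<in>{1..6::nat}. p m) = p 1 * (\<Prod>m\<in>{2..6}. p m)" for p :: "nat \<Rightarrow> 'k poly"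
  proof -
    have "{1..6::nat} = insert 1 {2..6}" by auto
    thus ?thesis by simp
  qed
  have "(\<Prod>m\<in>{1..6::nat}. [:- (x(1 := c * x 1)) m, (z(1 := c * z 1)) m:]) =
      [:- (c * x 1), c * z 1:] * (\<Prod>m\<in>{2..6}. [:- x m, z m:])"
    unfolding split by (intro arg_cong2[of _ _ _ _ "(*)"] prod.cong) auto
  also have "[:- (c * x 1), c * z 1:] = smult c [:- x 1, z 1:]" by simp
  also have "smult c [:- x 1, z 1:] * (\<Prod>m\<in>{2..6}. [:- x m, z m:]) = f"
    unfolding c split by (rule mult_smult_left)
  finally have "f = (\<Prod>m\<in>{1..6::nat}. [:- (x(1 := c * x 1)) m, (z(1 := c * z 1)) m:])" ..
  thus ?thesis by (rule that)
qed

lemma order_linear_factor: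
  fixes a b :: "'k::field"
  assumes "[:a, b:] \<noteq> 0"
  shows "Polynomial.order r [:a, b:] = (if a + r * b = 0 then 1 else 0)"
proof (cases "a + r * b = 0")
  case True
  hence *: "[:a, b:] = smult b [:- r, 1:]" by (simp add: eq_neg_iff_add_eq_0 mult.commute)
  have "b \<noteq> 0" using assms True by auto
  hence "Polynomial.order r [:a, b:] = Polynomial.order r [:- r, 1:]" unfolding * by (rule order_smult)
  thus ?thesis using True order_power_n_n[of r 1] by simp
qed (auto intro: order_0I)

lemma order_prod:
  fixes p :: "nat \<Rightarrow> 'k::field poly"
  assumes "finite A" "\<And>m. m \<in> A \<Longrightarrow> p m \<noteq> 0"
  shows "Polynomial.order r (\<Prod>m\<in>A. p m) = (\<Sum>m\<in>A. Polynomial.order r (p m))"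
  using assms by (induction A rule: finite_induct) (simp_all add: order_mult)

lemma sum_le_1:
  fixes g :: "nat \<Rightarrow> nat"
  assumes "finite A" "\<And>m. g m \<le> 1" "\<And>m n. m \<in> A \<Longrightarrow> n \<in> A \<Longrightarrow> g m \<noteq> 0 \<Longrightarrow> g n \<noteq> 0 \<Longrightarrow> m = n"
  shows "(\<Sum>m\<in>A. g m) \<le> 1"
proof (cases "\<exists>m\<in>A. g m \<noteq> 0")
  case True
  then obtain m where m: "m \<in> A" "g m \<noteq> 0" by blast
  have "(\<Sum>n\<in>A. g n) = g m + (\<Sum>n\<in>A - {m}. g n)" using assms(1) m(1) by (simp add: sum.remove)
  also have "(\<Sum>n\<in>A - {m}. g n) = 0" using assms(3)[OF m(1) _ m(2)] by (intro sum.neutral) blast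
  finally show ?thesis using assms(2)[of m] by simp
qed simp

text \<open>For non-zero pairs a bracket vanishes exactly when two points (x : z) of the projective
  line coincide. Among distinct points infinity occurs at most once, so the degree is at least 5,
  and every finite root is simple.\<close>

lemma genus2_iff_brackets:
  fixes x z :: "nat \<Rightarrow> 'k::{alg_closed_field, field_char_0}"
  defines "f \<equiv> (\<Prod>m\<in>{1..6::nat}. [:- x m, z m:])"
  shows "genus2 f \<longleftrightarrow> (\<forall>m\<in>{1..6}. \<forall>n\<in>{1..6}. m \<noteq> n \<longrightarrow> bracket x z m n \<noteq> 0)"
proof
  assume g: "genus2 f"
  have f0: "f \<noteq> 0" using g by (auto simp: genus2_def)
  show "\<forall>m\<in>{1..6}. \<forall>n\<in>{1..6}. m \<noteq> n \<longrightarrow> bracket x z m n \<noteq> 0"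
  proof (intro ballI impI)
    fix m n :: nat assume mn: "m \<in> {1..6}" "n \<in> {1..6}" "m \<noteq> n"
    show "bracket x z m n \<noteq> 0"
    proof
      assume "bracket x z m n = 0"
      hence eq: "x m * z n = x n * z m" by (simp add: bracket_def)
      define R where "R = (\<Prod>k\<in>{1..6} - {m} - {n}. [:- x k, z k:])"
      have f: "f = [:- x m, z m:] * ([:- x n, z n:] * R)"
      proof -
        have "f = [:- x m, z m:] * (\<Prod>k\<in>{1..6} - {m}. [:- x k, z k:])"
          unfolding f_def using mn(1) by (rule prod.remove[OF finite_atLeastAtMost])
        also have "(\<Prod>k\<in>{1..6} - {m}. [:- x k, z k:]) = [:- x n, z n:] * R"
          unfolding R_def using mn by (intro prod.remove) auto
        finally show ?thesis .
      qed
      have nz: "x m \<noteq> 0 \<or> z m \<noteq> 0" "x n \<noteq> 0 \<or> z n \<noteq> 0" "R \<noteq> 0"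
        using f0 unfolding f by (auto simp del: mult_pCons_left)
      show False
      proof (cases "z m = 0")
        case True
        \<comment> \<open>Infinity would be a double root: two factors without X leave degree at
          most 4.\<close>
        hence "z n = 0" using nz eq by auto
        hence "degree f = degree R" using True nz unfolding f by simp
        also have "degree R \<le> sum (degree \<circ> (\<lambda>k. [:- x k, z k:])) ({1..6} - {m} - {n})"
          unfolding R_def by (intro degree_prod_sum_le) auto
        also have "\<dots> \<le> sum (\<lambda>_. 1) ({1..6} - {m} - {n})" by (intro sum_mono) auto
        also have "\<dots> = 4" using mn by simp
        finally show False using g by (auto simp: genus2_def)
      next
        case False
        have n: "[:- x n, z n:] = smult (z n / z m) [:- x m, z m:]" using eq False by (simp add: field_simps)
        have "f = [:- x m, z m:] ^ 2 * smult (z n / z m) R"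
          unfolding f n power2_eq_square by (simp only: mult_smult_left mult_smult_right mult.assoc)
        hence "[:- x m, z m:] ^ 2 dvd f" by (rule dvdI)
        hence "is_unit [:- x m, z m:]" using g by (auto simp: genus2_def dest: squarefreeD)
        thus False using False by (simp add: is_unit_iff_degree)
      qed
    qed
  qed
next
  assume br: "\<forall>m\<in>{1..6}. \<forall>n\<in>{1..6}. m \<noteq> n \<longrightarrow> bracket x z m n \<noteq> 0"
  have nz: "x m \<noteq> 0 \<or> z m \<noteq> 0" if "m \<in> {1..6}" for m
    using br[rule_format, OF that, of "if m = 1 then 2 else 1"]
    by (cases "m = 1") (auto simp: bracket_def)
  have nz': "[:- x m, z m:] \<noteq> 0" if "m \<in> {1..6}" for m using nz[OF that] by auto
  have f0: "f \<noteq> 0" unfolding f_def using nz' by simp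
  have "degree f = (\<Sum>m\<in>{1..6}. degree [:- x m, z m:])"
    unfolding f_def using nz' by (intro degree_prod_eq_sum_degree) blast
  also have "\<dots> + (\<Sum>m\<in>{1..6}. if z m = 0 then 1 else 0) = (\<Sum>m\<in>{1..6::nat}. 1)"
    unfolding sum.distrib[symmetric] by (intro sum.cong) auto
  finally have "degree f + (\<Sum>m\<in>{1..6}. if z m = 0 then 1 else 0) = 6" by simp
  moreover have "(\<Sum>m\<in>{1..6::nat}. if z m = 0 then 1 else 0) \<le> (1::nat)"
  proof (intro sum_le_1)
    fix m n :: nat assume mn: "m \<in> {1..6}" "n \<in> {1..6}"
      and "(if z m = 0 then 1 else 0 :: nat) \<noteq> 0" "(if z n = 0 then 1 else 0 :: nat) \<noteq> 0"
    hence "bracket x z m n = 0" by (auto simp: bracket_def split: if_splits)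
    thus "m = n" using br mn by blast
  qed auto
  ultimately have deg: "degree f \<in> {5, 6}" by auto
  have ord: "Polynomial.order r f \<le> 1" for r
  proof -
    have "Polynomial.order r f = (\<Sum>m\<in>{1..6}. Polynomial.order r [:- x m, z m:])"
      unfolding f_def using nz' by (intro order_prod) auto
    also have "\<dots> = (\<Sum>m\<in>{1..6}. if - x m + r * z m = 0 then 1 else 0)"
      using nz' by (intro sum.cong order_linear_factor) auto
    also have "\<dots> \<le> 1"
    proof (intro sum_le_1)
      fix m n :: nat assume mn: "m \<in> {1..6}" "n \<in> {1..6}"
        and "(if - x m + r * z m = 0 then 1 else 0 :: nat) \<noteq> 0" "(if - x n + r * z n = 0 then 1 else 0 :: nat) \<noteq> 0"
      hence "x m = r * z m" "x n = r * z n" by (auto split: if_splits)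
      hence "bracket x z m n = 0" by (simp add: bracket_def)
      thus "m = n" using br mn by blast
    qed auto
    finally show ?thesis .
  qed
  have "is_unit p" if p: "p ^ 2 dvd f" for p
  proof (rule ccontr)
    assume "\<not> is_unit p"
    moreover have "p \<noteq> 0" using p f0 by auto
    ultimately have "degree p > 0" by (simp add: is_unit_iff_degree)
    then obtain r where "poly p r = 0" using alg_closed_imp_poly_has_root by blast
    hence "[:- r, 1:] ^ 2 dvd p ^ 2" by (intro dvd_power_same) (simp add: poly_eq_0_iff_dvd)
    hence "[:- r, 1:] ^ 2 dvd f" using p by (rule dvd_trans)
    hence "2 \<le> Polynomial.order r f" using f0 by (simp add: Polynomial.order_divides)
    thus False using ord[of r] by simp
  qed
  thus "genus2 f" using deg by (simp add: genus2_def squarefree_def)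
qed

subsection \<open>Linear substitutions\<close>

datatype 'k mat2 = Mat2 'k 'k 'k 'k

fun det2 :: "'k::comm_ring_1 mat2 \<Rightarrow> 'k" where
  "det2 (Mat2 a b c d) = a * d - b * c"

fun mul2 :: "'k::comm_ring_1 mat2 \<Rightarrow> 'k mat2 \<Rightarrow> 'k mat2" where
  "mul2 (Mat2 a b c d) (Mat2 a' b' c' d') =
     Mat2 (a * a' + b * c') (a * b' + b * d') (c * a' + d * c') (c * b' + d * d')"

definition diag2 :: "'k::comm_ring_1 \<Rightarrow> 'k \<Rightarrow> 'k mat2" where
  "diag2 l m = Mat2 l 0 0 m"

fun adj2 :: "'k::comm_ring_1 mat2 \<Rightarrow> 'k mat2" where
  "adj2 (Mat2 a b c d) = Mat2 d (- b) (- c) a"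

lemma det2_mul2: "det2 (mul2 A B) = det2 A * det2 B"
  by (cases A; cases B) (simp add: algebra_simps)

lemma mul2_assoc: "mul2 (mul2 A B) C = mul2 A (mul2 B C)"
  by (cases A; cases B; cases C) (simp add: algebra_simps)

lemma mul2_adj2: "mul2 A (adj2 A) = diag2 (det2 A) (det2 A)" "mul2 (adj2 A) A = diag2 (det2 A) (det2 A)"
  and det2_adj2 [simp]: "det2 (adj2 A) = det2 A"
  by (cases A; simp add: algebra_simps diag2_def)+

lemma det2_diag2 [simp]: "det2 (diag2 l m) = l * m"
  by (simp add: diag2_def)

text \<open>The substitution \<open>F(X, Z) \<mapsto> F(aX + bZ, cX + dZ)\<close> on binary sextics, at \<open>Z = 1\<close>.\<close>

fun subst6 :: "'k::comm_ring_1 mat2 \<Rightarrow> 'k poly \<Rightarrow> 'k poly" where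
  "subst6 (Mat2 a b c d) f = (\<Sum>i\<le>6. smult (coeff f i) ([:b, a:] ^ i * [:d, c:] ^ (6 - i)))"

fun mobius :: "'k::field mat2 \<Rightarrow> 'k poly fract" where
  "mobius (Mat2 a b c d) = to_fract [:b, a:] / to_fract [:d, c:]"

text \<open>The automorphy factor cX + d: its cube divides the image of Y, and its sixth power
  clears the denominators of a transformed sextic.\<close>

fun cofactor :: "'k::field mat2 \<Rightarrow> 'k poly fract" where
  "cofactor (Mat2 a b c d) = to_fract [:d, c:]"

abbreviation fract_const :: "'k::field \<Rightarrow> 'k poly fract" where
  "fract_const c \<equiv> to_fract [:c:]"

text \<open>The homomorphism with \<open>X \<mapsto> (aX + b) / (cX + d)\<close> and \<open>Y \<mapsto> e Y / (cX + d)\<^sup>3\<close>.\<close>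

definition mobius_map ::
  "'k::field mat2 \<Rightarrow> 'k \<Rightarrow> 'k poly fract \<times> 'k poly fract \<Rightarrow> 'k poly fract \<times> 'k poly fract" where
  "mobius_map A e u = (eval_fract fract_const (mobius A) (fst u),
     eval_fract fract_const (mobius A) (snd u) * (fract_const e / cofactor A ^ 3))"

global_interpretation fract_const: const_embedding fract_const
  by standard (simp_all flip: to_fract_add to_fract_mult add: one_pCons[symmetric])

lemma (in const_embedding) eval_poly_monom: "eval_poly h u (monom c n) = h c * u ^ n"
  by (induction n) (simp_all add: monom_Suc monom_0 algebra_simps)

lemma (in const_embedding) eval_poly_sum_coeffs:
  assumes "degree p \<le> n"
  shows "eval_poly h u p = (\<Sum>i\<le>n. h (coeff p i) * u ^ i)"
proof -
  have "eval_poly h u p = eval_poly h u (\<Sum>i\<le>n. monom (coeff p i) i)"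
    by (simp only: poly_as_sum_of_monoms'[OF assms])
  thus ?thesis by (simp add: eval_poly_sum eval_poly_monom)
qed

lemma cofactor_nonzero: "det2 A \<noteq> 0 \<Longrightarrow> cofactor A \<noteq> 0"
  by (cases A) auto

lemma transcendental_mobius:
  fixes A :: "'k::alg_closed_field mat2"
  assumes "det2 A \<noteq> 0"
  shows "transcendental_point fract_const (mobius A)"
proof unfold_locales
  fix e
  obtain a b c d where A: "A = Mat2 a b c d" by (cases A)
  show "mobius A \<noteq> fract_const e"
  proof
    assume "mobius A = fract_const e"
    hence "to_fract [:b, a:] = to_fract ([:e:] * [:d, c:])"
      unfolding to_fract_mult using cofactor_nonzero[OF assms] by (simp add: A divide_eq_eq)
    hence "[:b, a:] = [:e:] * [:d, c:]" by (simp only: to_fract_eq_iff)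
    thus False using assms by (simp add: A)
  qed
qed

text \<open>The dehomogenised form of the substitution. Composition and factorisation rules for
  \<open>subst6\<close> are derived in k(X) from this identity rather than from the defining
  sum.\<close>

lemma to_fract_subst6:
  assumes "det2 A \<noteq> 0" "degree f \<le> 6"
  shows "to_fract (subst6 A f) = cofactor A ^ 6 * eval_poly fract_const (mobius A) f"
proof -
  obtain a b c d where A: "A = Mat2 a b c d" by (cases A)
  have nz: "to_fract [:d, c:] \<noteq> 0" using cofactor_nonzero[OF assms(1)] by (simp add: A)
  have cancel: "p * (q * r) = (s * r) * (p * (q / s))" if "s \<noteq> 0" for p q r s :: "'a poly fract"
    using that by simp
  have pow: "to_fract (p ^ i) = to_fract p ^ i" for p :: "'a poly" and i by (induction i) simp_all
  have "to_fract (subst6 A f) = (\<Sum>i\<le>6. to_fract ([:coeff f i:] * ([:b, a:] ^ i * [:d, c:] ^ (6 - i))))"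
    by (simp add: A del: to_fract_mult)
  also have "\<dots> = (\<Sum>i\<le>6. to_fract [:d, c:] ^ 6 * (fract_const (coeff f i) * (to_fract [:b, a:] / to_fract [:d, c:]) ^ i))"
  proof (intro sum.cong refl)
    fix i :: nat assume "i \<in> {..6}"
    hence split: "to_fract [:d, c:] ^ 6 = to_fract [:d, c:] ^ i * to_fract [:d, c:] ^ (6 - i)"
      by (simp flip: power_add)
    show "to_fract ([:coeff f i:] * ([:b, a:] ^ i * [:d, c:] ^ (6 - i))) =
        to_fract [:d, c:] ^ 6 * (fract_const (coeff f i) * (to_fract [:b, a:] / to_fract [:d, c:]) ^ i)"
      unfolding to_fract_mult pow power_divide split using nz by (intro cancel power_not_zero)
  qed
  also have "\<dots> = cofactor A ^ 6 * eval_poly fract_const (mobius A) f"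
    by (simp add: fract_const.eval_poly_sum_coeffs[OF assms(2)] sum_distrib_left A)
  finally show ?thesis .
qed

lemma degree_subst6_le: "degree (subst6 A f) \<le> 6"
proof -
  obtain a b c d where A: "A = Mat2 a b c d" by (cases A)
  have "degree ([:b, a:] ^ i * [:d, c:] ^ (6 - i)) \<le> 6" if "i \<le> 6" for i
  proof -
    have "degree ([:b, a:] ^ i * [:d, c:] ^ (6 - i)) \<le> degree ([:b, a:] ^ i) + degree ([:d, c:] ^ (6 - i))"
      by (rule degree_mult_le)
    also have "\<dots> \<le> degree [:b, a:] * i + degree [:d, c:] * (6 - i)" by (intro add_mono degree_power_le)
    also have "\<dots> \<le> 1 * i + 1 * (6 - i)" by (intro add_mono mult_right_mono) auto
    finally show ?thesis using that by simp
  qed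
  thus ?thesis unfolding A subst6.simps
    by (intro degree_sum_le) (auto intro: le_trans[OF degree_smult_le])
qed

lemma subst6_smult: "subst6 A (smult k f) = smult k (subst6 A f)"
proof (cases A)
  case (Mat2 a b c d)
  have "smult k (sum p S) = (\<Sum>i\<in>S. smult k (p i))" for p :: "nat \<Rightarrow> 'a poly" and S
    by (induction S rule: infinite_finite_induct) (simp_all add: smult_add_right)
  thus ?thesis by (simp add: Mat2)
qed

lemma coeff_subst6_diag2:
  assumes "i \<le> 6"
  shows "coeff (subst6 (diag2 l m) f) i = l ^ i * m ^ (6 - i) * coeff f i"
proof -
  have *: "[:0, l:] ^ j * [:m:] ^ (6 - j) = monom (l ^ j * m ^ (6 - j)) j" for j
  proof -
    have "[:0, l:] = monom l 1" "[:m:] = monom m 0" by (simp_all add: monom_Suc monom_0)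
    thus ?thesis by (simp only: monom_power mult_monom) simp
  qed
  show ?thesis using assms by (simp add: diag2_def * coeff_sum if_distrib cong: if_cong)
qed

text \<open>The root (x : z) is moved by the adjugate of the matrix, which multiplies every bracket
  by the determinant.\<close>

lemma subst6_prod:
  fixes a b c d :: "'k::field"
  assumes "det2 (Mat2 a b c d) \<noteq> 0"
  shows "subst6 (Mat2 a b c d) (\<Prod>m\<in>{1..6::nat}. [:- x m, z m:]) =
    (\<Prod>m\<in>{1..6}. [:- (d * x m - b * z m), a * z m - c * x m:])"
proof -
  let ?D = "to_fract [:d, c:]" and ?N = "to_fract [:b, a:]"
  have D: "?D \<noteq> 0" using cofactor_nonzero[OF assms] by simp
  have "degree (\<Prod>m\<in>{1..6::nat}. [:- x m, z m:]) \<le> sum (degree \<circ> (\<lambda>m. [:- x m, z m:])) {1..6}"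
    by (intro degree_prod_sum_le) auto
  also have "\<dots> \<le> (\<Sum>m\<in>{1..6::nat}. 1)" by (intro sum_mono) auto
  finally have "degree (\<Prod>m\<in>{1..6::nat}. [:- x m, z m:]) \<le> 6" by simp
  hence "to_fract (subst6 (Mat2 a b c d) (\<Prod>m\<in>{1..6::nat}. [:- x m, z m:])) =
      ?D ^ 6 * (\<Prod>m\<in>{1..6::nat}. fract_const (- x m) + ?N / ?D * fract_const (z m))"
    using to_fract_subst6[OF assms] by (simp add: fract_const.eval_poly_prod)
  also have "\<dots> = (\<Prod>m\<in>{1..6::nat}. ?D * (fract_const (- x m) + ?N / ?D * fract_const (z m)))"
    by (simp add: prod.distrib)
  also have "\<dots> = (\<Prod>m\<in>{1..6::nat}. to_fract [:- (d * x m - b * z m), a * z m - c * x m:])"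
  proof (intro prod.cong refl)
    fix m
    have "?D * (fract_const (- x m) + ?N / ?D * fract_const (z m)) = ?D * fract_const (- x m) + ?N * fract_const (z m)"
      using D by (simp add: field_simps)
    also have "\<dots> = to_fract ([:d, c:] * [:- x m:] + [:b, a:] * [:z m:])" by (simp only: to_fract_add to_fract_mult)
    also have "[:d, c:] * [:- x m:] + [:b, a:] * [:z m:] = [:- (d * x m - b * z m), a * z m - c * x m:]"
      by (simp add: algebra_simps)
    finally show "?D * (fract_const (- x m) + ?N / ?D * fract_const (z m)) = to_fract \<dots>" .
  qed
  also have "\<dots> = to_fract (\<Prod>m\<in>{1..6}. [:- (d * x m - b * z m), a * z m - c * x m:])"
  proof -
    have "(\<Prod>m\<in>S. to_fract (p m)) = to_fract (\<Prod>m\<in>S. p m)" for p :: "nat \<Rightarrow> 'k poly" and S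
      by (induction S rule: infinite_finite_induct) simp_all
    thus ?thesis .
  qed
  finally show ?thesis by (simp only: to_fract_eq_iff)
qed

lemma genus2_subst6:
  assumes "genus2 f" "det2 A \<noteq> 0"
  shows "genus2 (subst6 A f)"
proof -
  obtain a b c d where A: "A = Mat2 a b c d" by (cases A)
  have "f \<noteq> 0" "degree f \<le> 6" using assms(1) by (auto simp: genus2_def)
  then obtain x z where f: "f = (\<Prod>m\<in>{1..6::nat}. [:- x m, z m:])" by (rule sextic_factorisation)
  have "bracket (\<lambda>m. d * x m - b * z m) (\<lambda>m. a * z m - c * x m) m n = det2 A * bracket x z m n" for m n
    by (simp add: A bracket_def algebra_simps)
  moreover have "subst6 A f = (\<Prod>m\<in>{1..6}. [:- (d * x m - b * z m), a * z m - c * x m:])"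
    using assms(2) unfolding A f by (rule subst6_prod)
  ultimately show ?thesis
    using assms genus2_iff_brackets[of x z] unfolding f
    by (simp only: genus2_iff_brackets) simp
qed

text \<open>Substituting \<open>mobius B\<close> into \<open>mobius A\<close> gives the matrix
  product A B in this order; the second equation is the cocycle rule for cX + d.\<close>

lemma eval_mobius_mobius:
  fixes A B :: "'k::alg_closed_field mat2"
  assumes "det2 A \<noteq> 0" "det2 B \<noteq> 0"
  shows "eval_fract fract_const (mobius B) (eval_fract fract_const (mobius A) q) =
      eval_fract fract_const (mobius (mul2 A B)) q" (is ?comp)
    and "eval_fract fract_const (mobius B) (cofactor A) * cofactor B = cofactor (mul2 A B)" (is ?cof)
proof -
  obtain a b c d where A: "A = Mat2 a b c d" by (cases A)
  obtain a' b' c' d' where B: "B = Mat2 a' b' c' d'" by (cases B)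
  interpret A: transcendental_point fract_const "mobius A" using assms(1) by (rule transcendental_mobius)
  interpret B: transcendental_point fract_const "mobius B" using assms(2) by (rule transcendental_mobius)
  have AB0: "det2 (mul2 A B) \<noteq> 0" using assms by (simp add: det2_mul2)
  interpret AB: transcendental_point fract_const "mobius (mul2 A B)" using AB0 by (rule transcendental_mobius)
  have D: "to_fract [:d', c':] \<noteq> 0" using cofactor_nonzero[OF assms(2)] by (simp add: B)
  have lin: "B.ev (to_fract [:s, r:]) * to_fract [:d', c':] = to_fract [:r * b' + s * d', r * a' + s * c':]" for r s
  proof -
    have "B.ev (to_fract [:s, r:]) * to_fract [:d', c':] =
        fract_const s * to_fract [:d', c':] + fract_const r * to_fract [:b', a':]"
      unfolding B.ev_to_fract using D by (simp add: B field_simps)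
    also have "\<dots> = to_fract ([:s:] * [:d', c':] + [:r:] * [:b', a':])" by (simp only: to_fract_add to_fract_mult)
    finally show ?thesis by (simp add: algebra_simps)
  qed
  show cof: ?cof using lin[of d c] by (simp add: A B del: B.ev_to_fract)
  have cofAB: "cofactor (mul2 A B) \<noteq> 0" using AB0 by (rule cofactor_nonzero)
  have "B.ev (mobius A) = mobius (mul2 A B)"
  proof -
    have "B.ev (mobius A) = (B.ev (to_fract [:b, a:]) * to_fract [:d', c':]) / (B.ev (to_fract [:d, c:]) * to_fract [:d', c':])"
      using D by (simp add: A B.ev_divide del: B.ev_to_fract)
    also have "\<dots> = mobius (mul2 A B)" unfolding lin by (simp add: A B)
    finally show ?thesis .
  qed
  thus ?comp
    by (intro AB.ev_unique) (simp_all add: A.ev_add A.ev_mult B.ev_add B.ev_mult fract_const.h_1)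
qed

lemma mobius_map_mobius_map:
  fixes A B :: "'k::alg_closed_field mat2"
  assumes "det2 A \<noteq> 0" "det2 B \<noteq> 0"
  shows "mobius_map B e' (mobius_map A e u) = mobius_map (mul2 A B) (e * e') u"
proof -
  interpret B: transcendental_point fract_const "mobius B" using assms(2) by (rule transcendental_mobius)
  have "B.ev (fract_const e / cofactor A ^ 3) * (fract_const e' / cofactor B ^ 3) =
      fract_const e * fract_const e' / (B.ev (cofactor A) * cofactor B) ^ 3"
    by (simp add: B.ev_divide B.ev_power power_mult_distrib)
  also have "\<dots> = fract_const (e * e') / cofactor (mul2 A B) ^ 3"
    by (simp only: fract_const.h_mult eval_mobius_mobius(2)[OF assms])
  finally show ?thesis
    by (simp only: mobius_map_def fst_conv snd_conv eval_mobius_mobius(1)[OF assms] B.ev_mult mult.assoc)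
qed

text \<open>The factor of Y is l^3 / l^3. Hence (A, e) and (l A, l^3 e) describe the same map, and
  relations between maps give relations between matrices only up to a scalar.\<close>

lemma mobius_map_scalar:
  assumes "l \<noteq> (0::'k::alg_closed_field)"
  shows "mobius_map (diag2 l l) (l ^ 3) = id"
proof -
  have "[:0, l:] = [:0, 1:] * [:l:]" by simp
  hence X: "mobius (diag2 l l) = to_fract [:0, 1:]"
    using assms unfolding diag2_def mobius.simps by (simp only: to_fract_mult) simp
  interpret transcendental_point fract_const "mobius (diag2 l l)"
    using assms by (intro transcendental_mobius) simp
  have "eval_fract fract_const (mobius (diag2 l l)) q = q" for q
    using ev_unique[of id q] by (simp add: X)
  moreover have "fract_const (l ^ 3) = fract_const l ^ 3"
    by (simp flip: to_fract_mult add: power3_eq_cube)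
  ultimately show ?thesis using assms by (simp add: mobius_map_def diag2_def fun_eq_iff)
qed

subsection \<open>Isomorphisms between function fields\<close>

lemma function_field_simps [simp]:
  "carrier (function_field f) = UNIV"
  "(a, b) \<otimes>\<^bsub>function_field f\<^esub> (c, d) = (a * c + to_fract f * (b * d), a * d + b * c)"
  "(a, b) \<oplus>\<^bsub>function_field f\<^esub> (c, d) = (a + c, b + d)"
  "\<one>\<^bsub>function_field f\<^esub> = (1, 0)" "\<zero>\<^bsub>function_field f\<^esub> = (0, 0)"
  by (simp_all add: function_field_def)

lemma function_field_isosD:
  assumes "\<phi> \<in> function_field_isos f g"
  shows "\<phi> (u \<oplus>\<^bsub>function_field f\<^esub> v) = \<phi> u \<oplus>\<^bsub>function_field g\<^esub> \<phi> v"
    and "\<phi> (u \<otimes>\<^bsub>function_field f\<^esub> v) = \<phi> u \<otimes>\<^bsub>function_field g\<^esub> \<phi> v"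
    and "\<phi> (1, 0) = (1, 0)" and "\<phi> (fract_const c, 0) = (fract_const c, 0)" and "bij \<phi>"
proof -
  have hom: "\<phi> \<in> ring_hom (function_field f) (function_field g)"
    using assms by (simp add: function_field_isos_def ring_iso_def)
  show "\<phi> (u \<oplus>\<^bsub>function_field f\<^esub> v) = \<phi> u \<oplus>\<^bsub>function_field g\<^esub> \<phi> v"
    and "\<phi> (u \<otimes>\<^bsub>function_field f\<^esub> v) = \<phi> u \<otimes>\<^bsub>function_field g\<^esub> \<phi> v"
    using ring_hom_add[OF hom] ring_hom_mult[OF hom] by simp_all
  show "\<phi> (1, 0) = (1, 0)" using ring_hom_one[OF hom] by simp
  show "\<phi> (fract_const c, 0) = (fract_const c, 0)" "bij \<phi>"
    using assms by (simp_all add: function_field_isos_def ring_iso_def const_def)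
qed

lemma mobius_map_iso:
  fixes f g :: "'k::alg_closed_field poly"
  assumes A: "det2 A \<noteq> 0" and e: "e \<noteq> 0" and f: "degree f \<le> 6" and fg: "subst6 A f = smult (e\<^sup>2) g"
  shows "mobius_map A e \<in> function_field_isos f g"
proof -
  interpret transcendental_point fract_const "mobius A" using A by (rule transcendental_mobius)
  define s where "s = fract_const e / cofactor A ^ 3"
  have "s ^ 2 * cofactor A ^ 6 = fract_const e ^ 2"
    using cofactor_nonzero[OF A] by (simp add: s_def power_divide flip: power_mult)
  moreover have "cofactor A ^ 6 * ev (to_fract f) = fract_const e ^ 2 * to_fract g"
    using to_fract_subst6[OF A f] fg by (simp add: power2_eq_square flip: to_fract_mult)
  ultimately have "cofactor A ^ 6 * ev (to_fract f) = cofactor A ^ 6 * (to_fract g * s\<^sup>2)"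
    by (simp add: mult.commute mult.left_commute)
  \<comment> \<open>The image s Y of Y satisfies the equation of the source curve; multiplicativity
    rests on this.\<close>
  hence f_eq: "ev (to_fract f) = to_fract g * s\<^sup>2"
    using cofactor_nonzero[OF A] by simp
  have "mobius_map A e \<in> ring_hom (function_field f) (function_field g)"
  proof (rule ring_hom_memI)
    fix u v :: "'k poly fract \<times> 'k poly fract"
    obtain p q r t where uv: "u = (p, q)" "v = (r, t)" by (cases u; cases v)
    show "mobius_map A e (u \<otimes>\<^bsub>function_field f\<^esub> v) = mobius_map A e u \<otimes>\<^bsub>function_field g\<^esub> mobius_map A e v"
      unfolding uv function_field_simps mobius_map_def s_def[symmetric]
      by (simp add: ev_add ev_mult f_eq[unfolded ev_to_fract] power2_eq_square algebra_simps)
    show "mobius_map A e (u \<oplus>\<^bsub>function_field f\<^esub> v) = mobius_map A e u \<oplus>\<^bsub>function_field g\<^esub> mobius_map A e v"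
      by (simp add: uv mobius_map_def ev_add algebra_simps)
  qed (simp_all add: mobius_map_def)
  moreover have "bij (mobius_map A e)"
  proof (rule o_bij)
    \<comment> \<open>A times its adjugate is the scalar det A, so by
      \<open>mobius_map_scalar\<close> the factors of Y have to multiply to its cube.\<close>
    show "mobius_map (adj2 A) (det2 A ^ 3 / e) \<circ> mobius_map A e = id"
      using A e by (simp add: fun_eq_iff mobius_map_mobius_map mul2_adj2 mobius_map_scalar)
    show "mobius_map A e \<circ> mobius_map (adj2 A) (det2 A ^ 3 / e) = id"
      using A e by (simp add: fun_eq_iff mobius_map_mobius_map mul2_adj2 mobius_map_scalar)
  qed
  ultimately show ?thesis
    by (simp add: function_field_isos_def ring_iso_def const_def mobius_map_def)
qed

subsection \<open>Automorphisms are Moebius transformations\<close>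

lemma hom_of_poly:
  fixes \<phi> :: "'k::field poly fract \<times> 'k poly fract \<Rightarrow> 'l::field" and h :: "'k \<Rightarrow> 'l"
  assumes "const_embedding h"
    and add: "\<And>u v. \<phi> (u \<oplus>\<^bsub>function_field f\<^esub> v) = \<phi> u + \<phi> v"
    and mult: "\<And>u v. \<phi> (u \<otimes>\<^bsub>function_field f\<^esub> v) = \<phi> u * \<phi> v"
    and const: "\<And>c. \<phi> (fract_const c, 0) = h c"
  shows "\<phi> (to_fract p, 0) = eval_poly h (\<phi> (to_fract [:0, 1:], 0)) p"
proof -
  interpret const_embedding h by fact
  show ?thesis
  proof (induction p)
    case 0
    show ?case using const[of 0] by simp
  next
    case (pCons a p)
    have "to_fract (pCons a p) = to_fract [:a:] + to_fract [:0, 1:] * to_fract p"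
      by (simp flip: to_fract_add to_fract_mult)
    hence "(to_fract (pCons a p), 0) = (fract_const a, 0) \<oplus>\<^bsub>function_field f\<^esub>
        ((to_fract [:0, 1:], 0) \<otimes>\<^bsub>function_field f\<^esub> (to_fract p, 0))"
      by simp
    thus ?case by (simp only: add mult const pCons.IH eval_poly_pCons)
  qed
qed

text \<open>X and Y generate the function field; quotients are handled by cancelling in the target,
  which is a field.\<close>

lemma iso_eqI:
  fixes f g :: "'k::{alg_closed_field, field_char_0} poly"
  assumes \<phi>: "\<phi> \<in> function_field_isos f g" and \<psi>: "\<psi> \<in> function_field_isos f g"
    and g: "genus2 g"
    and X: "\<phi> (to_fract [:0, 1:], 0) = \<psi> (to_fract [:0, 1:], 0)" and Y: "\<phi> (0, 1) = \<psi> (0, 1)"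
  shows "\<phi> = \<psi>"
proof
  fix u :: "'k poly fract \<times> 'k poly fract"
  interpret g: field "function_field g"
    using g by (intro function_field_field) (auto simp: genus2_def)
  note \<phi> = function_field_isosD[OF \<phi>] and \<psi> = function_field_isosD[OF \<psi>]
  have poly: "\<phi> (to_fract p, 0) = \<psi> (to_fract p, 0)" for p
  proof (induction p)
    case 0
    show ?case using \<phi>(4)[of 0] \<psi>(4)[of 0] by simp
  next
    case (pCons a p)
    have "to_fract (pCons a p) = to_fract [:a:] + to_fract [:0, 1:] * to_fract p"
      by (simp flip: to_fract_add to_fract_mult)
    hence "(to_fract (pCons a p), 0) = (fract_const a, 0) \<oplus>\<^bsub>function_field f\<^esub>
        ((to_fract [:0, 1:], 0) \<otimes>\<^bsub>function_field f\<^esub> (to_fract p, 0))"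
      by simp
    thus ?case by (simp only: \<phi> \<psi> X pCons.IH)
  qed
  have fract: "\<phi> (q, 0) = \<psi> (q, 0)" for q
  proof -
    obtain a b where ab: "b \<noteq> 0" "q = to_fract a / to_fract b" by (rule fract_poly_cases)
    have "(q, 0) \<otimes>\<^bsub>function_field f\<^esub> (to_fract b, 0) = (to_fract a, 0)" using ab by simp
    hence eq: "\<phi> (q, 0) \<otimes>\<^bsub>function_field g\<^esub> \<phi> (to_fract b, 0) = \<psi> (q, 0) \<otimes>\<^bsub>function_field g\<^esub> \<phi> (to_fract b, 0)"
      by (metis \<phi>(2) \<psi>(2) poly)
    have "\<phi> (to_fract b, 0) \<noteq> \<phi> (fract_const 0, 0)"
      using ab(1) injD[OF bij_is_inj[OF \<phi>(5)], of "(to_fract b, 0)" "(fract_const 0, 0)"] by auto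
    hence "\<phi> (to_fract b, 0) \<noteq> \<zero>\<^bsub>function_field g\<^esub>" unfolding \<phi>(4) by simp
    thus ?thesis using eq g.m_rcancel by simp
  qed
  obtain a b where u: "u = (a, b)" by (cases u)
  have "u = (a, 0) \<oplus>\<^bsub>function_field f\<^esub> ((b, 0) \<otimes>\<^bsub>function_field f\<^esub> (0, 1))" by (simp add: u)
  thus "\<phi> u = \<psi> u" by (simp only: \<phi> \<psi> fract Y)
qed

section \<open>Expansions along a branch and their derivatives\<close>

definition fract_deriv :: "'k::field poly fract \<Rightarrow> 'k poly fract" where
  "fract_deriv q = (let (a, b) = repr q in to_fract (pderiv a * b - a * pderiv b) / to_fract (b * b))"

lemma fls_deriv_eval_poly:
  fixes u :: "'k::field fls"
  shows
  "fls_deriv (eval_poly fls_const u p) = eval_poly fls_const u (pderiv p) * fls_deriv u"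
  by (induction p) (simp_all add: pderiv_pCons fls_const.eval_poly_add algebra_simps)

context
  fixes \<xi> :: "'k::{alg_closed_field, field_char_0} fls"
  assumes \<xi>: "transcendental_point fls_const \<xi>"
begin

interpretation transcendental_point fls_const \<xi> by (fact \<xi>)

lemma fls_deriv_eval_fract: "fls_deriv (ev q) = ev (fract_deriv q) * fls_deriv \<xi>"
proof -
  obtain a b where ab: "repr q = (a, b)" by fastforce
  have b: "b \<noteq> 0" and q: "q = to_fract a / to_fract b" using repr[of q] ab by auto
  let ?a = "eval_poly fls_const \<xi> a" and ?b = "eval_poly fls_const \<xi> b"
  have b0: "?b \<noteq> 0" using b by simp
  have ev_q: "ev q * ?b = ?a" using b by (simp add: q ev_quotient)
  hence "fls_deriv ?a = fls_deriv (ev q) * ?b + ev q * fls_deriv ?b"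
    by (simp flip: ev_q add: add.commute)
  hence "fls_deriv (ev q) * (?b * ?b) = fls_deriv ?a * ?b - (ev q * ?b) * fls_deriv ?b"
    by (simp add: algebra_simps)
  also have "\<dots> = (eval_poly fls_const \<xi> (pderiv a) * ?b - ?a * eval_poly fls_const \<xi> (pderiv b)) * fls_deriv \<xi>"
    by (simp add: ev_q fls_deriv_eval_poly algebra_simps)
  finally have "fls_deriv (ev q) = (eval_poly fls_const \<xi> (pderiv a) * ?b - ?a * eval_poly fls_const \<xi> (pderiv b))
      / (?b * ?b) * fls_deriv \<xi>"
    using b0 by (simp add: field_simps)
  moreover have "ev (fract_deriv q) = (eval_poly fls_const \<xi> (pderiv a) * ?b - ?a * eval_poly fls_const \<xi> (pderiv b)) / (?b * ?b)"
  proof -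
    have minus: "eval_poly fls_const \<xi> (p - r) = eval_poly fls_const \<xi> p - eval_poly fls_const \<xi> r" for p r
      using fls_const.eval_poly_add[of \<xi> "p - r" r] by (simp add: eq_diff_eq)
    show ?thesis using b
      by (simp add: fract_deriv_def ab ev_quotient fls_const.eval_poly_mult minus del: to_fract_mult to_fract_diff)
  qed
  ultimately show ?thesis by simp
qed

end

text \<open>\<open>\<sigma>\<close> expands a function along the branch (\<open>\<xi>\<close>,
  \<open>\<eta>\<close>). In the last clause the derivative of an expansion is traced back to d/dX
  on the function field, where Y' = f' Y / (2 f) because Y^2 = f.\<close>

lemma function_field_hom_to_fls:
  fixes f :: "'k::{alg_closed_field, field_char_0} poly"
  assumes "transcendental_point fls_const \<xi>" and \<eta>: "\<eta>\<^sup>2 = eval_poly fls_const \<xi> f"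
  defines "\<sigma> \<equiv> \<lambda>u. eval_fract fls_const \<xi> (fst u) + eval_fract fls_const \<xi> (snd u) * \<eta>"
  shows "\<sigma> (u \<oplus>\<^bsub>function_field f\<^esub> v) = \<sigma> u + \<sigma> v"
    and "\<sigma> (u \<otimes>\<^bsub>function_field f\<^esub> v) = \<sigma> u * \<sigma> v"
    and "\<sigma> (fract_const c, 0) = fls_const c"
    and "f \<noteq> 0 \<Longrightarrow> fls_deriv (\<sigma> (p, q)) =
      \<sigma> (fract_deriv p, fract_deriv q + q * to_fract (pderiv f) / (2 * to_fract f)) * fls_deriv \<xi>"
proof -
  interpret transcendental_point fls_const \<xi> by fact
  obtain a b where u: "u = (a, b)" by (cases u)
  obtain a' b' where v: "v = (a', b')" by (cases v)
  show "\<sigma> (u \<oplus>\<^bsub>function_field f\<^esub> v) = \<sigma> u + \<sigma> v"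
    by (simp add: u v \<sigma>_def ev_add algebra_simps)
  show "\<sigma> (u \<otimes>\<^bsub>function_field f\<^esub> v) = \<sigma> u * \<sigma> v"
    by (simp add: u v \<sigma>_def ev_add ev_mult algebra_simps flip: \<eta> power2_eq_square)
  show "\<sigma> (fract_const c, 0) = fls_const c" by (simp add: \<sigma>_def)
  assume f: "f \<noteq> 0"
  hence \<eta>0: "\<eta> \<noteq> 0" using \<eta> by auto
  have two: "ev 2 = 2" using ev_add[of 1 1] by (simp only: ev_1 one_add_one)
  have "2 * \<eta> * fls_deriv \<eta> = fls_deriv (\<eta>\<^sup>2)" by (simp add: power2_eq_square algebra_simps)
  also have "\<dots> = eval_poly fls_const \<xi> (pderiv f) * fls_deriv \<xi>" by (simp add: \<eta> fls_deriv_eval_poly)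
  finally have "fls_deriv \<eta> * (2 * \<eta> * \<eta>) = eval_poly fls_const \<xi> (pderiv f) * fls_deriv \<xi> * \<eta>"
    by (simp add: algebra_simps)
  hence "fls_deriv \<eta> = eval_poly fls_const \<xi> (pderiv f) * fls_deriv \<xi> * \<eta> / (2 * \<eta> * \<eta>)"
    using \<eta>0 by (subst nonzero_eq_divide_eq) simp_all
  moreover have "ev (to_fract (pderiv f) / (2 * to_fract f)) = eval_poly fls_const \<xi> (pderiv f) / (2 * \<eta> * \<eta>)"
    using \<eta> by (simp add: ev_divide ev_mult two power2_eq_square mult.assoc)
  ultimately have d\<eta>: "fls_deriv \<eta> = ev (to_fract (pderiv f) / (2 * to_fract f)) * \<eta> * fls_deriv \<xi>"
    by simp
  show "fls_deriv (\<sigma> (p, q)) =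
      \<sigma> (fract_deriv p, fract_deriv q + q * to_fract (pderiv f) / (2 * to_fract f)) * fls_deriv \<xi>"
  proof -
    have "fls_deriv (\<sigma> (p, q)) = fls_deriv (ev p) + (ev q * fls_deriv \<eta> + fls_deriv (ev q) * \<eta>)"
      by (simp add: \<sigma>_def)
    also have "\<dots> = (ev (fract_deriv p) + (ev (fract_deriv q) + ev q * ev (to_fract (pderiv f) / (2 * to_fract f))) * \<eta>)
        * fls_deriv \<xi>"
      unfolding d\<eta> fls_deriv_eval_fract[OF transcendental_point_axioms] by (simp only: algebra_simps)
    also have "ev (fract_deriv q) + ev q * ev (to_fract (pderiv f) / (2 * to_fract f)) =
        ev (fract_deriv q + q * to_fract (pderiv f) / (2 * to_fract f))"
      by (simp only: ev_add ev_mult[symmetric] times_divide_eq_right)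
    finally show ?thesis by (simp add: \<sigma>_def)
  qed
qed

lemma degree_le_1_form: "degree p \<le> 1 \<Longrightarrow> \<exists>a b. p = [:a, b:]"
  by (rule exI[of _ "coeff p 0"], rule exI[of _ "coeff p 1"], intro poly_eqI)
     (auto simp: coeff_pCons coeff_eq_0 split: nat.split)

text \<open>W dX is the pullback of dX/Y, and x W dX that of X dX/Y. Both have the shape R dX/Y with
  deg R <= 1, so x = R2 / R1 without a Y-part.\<close>

lemma automorphism_X:
  fixes f :: "'k::{alg_closed_field, field_char_0} poly"
  assumes f: "genus2 f" and \<phi>: "\<phi> \<in> function_field_isos f f"
  obtains A where "det2 A \<noteq> 0" "\<phi> (to_fract [:0, 1:], 0) = (mobius A, 0)"
proof -
  let ?K = "function_field f"
  note hom = function_field_isosD[OF \<phi>]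
  have f0: "f \<noteq> 0" using f by (auto simp: genus2_def)
  define x where "x = \<phi> (to_fract [:0, 1:], 0)"
  define y where "y = \<phi> (0, 1)"
  define y' where "y' = \<phi> (0, 1 / to_fract f)"
  \<comment> \<open>Differentiation d/dX on the function field.\<close>
  define D where "D = (\<lambda>(p :: 'k poly fract, q :: 'k poly fract). (fract_deriv p, fract_deriv q + q * to_fract (pderiv f) / (2 * to_fract f)))"
  define W where "W = D x \<otimes>\<^bsub>?K\<^esub> y'"
  define \<sigma> where "\<sigma> \<xi> \<eta> u = eval_fract fls_const \<xi> (fst u) + eval_fract fls_const \<xi> (snd u) * \<eta>"
    for \<xi> \<eta> :: "'k fls" and u
  have yy': "y \<otimes>\<^bsub>?K\<^esub> y' = (1, 0)"
    unfolding y_def y'_def hom(2)[symmetric] using f0 hom(3) by simp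
  have yy: "y \<otimes>\<^bsub>?K\<^esub> y = \<phi> (to_fract f, 0)" unfolding y_def hom(2)[symmetric] by simp

  have branch: "(\<forall>c. \<sigma> \<xi> \<eta> x \<noteq> fls_const c) \<and> fls_deriv (\<sigma> \<xi> \<eta> x) \<noteq> 0 \<and>
      \<sigma> \<xi> \<eta> W * fls_deriv \<xi> = fls_deriv (\<sigma> \<xi> \<eta> x) / \<sigma> \<xi> \<eta> y \<and>
      (\<sigma> \<xi> \<eta> y)\<^sup>2 = eval_poly fls_const (\<sigma> \<xi> \<eta> x) f \<and>
      \<sigma> \<xi> \<eta> (x \<otimes>\<^bsub>?K\<^esub> W) = \<sigma> \<xi> \<eta> x * \<sigma> \<xi> \<eta> W \<and> \<sigma> \<xi> \<eta> y \<noteq> 0"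
    if b: "branch_x \<xi>" and \<eta>: "\<eta>\<^sup>2 = eval_poly fls_const \<xi> f" for \<xi> \<eta>
  proof -
    have \<xi>: "transcendental_point fls_const \<xi>" using b by (rule branch_x_cases)
    note \<sigma> = function_field_hom_to_fls[OF \<xi> \<eta>, folded \<sigma>_def]
    have poly: "\<sigma> \<xi> \<eta> (\<phi> (to_fract p, 0)) = eval_poly fls_const (\<sigma> \<xi> \<eta> x) p" for p
      unfolding x_def by (rule hom_of_poly[of fls_const "\<lambda>u. \<sigma> \<xi> \<eta> (\<phi> u)" f])
        (use hom \<sigma> in \<open>simp_all add: fls_const.const_embedding_axioms\<close>)
    \<comment> \<open>A constant value c would send the invertible element X - c to 0.\<close>
    have nonconst: "\<sigma> \<xi> \<eta> x \<noteq> fls_const c" for c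
    proof
      assume c: "\<sigma> \<xi> \<eta> x = fls_const c"
      have "\<sigma> \<xi> \<eta> (\<phi> (to_fract [:- c, 1:], 0)) = 0" unfolding poly using c by simp
      moreover have "(to_fract [:- c, 1:], 0) \<otimes>\<^bsub>?K\<^esub> (1 / to_fract [:- c, 1:], 0) = (1, 0)" by simp
      hence "\<sigma> \<xi> \<eta> (\<phi> (to_fract [:- c, 1:], 0)) * \<sigma> \<xi> \<eta> (\<phi> (1 / to_fract [:- c, 1:], 0)) = \<sigma> \<xi> \<eta> (1, 0)"
        by (metis \<sigma>(2) hom(2,3))
      moreover have "\<sigma> \<xi> \<eta> (1, 0) = 1" using \<sigma>(3)[of 1] by (simp add: fract_const.h_1)
      ultimately show False by simp
    qed
    have "\<sigma> \<xi> \<eta> y * \<sigma> \<xi> \<eta> y' = 1"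
      using \<sigma>(2)[of y y'] \<sigma>(3)[of 1] yy' by (simp add: fract_const.h_1)
    moreover from this have y0: "\<sigma> \<xi> \<eta> y \<noteq> 0" by auto
    ultimately have y'_eq: "\<sigma> \<xi> \<eta> y' = 1 / \<sigma> \<xi> \<eta> y" by (simp add: field_simps)
    have "fls_deriv (\<sigma> \<xi> \<eta> x) = \<sigma> \<xi> \<eta> (D x) * fls_deriv \<xi>"
      using \<sigma>(4)[OF f0, of "fst x" "snd x"] by (simp add: D_def case_prod_beta)
    hence "\<sigma> \<xi> \<eta> W * fls_deriv \<xi> = fls_deriv (\<sigma> \<xi> \<eta> x) / \<sigma> \<xi> \<eta> y"
      unfolding W_def \<sigma>(2) y'_eq by simp
    moreover have "(\<sigma> \<xi> \<eta> y)\<^sup>2 = eval_poly fls_const (\<sigma> \<xi> \<eta> x) f"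
      unfolding power2_eq_square \<sigma>(2)[symmetric] yy poly ..
    moreover have "fls_deriv (\<sigma> \<xi> \<eta> x) \<noteq> 0" using nonconst by (auto simp: fls_deriv_eq_0_iff)
    ultimately show ?thesis using nonconst \<sigma>(2) y0 by blast
  qed
  have reg: "fst u = 0 \<and> (\<exists>R. degree R \<le> 1 \<and> snd u = to_fract R / to_fract f)"
    if "u = W \<or> u = x \<otimes>\<^bsub>?K\<^esub> W" for u
  proof (rule regular_differential_form[OF f])
    fix \<xi> \<eta> assume b: "branch_x \<xi>" and \<eta>: "\<eta>\<^sup>2 = eval_poly fls_const \<xi> f"
    note br = branch[OF b \<eta>]
    have "fls_subdegree (\<sigma> \<xi> \<eta> u * fls_deriv \<xi>) \<ge> 0"
    proof (cases "u = W")
      case True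
      have "\<sigma> \<xi> \<eta> W * fls_deriv \<xi> = fls_deriv (\<sigma> \<xi> \<eta> x) / \<sigma> \<xi> \<eta> y" using br by blast
      thus ?thesis using holomorphic_differentials(1)[OF f, of "\<sigma> \<xi> \<eta> y" "\<sigma> \<xi> \<eta> x"] br True by simp
    next
      case False
      hence "\<sigma> \<xi> \<eta> u * fls_deriv \<xi> = \<sigma> \<xi> \<eta> x * (\<sigma> \<xi> \<eta> W * fls_deriv \<xi>)"
        using that br by (simp add: mult.assoc)
      also have "\<sigma> \<xi> \<eta> W * fls_deriv \<xi> = fls_deriv (\<sigma> \<xi> \<eta> x) / \<sigma> \<xi> \<eta> y" using br by blast
      finally show ?thesis using holomorphic_differentials(2)[OF f, of "\<sigma> \<xi> \<eta> y" "\<sigma> \<xi> \<eta> x"] br by simp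
    qed
    thus "fls_subdegree ((eval_fract fls_const \<xi> (fst u) + eval_fract fls_const \<xi> (snd u) * \<eta>) * fls_deriv \<xi>) \<ge> 0"
      by (simp add: \<sigma>_def)
  qed
  obtain R1 where R1: "degree R1 \<le> 1" "W = (0, to_fract R1 / to_fract f)"
    using reg[of W] by (metis prod.collapse)
  obtain R2 where R2: "degree R2 \<le> 1" "x \<otimes>\<^bsub>?K\<^esub> W = (0, to_fract R2 / to_fract f)"
    using reg[of "x \<otimes>\<^bsub>?K\<^esub> W"] by (metis prod.collapse)
  obtain \<xi> :: "'k fls" where b: "branch_x \<xi>" by (auto simp: branch_x_def)
  obtain \<eta> where \<eta>: "\<eta>\<^sup>2 = eval_poly fls_const \<xi> f" using fls_has_sqrt branch_x_cases(2)[OF b] by blast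
  note br = branch[OF b \<eta>]
  have \<xi>: "transcendental_point fls_const \<xi>" using b by (rule branch_x_cases)
  interpret transcendental_point fls_const \<xi> by fact
  have R1_0: "R1 \<noteq> 0"
  proof
    assume "R1 = 0"
    hence "\<sigma> \<xi> \<eta> W = 0" using R1 by (simp add: \<sigma>_def)
    thus False using br by auto
  qed
  obtain x1 x2 where x: "x = (x1, x2)" by (cases x)
  have "x2 * to_fract R1 = 0" "x1 * to_fract R1 = to_fract R2"
    using R2(2) f0 by (simp_all add: x R1(2))
  hence x': "x2 = 0" "x1 = to_fract R2 / to_fract R1" using R1_0 by (simp_all add: field_simps)
  obtain c d where R1': "R1 = [:d, c:]" using degree_le_1_form[OF R1(1)] by blast
  obtain a b where R2': "R2 = [:b, a:]" using degree_le_1_form[OF R2(1)] by blast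
  \<comment> \<open>Otherwise R1 and R2 are proportional and the image of X is constant, against
    \<open>branch\<close>.\<close>
  have "a * d - b * c \<noteq> 0"
  proof
    assume det: "a * d - b * c = 0"
    obtain k where "R2 = [:k:] * R1"
    proof (cases "c = 0")
      case True
      thus ?thesis using that[of "b / d"] det R1_0 by (simp add: R1' R2')
    next
      case False
      thus ?thesis using that[of "a / c"] det by (simp add: R1' R2' field_simps)
    qed
    hence "to_fract R2 = fract_const k * to_fract R1" by (simp only: to_fract_mult)
    hence "x = (fract_const k, 0)" using x x' R1_0 by simp
    hence "\<sigma> \<xi> \<eta> x = fls_const k" by (simp add: \<sigma>_def)
    thus False using br by blast
  qed
  thus ?thesis using that[of "Mat2 a b c d"] x x' by (simp add: x_def[symmetric] R1' R2')
qed

text \<open>At every point f and F have order 0 or 1 while r^2 has even order. So the orders of f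
  and F agree, and r has neither zeros nor poles.\<close>

lemma coprime_roots_square_eq:
  fixes f F :: "'k::alg_closed_field poly"
  assumes sqf: "squarefree f" "squarefree F" and nz: "f \<noteq> 0" "F \<noteq> 0"
    and r: "to_fract f * r\<^sup>2 = to_fract F"
  obtains e where "e \<noteq> 0" "r = fract_const e" "F = smult (e\<^sup>2) f"
proof -
  obtain n d where nd: "d \<noteq> 0" "r = to_fract n / to_fract d" "\<And>a. poly d a = 0 \<Longrightarrow> poly n a \<noteq> 0"
    using fract_poly_cases_coprime[of r] by blast
  have "to_fract (f * (n * n)) = to_fract (F * (d * d))"
    using r nd(1,2) by (simp add: power2_eq_square field_simps)
  hence eq: "f * (n * n) = F * (d * d)" by (simp only: to_fract_eq_iff)
  have n0: "n \<noteq> 0" using eq nz nd(1) by auto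
  have ord: "Polynomial.order a f + 2 * Polynomial.order a n = Polynomial.order a F + 2 * Polynomial.order a d" for a
    using arg_cong[OF eq, of "Polynomial.order a"] nz n0 nd(1) by (simp add: order_mult)
  have le: "Polynomial.order a f \<le> 1" "Polynomial.order a F \<le> 1" for a
    using square_free_order_le_1 sqf nz by blast+
  have disj: "Polynomial.order a n = 0 \<or> Polynomial.order a d = 0" for a
    using nd(1,3) n0 by (auto simp: order_root)
  have zero: "Polynomial.order a n = 0 \<and> Polynomial.order a d = 0" for a
    using disj[of a] ord[of a] le[of a] by presburger
  have const: "degree p = 0" if "p \<noteq> 0" "\<And>a. Polynomial.order a p = 0" for p :: "'k poly"
    using that alg_closed_imp_poly_has_root[of p] by (auto simp: order_root)
  obtain k where k: "n = [:k:]" using const[OF n0] zero by (metis degree_eq_zeroE)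
  obtain l where l: "d = [:l:]" using const[OF nd(1)] zero by (metis degree_eq_zeroE)
  have kl: "k \<noteq> 0" "l \<noteq> 0" using k l n0 nd(1) by auto
  have "to_fract [:k:] = to_fract ([:k / l:] * [:l:])" using kl by simp
  hence "r = fract_const (k / l)" unfolding nd(2) k l to_fract_mult using kl by simp
  moreover have "F = smult ((k / l)\<^sup>2) f"
  proof -
    have "smult (l * l) F = smult (k * k) f" using eq by (simp add: k l)
    hence "smult (inverse (l * l)) (smult (l * l) F) = smult (inverse (l * l)) (smult (k * k) f)" by simp
    thus ?thesis using kl by (simp add: power2_eq_square field_simps)
  qed
  ultimately show ?thesis using that[of "k / l"] kl by simp
qed

text \<open>Given the image of X, let y1 + y2 Y be the image of Y. Its square lies in k(X), so y1 y2
  = 0, and y2 = 0 would make the transformed sextic a square in k(X). Then y2 (cX + d)^3 squares to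
  a quotient of two squarefree polynomials and is therefore constant.\<close>

theorem automorphism_mobius:
  fixes f :: "'k::{alg_closed_field, field_char_0} poly"
  assumes f: "genus2 f" and \<phi>: "\<phi> \<in> function_field_isos f f"
  obtains A e where "det2 A \<noteq> 0" "e \<noteq> 0" "subst6 A f = smult (e\<^sup>2) f" "\<phi> = mobius_map A e"
proof -
  obtain A where A: "det2 A \<noteq> 0" and X: "\<phi> (to_fract [:0, 1:], 0) = (mobius A, 0)"
    using automorphism_X[OF f \<phi>] by blast
  interpret transcendental_point fract_const "mobius A" using A by (rule transcendental_mobius)
  note hom = function_field_isosD[OF \<phi>]
  define F where "F = subst6 A f"
  have gF: "genus2 F" unfolding F_def using f A by (rule genus2_subst6)
  have deg: "degree f \<le> 6" "f \<noteq> 0" "F \<noteq> 0" using f gF by (auto simp: genus2_def)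
  have cof: "cofactor A \<noteq> 0" using A by (rule cofactor_nonzero)
  have poly: "\<phi> (to_fract p, 0) = (ev (to_fract p), 0)" for p
  proof (induction p)
    case 0
    show ?case using hom(4)[of 0] by simp
  next
    case (pCons a p)
    have "to_fract (pCons a p) = to_fract [:a:] + to_fract [:0, 1:] * to_fract p"
      by (simp flip: to_fract_add to_fract_mult)
    hence "(to_fract (pCons a p), 0) = (fract_const a, 0) \<oplus>\<^bsub>function_field f\<^esub>
        ((to_fract [:0, 1:], 0) \<otimes>\<^bsub>function_field f\<^esub> (to_fract p, 0))"
      by simp
    hence "\<phi> (to_fract (pCons a p), 0) = (fract_const a, 0) \<oplus>\<^bsub>function_field f\<^esub>
        ((mobius A, 0) \<otimes>\<^bsub>function_field f\<^esub> (ev (to_fract p), 0))"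
      by (simp only: hom X pCons.IH)
    thus ?case by simp
  qed
  obtain y1 y2 where y: "\<phi> (0, 1) = (y1, y2)" by fastforce
  have "(y1, y2) \<otimes>\<^bsub>function_field f\<^esub> (y1, y2) = \<phi> (to_fract f, 0)"
    unfolding y[symmetric] hom(2)[symmetric] by simp
  hence sq: "y1 * y1 + to_fract f * (y2 * y2) = ev (to_fract f)" and "y1 * y2 + y2 * y1 = 0"
    by (simp_all add: poly del: ev_to_fract)
  hence "2 * (y1 * y2) = 0" by (simp add: mult.commute)
  moreover have "(2 :: 'k poly fract) \<noteq> 0"
    by (metis one_add_one to_fract_1 to_fract_add to_fract_eq_0_iff zero_neq_numeral)
  ultimately have "y1 = 0 \<or> y2 = 0" by simp
  have F: "cofactor A ^ 6 * ev (to_fract f) = to_fract F"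
    using to_fract_subst6[OF A deg(1)] by (simp add: F_def)
  have "y2 \<noteq> 0"
  proof
    assume "y2 = 0"
    have "(y1 * cofactor A ^ 3)\<^sup>2 = cofactor A ^ 6 * (y1 * y1)"
      by (simp add: power_mult_distrib flip: power_mult) (simp add: power2_eq_square)
    also have "y1 * y1 = ev (to_fract f)" using sq \<open>y2 = 0\<close> by simp
    finally have "(y1 * cofactor A ^ 3)\<^sup>2 = to_fract F * 1\<^sup>2" using F by simp
    hence "(1 :: 'k poly fract) = 0"
      using gF by (intro to_fract_nonsquare[of F]) (auto simp: genus2_def)
    thus False by simp
  qed
  hence y1: "y1 = 0" using \<open>y1 = 0 \<or> y2 = 0\<close> by blast
  define r where "r = y2 * cofactor A ^ 3"
  have "r\<^sup>2 = y2 * y2 * cofactor A ^ 6"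
    by (simp add: r_def power_mult_distrib flip: power_mult) (simp add: power2_eq_square)
  hence "to_fract f * r\<^sup>2 = cofactor A ^ 6 * (to_fract f * (y2 * y2))" by simp
  also have "to_fract f * (y2 * y2) = ev (to_fract f)" using sq y1 by simp
  finally have "to_fract f * r\<^sup>2 = to_fract F" using F by simp
  then obtain e where e: "e \<noteq> 0" "r = fract_const e" "F = smult (e\<^sup>2) f"
    using coprime_roots_square_eq[of f F r] f gF deg by (auto simp: genus2_def)
  have y2: "y2 = fract_const e / cofactor A ^ 3" using e(2) cof by (simp add: r_def field_simps)
  have iso: "mobius_map A e \<in> function_field_isos f f"
    using A e deg by (intro mobius_map_iso) (simp_all add: F_def)
  have eq: "\<phi> = mobius_map A e"
  proof (rule iso_eqI[OF \<phi> iso f])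
    show "\<phi> (to_fract [:0, 1:], 0) = mobius_map A e (to_fract [:0, 1:], 0)"
      unfolding X mobius_map_def by (simp add: fract_const.h_1)
    show "\<phi> (0, 1) = mobius_map A e (0, 1)"
      unfolding y mobius_map_def y1 y2 by simp
  qed
  show ?thesis by (rule that[OF A e(1) e(3)[unfolded F_def] eq])
qed

subsection \<open>Groups of automorphisms\<close>

lemma subst6_subst6:
  fixes A B :: "'k::alg_closed_field mat2"
  assumes "det2 A \<noteq> 0" "det2 B \<noteq> 0" "degree f \<le> 6"
  shows "subst6 B (subst6 A f) = subst6 (mul2 A B) f"
proof -
  interpret A: transcendental_point fract_const "mobius A" using assms(1) by (rule transcendental_mobius)
  interpret B: transcendental_point fract_const "mobius B" using assms(2) by (rule transcendental_mobius)
  have AB: "det2 (mul2 A B) \<noteq> 0" using assms by (simp add: det2_mul2)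
  interpret AB: transcendental_point fract_const "mobius (mul2 A B)" using AB by (rule transcendental_mobius)
  have "to_fract (subst6 B (subst6 A f)) = cofactor B ^ 6 * B.ev (to_fract (subst6 A f))"
    using to_fract_subst6[OF assms(2) degree_subst6_le] by simp
  also have "\<dots> = cofactor B ^ 6 * B.ev (cofactor A ^ 6 * A.ev (to_fract f))"
    using to_fract_subst6[OF assms(1,3)] by simp
  also have "\<dots> = (B.ev (cofactor A) * cofactor B) ^ 6 * B.ev (A.ev (to_fract f))"
    by (simp only: B.ev_mult B.ev_power power_mult_distrib mult_ac)
  also have "\<dots> = to_fract (subst6 (mul2 A B) f)"
    using to_fract_subst6[OF AB assms(3)]
    by (simp only: eval_mobius_mobius[OF assms(1,2)] AB.ev_to_fract)
  finally show ?thesis by (simp only: to_fract_eq_iff)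
qed

lemma subst6_diag2_eqI:
  assumes "degree g \<le> 6" "\<And>i. i \<le> 6 \<Longrightarrow> l ^ i * m ^ (6 - i) * coeff f i = coeff g i"
  shows "subst6 (diag2 l m) f = g"
proof (rule poly_eqI)
  fix i
  show "coeff (subst6 (diag2 l m) f) i = coeff g i"
    using assms le_less_trans[OF degree_subst6_le, of i "diag2 l m" f]
    by (cases "i \<le> 6") (simp_all add: coeff_subst6_diag2 coeff_eq_0)
qed

lemma mul2_scalar [simp]: "mul2 A (diag2 1 1) = A" "mul2 (diag2 1 1) A = A"
  by (cases A; simp add: diag2_def)+

primrec pow2 :: "'k::comm_ring_1 mat2 \<Rightarrow> nat \<Rightarrow> 'k mat2" where
  "pow2 A 0 = diag2 1 1"
| "pow2 A (Suc n) = mul2 (pow2 A n) A"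

lemma det2_pow2: "det2 (pow2 A n) = det2 A ^ n"
  by (induction n) (simp_all add: det2_mul2)

lemma mobius_map_id: "mobius_map (diag2 1 1) (1::'k::alg_closed_field) = id"
  using mobius_map_scalar[of 1] by simp

lemma mobius_map_funpow:
  fixes A :: "'k::alg_closed_field mat2"
  assumes "det2 A \<noteq> 0"
  shows "mobius_map A e ^^ n = mobius_map (pow2 A n) (e ^ n)"
  using assms
  by (induction n) (simp_all add: mobius_map_id mobius_map_mobius_map det2_pow2 fun_eq_iff mult.commute)

text \<open>Converse of \<open>mobius_map_scalar\<close>: agreement on X forces a scalar matrix, and
  agreement on Y then fixes e. Through it, equations between automorphisms become equations between
  matrices.\<close>

lemma mobius_map_eq_scalar:
  fixes A :: "'k::alg_closed_field mat2"
  assumes A: "det2 A \<noteq> 0" and eq: "mobius_map A e = mobius_map (diag2 1 1) e0"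
  obtains l where "l \<noteq> 0" "A = diag2 l l" "e = l ^ 3 * e0"
proof -
  obtain a b c d where M: "A = Mat2 a b c d" by (cases A)
  interpret transcendental_point fract_const "mobius A" using A by (rule transcendental_mobius)
  interpret I: transcendental_point fract_const "mobius (diag2 1 1)" by (intro transcendental_mobius) simp
  have cof: "to_fract [:d, c:] \<noteq> 0" using cofactor_nonzero[OF A] by (simp add: M)
  have "mobius A = mobius (diag2 1 1)"
    using arg_cong[OF fun_cong[OF eq, of "(to_fract [:0, 1:], 0)"], of fst] by (simp add: mobius_map_def)
  hence "to_fract [:b, a:] = to_fract ([:0, 1:] * [:d, c:])"
    unfolding to_fract_mult using cof by (simp add: M diag2_def fract_const.h_1 divide_eq_eq)
  hence "[:b, a:] = [:0, 1:] * [:d, c:]" by (simp only: to_fract_eq_iff)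
  hence abc: "b = 0" "a = d" "c = 0" by simp_all
  have d: "d \<noteq> 0" using A abc by (simp add: M)
  have "fract_const e / fract_const d ^ 3 = fract_const e0"
    using arg_cong[OF fun_cong[OF eq, of "(0, 1)"], of snd]
    by (simp only: mobius_map_def snd_conv ev_1 I.ev_1 mult_1_left)
       (simp add: M abc diag2_def fract_const.h_1)
  hence "fract_const e = fract_const e0 * fract_const d ^ 3" using d by (simp add: divide_eq_eq)
  hence "fract_const e = fract_const (e0 * d ^ 3)" by (simp only: fract_const.h_mult power3_eq_cube)
  hence "e = d ^ 3 * e0" by (simp add: mult.commute)
  thus ?thesis using that[of d] d M abc by (simp add: diag2_def)
qed

abbreviation hyperelliptic :: "'k::field poly fract \<times> 'k poly fract \<Rightarrow> 'k poly fract \<times> 'k poly fract" where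
  "hyperelliptic \<equiv> mobius_map (diag2 1 1) (- 1)"

lemma hyperelliptic:
  fixes f :: "'k::{alg_closed_field, field_char_0} poly"
  assumes f: "genus2 f"
  shows "hyperelliptic \<in> function_field_isos f f" "hyperelliptic \<noteq> (id :: 'k poly fract \<times> 'k poly fract \<Rightarrow> _)"
    and "\<phi> \<in> function_field_isos f f \<Longrightarrow> \<phi> \<circ> hyperelliptic = hyperelliptic \<circ> \<phi>"
proof -
  have deg: "degree f \<le> 6" using f by (auto simp: genus2_def)
  show "hyperelliptic \<in> function_field_isos f f"
    using deg by (intro mobius_map_iso subst6_diag2_eqI) simp_all
  show "hyperelliptic \<noteq> (id :: 'k poly fract \<times> 'k poly fract \<Rightarrow> _)"
  proof
    assume "hyperelliptic = (id :: 'k poly fract \<times> 'k poly fract \<Rightarrow> _)"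
    hence "mobius_map (diag2 1 1) (- 1 :: 'k) = mobius_map (diag2 1 1) 1" by (simp add: mobius_map_id)
    from mobius_map_eq_scalar[OF _ this] obtain l :: 'k where "diag2 1 1 = diag2 l l" "- 1 = l ^ 3 * 1"
      by auto
    thus False by (simp add: diag2_def)
  qed
  assume "\<phi> \<in> function_field_isos f f"
  then obtain A e where "det2 A \<noteq> 0" and \<phi>: "\<phi> = mobius_map A e" using automorphism_mobius[OF f] by metis
  thus "\<phi> \<circ> hyperelliptic = hyperelliptic \<circ> \<phi>"
    unfolding \<phi> by (simp add: fun_eq_iff mobius_map_mobius_map)
qed

section \<open>Exponents and relations of the dihedral groups\<close>

lemma Aut_simps [simp]:
  "carrier (Aut f) = function_field_isos f f" "\<phi> \<otimes>\<^bsub>Aut f\<^esub> \<psi> = \<phi> \<circ> \<psi>" "\<one>\<^bsub>Aut f\<^esub> = id"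
  by (simp_all add: Aut_def)

lemma dihedral_simps [simp]:
  "carrier (dihedral_group n) = {0..<int n} \<times> UNIV"
  "(i, b) \<otimes>\<^bsub>dihedral_group n\<^esub> (j, c) = ((if b then i - j else i + j) mod int n, b \<noteq> c)"
  "\<one>\<^bsub>dihedral_group n\<^esub> = (0, False)"
  by (simp_all add: dihedral_group_def)

lemma Aut_nat_pow: "\<phi> [^]\<^bsub>Aut f\<^esub> (n::nat) = \<phi> ^^ n"
  by (induction n) (simp_all add: funpow_Suc_right del: funpow.simps(2))

text \<open>Rotations have order dividing n, and an even n annihilates the reflections as
  well.\<close>

lemma dihedral_exponent:
  assumes "even n" "n > 0" "v \<in> carrier (dihedral_group n)"
  shows "v [^]\<^bsub>dihedral_group n\<^esub> n = \<one>\<^bsub>dihedral_group n\<^esub>"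
proof -
  interpret group "dihedral_group n" using assms(2) by (rule group_dihedral_group)
  obtain i b where v: "v = (i, b)" by (cases v)
  show ?thesis
  proof (cases b)
    case True
    obtain m where m: "n = 2 * m" using assms(1) by blast
    have "v [^]\<^bsub>dihedral_group n\<^esub> (2::nat) = \<one>\<^bsub>dihedral_group n\<^esub>"
      using assms True unfolding v numeral_2_eq_2 by simp
    hence "(v [^]\<^bsub>dihedral_group n\<^esub> (2::nat)) [^]\<^bsub>dihedral_group n\<^esub> m = \<one>\<^bsub>dihedral_group n\<^esub>"
      by (simp only: nat_pow_one)
    thus ?thesis using nat_pow_pow[OF assms(3), of 2 m] m by simp
  next
    case False
    have "v [^]\<^bsub>dihedral_group n\<^esub> k = (int k * i mod int n, False)" for k :: nat
      using assms(2) by (induction k) (simp_all add: v False mod_simps algebra_simps)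
    thus ?thesis by simp
  qed
qed

lemma Aut_dihedral_exponent:
  assumes "Aut f \<cong> dihedral_group n" "even n" "n > 0" "\<phi> \<in> function_field_isos f f"
  shows "\<phi> ^^ n = id"
proof -
  interpret A: group "Aut f" by (rule group_Aut)
  interpret D: group "dihedral_group n" using assms(3) by (rule group_dihedral_group)
  obtain h where h: "h \<in> hom (Aut f) (dihedral_group n)" "bij_betw h (carrier (Aut f)) (carrier (dihedral_group n))"
    using assms(1) by (auto simp: is_iso_def iso_def)
  interpret group_hom "Aut f" "dihedral_group n" h by unfold_locales (rule h)
  have "h (\<phi> [^]\<^bsub>Aut f\<^esub> n) = h \<phi> [^]\<^bsub>dihedral_group n\<^esub> n"
    using assms(4) by (intro hom_nat_pow) simp
  also have "\<dots> = \<one>\<^bsub>dihedral_group n\<^esub>"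
    using assms h(1) by (intro dihedral_exponent) (auto dest: hom_in_carrier simp del: dihedral_simps)
  also have "\<dots> = h \<one>\<^bsub>Aut f\<^esub>" by (rule hom_one[symmetric])
  finally have "\<phi> [^]\<^bsub>Aut f\<^esub> n = \<one>\<^bsub>Aut f\<^esub>"
    using assms(4) by (intro inj_onD[OF bij_betw_imp_inj_on[OF h(2)]] A.nat_pow_closed A.one_closed) auto
  thus ?thesis by (simp add: Aut_nat_pow)
qed

text \<open>Conjugation with an isomorphism. It moves the exponent of the dihedral group to a normal
  form, where an explicit automorphism can contradict it.\<close>

lemma exponent_transfer:
  fixes f g :: "'k::{alg_closed_field, field_char_0} poly"
  assumes exp: "\<And>\<phi>. \<phi> \<in> function_field_isos f f \<Longrightarrow> \<phi> ^^ n = id"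
    and fg: "curve_isomorphic f g" and \<psi>: "\<psi> \<in> function_field_isos g g"
  shows "\<psi> ^^ n = id"
proof -
  obtain h where h: "h \<in> function_field_isos f g" using fg by (auto simp: curve_isomorphic_def)
  have bij: "bij h" by (rule function_field_isosD[OF h])
  define h' where "h' = inv_into UNIV h"
  have inv: "h' (h u) = u" "h (h' u) = u" for u
    using bij by (simp_all add: h'_def bij_is_inj surj_f_inv_f bij_is_surj)
  have "h' \<in> ring_iso (function_field g) (function_field f)"
    using h ring_iso_set_sym[OF cring.axioms(1)[OF function_field_cring], of h f "function_field g"]
    by (simp add: function_field_isos_def h'_def)
  moreover have "h' (const c) = const c" for c
    using h inv(1)[of "const c"] by (simp add: function_field_isos_def)
  ultimately have h': "h' \<in> function_field_isos g f" by (simp add: function_field_isos_def)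
  have "h' \<circ> \<psi> \<circ> h \<in> function_field_isos f f"
    using h h' \<psi> unfolding function_field_isos_def
    by (auto intro!: ring_iso_set_trans[of _ _ "function_field g"])
  hence "(h' \<circ> \<psi> \<circ> h) ^^ n = id" by (rule exp)
  moreover have "(h' \<circ> \<psi> \<circ> h) ^^ n = h' \<circ> \<psi> ^^ n \<circ> h"
    by (induction n) (simp_all add: fun_eq_iff inv)
  ultimately have "h' ((\<psi> ^^ n) (h u)) = u" for u by (cases u) (simp add: fun_eq_iff)
  hence "(\<psi> ^^ n) (h (h' u)) = h (h' u)" for u by (metis inv(2))
  thus ?thesis by (simp add: inv(2) fun_eq_iff)
qed

lemma subst6_imp_isomorphic:
  fixes f g :: "'k::{alg_closed_field, field_char_0} poly"
  assumes f: "genus2 f" and A: "det2 A \<noteq> 0" and k: "\<kappa> \<noteq> 0" and fg: "subst6 A f = smult \<kappa> g"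
  shows "curve_isomorphic f g"
proof -
  obtain e where "e\<^sup>2 = \<kappa>" using nth_root_exists[of 2 \<kappa>] by auto
  hence "mobius_map A e \<in> function_field_isos f g"
    using f A k fg by (intro mobius_map_iso) (auto simp: genus2_def)
  thus ?thesis by (auto simp: curve_isomorphic_def)
qed

lemma dihedral_4_square_root:
  assumes "Aut f \<cong> dihedral_group 4" and z: "z \<in> function_field_isos f f" "z \<noteq> id"
    and central: "\<And>\<phi>. \<phi> \<in> function_field_isos f f \<Longrightarrow> \<phi> \<circ> z = z \<circ> \<phi>"
  obtains r where "r \<in> function_field_isos f f" "r \<circ> r = z"
proof -
  interpret A: group "Aut f" by (rule group_Aut)
  interpret D: group "dihedral_group 4" by (rule group_dihedral_group) simp
  have "dihedral_group 4 \<cong> Aut f" using assms(1) by (rule A.iso_sym)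
  then obtain h where h: "h \<in> hom (dihedral_group 4) (Aut f)" "bij_betw h (carrier (dihedral_group 4)) (carrier (Aut f))"
    by (auto simp: is_iso_def iso_def)
  interpret group_hom "dihedral_group 4" "Aut f" h by unfold_locales (rule h)
  have inj: "inj_on h (carrier (dihedral_group 4))" using h(2) by (rule bij_betw_imp_inj_on)
  have "z \<in> h ` carrier (dihedral_group 4)" using h(2) z(1) by (simp add: bij_betw_def)
  then obtain i b where ib: "z = h (i, b)" "0 \<le> i" "i < 4" by auto
  have comm: "v \<otimes>\<^bsub>dihedral_group 4\<^esub> (i, b) = (i, b) \<otimes>\<^bsub>dihedral_group 4\<^esub> v"
    if v: "v \<in> carrier (dihedral_group 4)" for v
  proof (rule inj_onD[OF inj])
    have ib': "(i, b) \<in> carrier (dihedral_group 4)" using ib by simp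
    show "h (v \<otimes>\<^bsub>dihedral_group 4\<^esub> (i, b)) = h ((i, b) \<otimes>\<^bsub>dihedral_group 4\<^esub> v)"
      unfolding hom_mult[OF v ib'] hom_mult[OF ib' v]
      using central[of "h v"] hom_closed[OF v] ib(1) by simp
    show "v \<otimes>\<^bsub>dihedral_group 4\<^esub> (i, b) \<in> carrier (dihedral_group 4)"
      and "(i, b) \<otimes>\<^bsub>dihedral_group 4\<^esub> v \<in> carrier (dihedral_group 4)"
      using v ib' D.m_closed by blast+
  qed
  have "(i, b) \<noteq> (0, False)" using z(2) ib(1) hom_one by auto
  moreover have "i = 0 \<or> i = 1 \<or> i = 2 \<or> i = 3" using ib by auto
  \<comment> \<open>Commuting with the rotation excludes reflections; commuting with a reflection
    then leaves only the half turn, which is the square of the rotation.\<close>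
  ultimately have "i = 2 \<and> \<not> b"
    using comm[of "(1, False)"] comm[of "(0, True)"] by (cases b) auto
  hence "z = h ((1, False) \<otimes>\<^bsub>dihedral_group 4\<^esub> (1, False))" using ib by simp
  also have "\<dots> = h (1, False) \<circ> h (1, False)" by (subst hom_mult) simp_all
  finally show ?thesis using that[of "h (1, False)"] hom_closed[of "(1, False)"] by simp
qed

lemma dihedral_6_order_3:
  assumes "Aut f \<cong> dihedral_group 6"
  obtains r where "r \<in> function_field_isos f f" "r \<noteq> id" "r \<circ> r \<circ> r = id"
proof -
  interpret A: group "Aut f" by (rule group_Aut)
  interpret D: group "dihedral_group 6" by (rule group_dihedral_group) simp
  have "dihedral_group 6 \<cong> Aut f" using assms(1) by (rule A.iso_sym)
  then obtain h where h: "h \<in> hom (dihedral_group 6) (Aut f)" "bij_betw h (carrier (dihedral_group 6)) (carrier (Aut f))"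
    by (auto simp: is_iso_def iso_def)
  interpret group_hom "dihedral_group 6" "Aut f" h by unfold_locales (rule h)
  have inj: "inj_on h (carrier (dihedral_group 6))" using h(2) by (rule bij_betw_imp_inj_on)
  have "h (2, False) \<circ> h (2, False) \<circ> h (2, False) =
      h (((2, False) \<otimes>\<^bsub>dihedral_group 6\<^esub> (2, False)) \<otimes>\<^bsub>dihedral_group 6\<^esub> (2, False))"
    by (subst hom_mult, simp, simp, subst hom_mult) (simp_all del: dihedral_simps(2))
  also have "\<dots> = id" using hom_one by simp
  finally have "h (2, False) \<circ> h (2, False) \<circ> h (2, False) = id" .
  moreover have "h (2, False) \<noteq> id"
    using inj_onD[OF inj, of "(2, False)" "\<one>\<^bsub>dihedral_group 6\<^esub>"] hom_one by auto
  ultimately show ?thesis using that[of "h (2, False)"] hom_closed[of "(2, False)"] by simp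
qed

subsection \<open>Normal forms\<close>

text \<open>The columns of N are eigenvectors for l and m. Two formulas are available for them, and
  one applies unless the matrix is already diagonal.\<close>

lemma diagonalisation:
  fixes a b c d :: "'k::{alg_closed_field, field_char_0}"
  assumes det: "a * d - b * c \<noteq> 0" and nonscalar: "\<not> (b = 0 \<and> c = 0 \<and> a = d)"
    and disc: "(a + d)\<^sup>2 \<noteq> 4 * (a * d - b * c)"
  obtains N l m where "det2 N \<noteq> 0" "mul2 (Mat2 a b c d) N = mul2 N (diag2 l m)"
    "l \<noteq> m" "l + m = a + d" "l * m = a * d - b * c"
proof -
  obtain s where s: "s\<^sup>2 = (a + d)\<^sup>2 - 4 * (a * d - b * c)"
    using nth_root_exists[of 2 "(a + d)\<^sup>2 - 4 * (a * d - b * c)"] by auto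
  define l where "l = (a + d + s) / 2"
  define m where "m = (a + d - s) / 2"
  have lm: "l \<noteq> m" "l + m = a + d" "l * m = a * d - b * c"
  proof -
    have "s \<noteq> 0" using s disc by auto
    thus "l \<noteq> m" by (simp add: l_def m_def)
    show "l + m = a + d" by (simp add: l_def m_def field_simps)
    have "4 * (l * m) = (a + d)\<^sup>2 - s\<^sup>2" by (simp add: l_def m_def field_simps power2_eq_square)
    also have "\<dots> = 4 * (a * d - b * c)" by (simp add: s)
    finally show "l * m = a * d - b * c" by (simp only: mult_left_cancel[OF zero_neq_numeral[symmetric]])
  qed
  have l: "l * l = (a + d) * l - (a * d - b * c)" unfolding lm(2)[symmetric] lm(3)[symmetric] by (simp add: algebra_simps)
  have m: "m * m = (a + d) * m - (a * d - b * c)" unfolding lm(2)[symmetric] lm(3)[symmetric] by (simp add: algebra_simps)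
  consider "b \<noteq> 0" | "c \<noteq> 0" | "b = 0" "c = 0" by blast
  thus ?thesis
  proof cases
    case 1
    show ?thesis
    proof (rule that[of "Mat2 b b (l - a) (m - a)"])
      have "det2 (Mat2 b b (l - a) (m - a)) = b * (m - l)" by (simp add: algebra_simps)
      thus "det2 (Mat2 b b (l - a) (m - a)) \<noteq> 0" using 1 lm(1) by auto
      show "mul2 (Mat2 a b c d) (Mat2 b b (l - a) (m - a)) = mul2 (Mat2 b b (l - a) (m - a)) (diag2 l m)"
        using l m by (simp add: diag2_def algebra_simps)
    qed (use lm in auto)
  next
    case 2
    show ?thesis
    proof (rule that[of "Mat2 (l - d) (m - d) c c"])
      have "det2 (Mat2 (l - d) (m - d) c c) = c * (l - m)" by (simp add: algebra_simps)
      thus "det2 (Mat2 (l - d) (m - d) c c) \<noteq> 0" using 2 lm(1) by auto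
      show "mul2 (Mat2 a b c d) (Mat2 (l - d) (m - d) c c) = mul2 (Mat2 (l - d) (m - d) c c) (diag2 l m)"
        using l m by (simp add: diag2_def algebra_simps)
    qed (use lm in auto)
  next
    case 3
    show ?thesis
      by (rule that[of "Mat2 1 0 0 1" a d]) (use 3 nonscalar in \<open>simp_all add: diag2_def\<close>)
  qed
qed

text \<open>In eigencoordinates X^i has weight l^i m^(6 - i), so a coefficient can survive only
  where this weight equals k.\<close>

lemma diagonal_automorphism:
  fixes f :: "'k::{alg_closed_field, field_char_0} poly"
  assumes f: "degree f \<le> 6" and A: "det2 A \<noteq> 0" and N: "det2 N \<noteq> 0"
    and AN: "mul2 A N = mul2 N (diag2 l m)" and Af: "subst6 A f = smult k f" and i: "i \<le> 6"
  shows "l ^ i * m ^ (6 - i) * coeff (subst6 N f) i = k * coeff (subst6 N f) i"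
proof -
  have "det2 A * det2 N = det2 N * (l * m)"
    using arg_cong[OF AN, of det2] by (simp add: det2_mul2)
  hence D: "det2 (diag2 l m) \<noteq> 0" using A N by auto
  have "subst6 (diag2 l m) (subst6 N f) = subst6 N (subst6 A f)"
    by (simp only: subst6_subst6[OF N D f] subst6_subst6[OF A N f] AN)
  also have "\<dots> = smult k (subst6 N f)" unfolding Af by (rule subst6_smult)
  finally have "coeff (subst6 (diag2 l m) (subst6 N f)) i = k * coeff (subst6 N f) i" by simp
  thus ?thesis by (simp only: coeff_subst6_diag2[OF i])
qed

lemma poly_eq_sextic:
  assumes "degree p \<le> 6"
  shows "p = [:coeff p 0, coeff p 1, coeff p 2, coeff p 3, coeff p 4, coeff p 5, coeff p 6:]"
  using assms by (intro poly_eqI) (auto simp: coeff_pCons coeff_eq_0 eval_nat_numeral split: nat.split)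

text \<open>Infinity and 0 are at most simple roots. This decides which exponents can survive in the
  diagonal forms below.\<close>

lemma genus2_coeffs:
  assumes "genus2 g"
  shows "coeff g 5 \<noteq> 0 \<or> coeff g 6 \<noteq> 0" "coeff g 0 \<noteq> 0 \<or> coeff g 1 \<noteq> 0"
proof -
  have deg: "degree g = 5 \<or> degree g = 6" and g0: "g \<noteq> 0" and sqf: "squarefree g"
    using assms by (auto simp: genus2_def)
  show "coeff g 5 \<noteq> 0 \<or> coeff g 6 \<noteq> 0"
    using deg leading_coeff_neq_0[OF g0] by metis
  show "coeff g 0 \<noteq> 0 \<or> coeff g 1 \<noteq> 0"
  proof (rule ccontr)
    assume "\<not> ?thesis"
    then obtain h where "g = pCons 0 (pCons 0 h)"
      by (metis coeff_pCons_0 coeff_pCons_Suc One_nat_def pCons_cases)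
    hence "g = [:0, 1:] ^ 2 * h" by (simp add: power2_eq_square)
    hence "is_unit [:0, 1 :: 'a:]" using sqf by (intro squarefreeD[of g]) auto
    thus False by (simp add: is_unit_iff_degree)
  qed
qed

text \<open>The square root of the hyperelliptic involution gives A^2 = \<mu> and e^2 = -\<mu>^3. A
  non-scalar A then has trace 0 and eigenvalues m, -m with m^2 = \<mu>, so X^i has weight (-1)^i
  \<mu>^3, which equals e^2 only for odd i.\<close>

lemma D8_odd_form:
  fixes f :: "'k::{alg_closed_field, field_char_0} poly"
  assumes f: "genus2 f" and G: "Aut f \<cong> dihedral_group 4"
  obtains N a b c where "det2 N \<noteq> 0" "subst6 N f = [:0, c, 0, b, 0, a:]" "a \<noteq> 0" "c \<noteq> 0"
proof -
  have deg: "degree f \<le> 6" using f by (auto simp: genus2_def)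
  obtain r where r: "r \<in> function_field_isos f f" "r \<circ> r = hyperelliptic"
    using dihedral_4_square_root[OF G] hyperelliptic[OF f] by metis
  obtain A e where A: "det2 A \<noteq> 0" and e: "e \<noteq> 0" and Af: "subst6 A f = smult (e\<^sup>2) f" and rA: "r = mobius_map A e"
    using automorphism_mobius[OF f r(1)] by blast
  have m: "mobius_map (mul2 A A) (e * e) = hyperelliptic"
    using r(2) A unfolding rA by (simp add: fun_eq_iff mobius_map_mobius_map)
  have "det2 (mul2 A A) \<noteq> 0" using A by (simp add: det2_mul2)
  then obtain \<mu> where \<mu>: "\<mu> \<noteq> 0" "mul2 A A = diag2 \<mu> \<mu>" "e * e = \<mu> ^ 3 * - 1"
    using m by (rule mobius_map_eq_scalar)
  obtain a b c d where M: "A = Mat2 a b c d" by (cases A)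
  have ent: "a * a + b * c = \<mu>" "b * (a + d) = 0" "c * (a + d) = 0" "c * b + d * d = \<mu>"
    using \<mu>(2) by (simp_all add: M diag2_def algebra_simps)
  \<comment> \<open>A scalar A = a would give e^2 = a^6 = \<mu>^3, the wrong sign.\<close>
  have nonscalar: "\<not> (b = 0 \<and> c = 0 \<and> a = d)"
  proof
    assume *: "b = 0 \<and> c = 0 \<and> a = d"
    hence "A = diag2 a a" "a \<noteq> 0" using A by (auto simp: M diag2_def)
    hence "smult (e\<^sup>2) f = smult (a ^ 6) f"
      unfolding Af[symmetric] using deg
      by (intro subst6_diag2_eqI[of "smult (a ^ 6) f" a a f, folded \<open>A = diag2 a a\<close>])
         (auto simp flip: power_add intro: le_trans[OF degree_smult_le])
    hence "coeff (smult (e\<^sup>2) f) (degree f) = coeff (smult (a ^ 6) f) (degree f)" by (rule arg_cong)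
    moreover have "f \<noteq> 0" using f by (auto simp: genus2_def)
    ultimately have "e\<^sup>2 = a ^ 6" by simp
    moreover have "a ^ 6 = (a * a) ^ 3" by (simp add: power_mult_distrib flip: power_add)
    hence "a ^ 6 = \<mu> ^ 3" using ent(1) * by simp
    ultimately show False using \<mu> by (simp add: power2_eq_square)
  qed
  have tr: "a + d = 0"
  proof (rule ccontr)
    assume *: "a + d \<noteq> 0"
    hence bc: "b = 0" "c = 0" using ent by auto
    hence "(a + d) * (a - d) = 0" using ent by (simp add: algebra_simps)
    thus False using * bc nonscalar by simp
  qed
  have det: "a * d - b * c \<noteq> 0" using A by (simp add: M)
  obtain N l m where N: "det2 N \<noteq> 0" "mul2 A N = mul2 N (diag2 l m)" "l \<noteq> m" "l + m = a + d" "l * m = a * d - b * c"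
    using diagonalisation[OF det nonscalar, of thesis] tr det unfolding M by auto
  have l: "l = - m" using N(4) tr by (simp add: eq_neg_iff_add_eq_0)
  have "d = - a" using tr by (simp add: eq_neg_iff_add_eq_0 add.commute)
  hence "- (m * m) = - (a * a + b * c)" using N(5) unfolding l by simp
  hence "m\<^sup>2 = \<mu>" by (simp only: neg_equal_iff_equal ent(1) power2_eq_square)
  moreover have "m ^ 6 = (m\<^sup>2) ^ 3" by (simp flip: power_mult)
  ultimately have "m ^ 6 = \<mu> ^ 3" by simp
  define g where "g = subst6 N f"
  have gg: "genus2 g" unfolding g_def using f N(1) by (rule genus2_subst6)
  have even0: "coeff g i = 0" if "i \<le> 6" "even i" for i
  proof -
    have "l ^ i * m ^ (6 - i) * coeff g i = e\<^sup>2 * coeff g i"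
      unfolding g_def using diagonal_automorphism[OF deg A N(1,2) Af that(1)] .
    moreover have "l ^ i * m ^ (6 - i) = m ^ 6" using that by (simp add: l flip: power_add)
    ultimately have "2 * (\<mu> ^ 3 * coeff g i) = 0"
      using \<mu>(3) \<open>m ^ 6 = \<mu> ^ 3\<close> by (auto simp: power2_eq_square)
    thus ?thesis using \<mu>(1) by simp
  qed
  have "g = [:coeff g 0, coeff g 1, coeff g 2, coeff g 3, coeff g 4, coeff g 5, coeff g 6:]"
    unfolding g_def by (intro poly_eq_sextic degree_subst6_le)
  hence "subst6 N f = [:0, coeff g 1, 0, coeff g 3, 0, coeff g 5:]"
    using even0[of 0] even0[of 2] even0[of 4] even0[of 6] by (simp flip: g_def)
  thus ?thesis
    using that[OF N(1)] genus2_coeffs[OF gg] even0[of 0] even0[of 6] by auto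
qed

text \<open>The ratio w of the eigenvalues is a primitive cube root of unity, so the surviving
  exponents agree modulo 3. Class 1 would put a double root at infinity and class 2 one at 0, which
  leaves the exponents 0, 3, 6.\<close>

lemma D12_cubic_form:
  fixes f :: "'k::{alg_closed_field, field_char_0} poly"
  assumes f: "genus2 f" and G: "Aut f \<cong> dihedral_group 6"
  obtains N a b c where "det2 N \<noteq> 0" "subst6 N f = [:c, 0, 0, b, 0, 0, a:]" "a \<noteq> 0" "c \<noteq> 0"
proof -
  have deg: "degree f \<le> 6" using f by (auto simp: genus2_def)
  obtain r where r: "r \<in> function_field_isos f f" "r \<noteq> id" "r \<circ> r \<circ> r = id"
    using dihedral_6_order_3[OF G] by blast
  obtain A e where A: "det2 A \<noteq> 0" and e: "e \<noteq> 0" and Af: "subst6 A f = smult (e\<^sup>2) f" and rA: "r = mobius_map A e"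
    using automorphism_mobius[OF f r(1)] by blast
  have m: "mobius_map (mul2 A (mul2 A A)) (e * (e * e)) = mobius_map (diag2 1 1) 1"
    using r(3) A unfolding rA mobius_map_id by (simp add: fun_eq_iff mobius_map_mobius_map det2_mul2 mul2_assoc mult.assoc)
  have "det2 (mul2 A (mul2 A A)) \<noteq> 0" using A by (simp add: det2_mul2)
  then obtain \<mu> where \<mu>: "\<mu> \<noteq> 0" "mul2 A (mul2 A A) = diag2 \<mu> \<mu>" "e * (e * e) = \<mu> ^ 3 * 1"
    using m by (rule mobius_map_eq_scalar)
  obtain a b c d where M: "A = Mat2 a b c d" by (cases A)
  \<comment> \<open>By Cayley-Hamilton A^3 = D A - tr A det A, so a scalar cube of a non-scalar A
    forces D = 0.\<close>
  define D where "D = (a + d)\<^sup>2 - (a * d - b * c)"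
  have ent: "b * D = 0" "c * D = 0" "a * D - (a + d) * (a * d - b * c) = \<mu>" "d * D - (a + d) * (a * d - b * c) = \<mu>"
    using \<mu>(2) by (simp_all add: M D_def diag2_def algebra_simps power2_eq_square)
  have nonscalar: "\<not> (b = 0 \<and> c = 0 \<and> a = d)"
  proof
    assume *: "b = 0 \<and> c = 0 \<and> a = d"
    hence Aa: "A = diag2 a a" and a0: "a \<noteq> 0" using A by (auto simp: M diag2_def)
    hence "smult (e\<^sup>2) f = smult (a ^ 6) f"
      unfolding Af[symmetric] using deg
      by (intro subst6_diag2_eqI[of "smult (a ^ 6) f" a a f, folded \<open>A = diag2 a a\<close>])
         (auto simp flip: power_add intro: le_trans[OF degree_smult_le])
    hence "coeff (smult (e\<^sup>2) f) (degree f) = coeff (smult (a ^ 6) f) (degree f)" by (rule arg_cong)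
    moreover have "f \<noteq> 0" using f by (auto simp: genus2_def)
    ultimately have "e\<^sup>2 = a ^ 6" by simp
    moreover have "\<mu> = a ^ 3" using ent(3) * by (simp add: D_def algebra_simps power2_eq_square power3_eq_cube)
    hence "e * (e * e) = a ^ 9" using \<mu>(3) by (simp flip: power_mult)
    hence "e ^ 3 = a ^ 9" by (simp add: power3_eq_cube mult.assoc)
    moreover have "e ^ 3 = e\<^sup>2 * e" by (simp add: power3_eq_cube power2_eq_square)
    moreover have "a ^ 9 = a ^ 6 * a ^ 3" by (simp flip: power_add)
    \<comment> \<open>From e^2 = a^6 and e^3 = a^9 one gets e = a^3: with a scalar A the
      automorphism would be the identity.\<close>
    ultimately have "a ^ 6 * e = a ^ 6 * a ^ 3" using \<open>e ^ 3 = a ^ 9\<close> by metis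
    hence "e = a ^ 3" using a0 by (metis mult_left_cancel power_not_zero)
    hence "r = id" using rA Aa mobius_map_scalar[OF a0] by simp
    thus False using r(2) by blast
  qed
  have D0: "D = 0"
  proof (rule ccontr)
    assume *: "D \<noteq> 0"
    hence "b = 0" "c = 0" using ent by auto
    moreover have "a * D = d * D" using ent(3,4) by (metis diff_add_cancel)
    ultimately show False using * nonscalar by simp
  qed
  have det: "a * d - b * c \<noteq> 0" using A by (simp add: M)
  have "(a + d)\<^sup>2 = a * d - b * c" using D0 by (simp add: D_def)
  hence "(a + d)\<^sup>2 \<noteq> 4 * (a * d - b * c)" using det by simp
  then obtain N l m where N: "det2 N \<noteq> 0" "mul2 A N = mul2 N (diag2 l m)" "l \<noteq> m" "l + m = a + d" "l * m = a * d - b * c"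
    using diagonalisation[OF det nonscalar] unfolding M by metis
  have lm0: "l \<noteq> 0" "m \<noteq> 0" using N(5) det by auto
  have "l\<^sup>2 + l * m + m\<^sup>2 = 0"
    using D0 unfolding D_def N(4)[symmetric] N(5)[symmetric] by (simp add: algebra_simps power2_eq_square)
  hence "(l - m) * (l\<^sup>2 + l * m + m\<^sup>2) = 0" by simp
  hence cube: "l ^ 3 = m ^ 3" by (simp add: algebra_simps power2_eq_square power3_eq_cube)
  define w where "w = l / m"
  have l: "l = w * m" using lm0 by (simp add: w_def)
  have w3: "w ^ 3 = 1" using cube lm0 by (simp add: w_def power_divide)
  have w1: "w \<noteq> 1" using N(3) l by auto
  have w2: "w\<^sup>2 \<noteq> 1"
  proof
    assume "w\<^sup>2 = 1"
    hence "w ^ 3 = w" by (simp add: power2_eq_square power3_eq_cube)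
    thus False using w3 w1 by simp
  qed
  have w4: "w ^ 4 = w" "w ^ 5 = w\<^sup>2" "w ^ 6 = 1"
    using w3 power_add[of w 3 1] power_add[of w 3 2] power_add[of w 3 3] by simp_all
  define g where "g = subst6 N f"
  have gg: "genus2 g" unfolding g_def using f N(1) by (rule genus2_subst6)
  define k where "k = e\<^sup>2 / m ^ 6"
  have diag: "w ^ i * coeff g i = k * coeff g i" if "i \<le> 6" for i
  proof -
    have "l ^ i * m ^ (6 - i) * coeff g i = e\<^sup>2 * coeff g i"
      unfolding g_def using diagonal_automorphism[OF deg A N(1,2) Af that(1)] .
    moreover have "l ^ i * m ^ (6 - i) = w ^ i * m ^ 6"
      using that by (simp add: l power_mult_distrib mult.assoc flip: power_add)
    ultimately show ?thesis using lm0 by (simp add: k_def field_simps)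
  qed
  \<comment> \<open>Otherwise X^5 survives, the common weight is w^2, and both lowest coefficients
    vanish.\<close>
  have a6: "coeff g 6 \<noteq> 0"
  proof
    assume a6: "coeff g 6 = 0"
    hence "coeff g 5 \<noteq> 0" using genus2_coeffs[OF gg] by simp
    hence k: "k = w\<^sup>2" using diag[of 5] w4 by simp
    have "(w\<^sup>2 - 1) * coeff g 0 = 0" using diag[of 0] k by (simp add: algebra_simps)
    hence "coeff g 0 = 0" using w2 by simp
    moreover have "coeff g 1 = 0"
    proof (rule ccontr)
      assume "coeff g 1 \<noteq> 0"
      hence "w = w\<^sup>2" using diag[of 1] k by simp
      hence "w * (w - 1) = 0" by (simp add: algebra_simps power2_eq_square)
      thus False using w1 lm0 by (simp add: w_def)
    qed
    ultimately show False using genus2_coeffs[OF gg] by simp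
  qed
  hence k: "k = 1" using diag[of 6] w4 by simp
  have "coeff g 1 = 0" "coeff g 2 = 0" "coeff g 4 = 0" "coeff g 5 = 0"
    using diag[of 1] diag[of 2] diag[of 4] diag[of 5] k w1 w2 w4 by simp_all
  moreover have "g = [:coeff g 0, coeff g 1, coeff g 2, coeff g 3, coeff g 4, coeff g 5, coeff g 6:]"
    unfolding g_def by (intro poly_eq_sextic degree_subst6_le)
  ultimately have "subst6 N f = [:coeff g 0, 0, 0, coeff g 3, 0, 0, coeff g 6:]" by (simp flip: g_def)
  moreover have "coeff g 0 \<noteq> 0" using genus2_coeffs[OF gg] \<open>coeff g 1 = 0\<close> by simp
  ultimately show ?thesis using that[OF N(1)] a6 by blast
qed

lemma pow2_diag2: "pow2 (diag2 l m) n = diag2 (l ^ n) (m ^ n)"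
  by (induction n) (simp_all add: diag2_def mult.commute)

lemma mobius_map_funpow_eq_id:
  fixes A :: "'k::alg_closed_field mat2"
  assumes "det2 A \<noteq> 0" "mobius_map A e ^^ n = id"
  obtains l where "l \<noteq> 0" "pow2 A n = diag2 l l" "e ^ n = l ^ 3"
proof -
  have "mobius_map (pow2 A n) (e ^ n) = mobius_map (diag2 1 1) 1"
    using assms(2) unfolding mobius_map_funpow[OF assms(1)] mobius_map_id .
  moreover have "det2 (pow2 A n) \<noteq> 0" using assms(1) by (simp add: det2_pow2)
  ultimately show ?thesis using mobius_map_eq_scalar[of "pow2 A n" "e ^ n" 1] that by auto
qed

subsection \<open>Curves with larger automorphism groups\<close>

text \<open>
  The two dihedral groups have exponent 4 and 6, and each of the following curves has an
  automorphism violating this: in the first and last family the six branch points form an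
  octahedron, in the other two a regular hexagon.
\<close>

lemma quintic_exponent:
  fixes a c :: "'k::{alg_closed_field, field_char_0}"
  assumes "a \<noteq> 0"
  obtains \<psi> where "\<psi> \<in> function_field_isos [:0, c, 0, 0, 0, a:] [:0, c, 0, 0, 0, a:]" "\<psi> ^^ 4 \<noteq> id"
proof -
  let ?g = "[:0, c, 0, 0, 0, a:]"
  \<comment> \<open>The quarter turn of X by e^2 goes with multiplication of Y by e; its fourth
    power is the hyperelliptic involution.\<close>
  obtain e :: 'k where e: "e ^ 4 = - 1" using nth_root_exists[of 4 "- 1 :: 'k"] by auto
  have e0: "e \<noteq> 0" using e by auto
  have e8: "e ^ 8 = 1" using power_mult[of e 4 2] e by simp
  have e10: "e ^ 10 = e\<^sup>2" using power_add[of e 8 2] e8 by simp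
  have "subst6 (diag2 l 1) ?g = [:0, l * c, 0, 0, 0, l ^ 5 * a:]" for l
    by (simp add: diag2_def eval_nat_numeral algebra_simps)
  moreover have "(e\<^sup>2) ^ 5 = e\<^sup>2" using e10 by (simp flip: power_mult)
  ultimately have "subst6 (diag2 (e\<^sup>2) 1) ?g = smult (e\<^sup>2) ?g" by simp
  hence "mobius_map (diag2 (e\<^sup>2) 1) e \<in> function_field_isos ?g ?g"
    using e0 by (intro mobius_map_iso) simp_all
  moreover have "mobius_map (diag2 (e\<^sup>2) 1) e ^^ 4 \<noteq> id"
  proof
    assume "mobius_map (diag2 (e\<^sup>2) 1) e ^^ 4 = id"
    then obtain l where "pow2 (diag2 (e\<^sup>2) 1) 4 = diag2 l l" "e ^ 4 = l ^ 3"
      using mobius_map_funpow_eq_id[where A = "diag2 (e\<^sup>2) 1" and e = e and n = 4] e0 by auto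
    hence "l = 1" "e ^ 4 = l ^ 3" by (simp_all add: pow2_diag2) (simp_all add: diag2_def)
    thus False using e by simp
  qed
  ultimately show ?thesis by (rule that)
qed

lemma harmonic_exponent:
  fixes g :: "'k::{alg_closed_field, field_char_0} poly"
  assumes "g = [:0, 9 / 100, 0, 1, 0, 1:]"
  obtains \<psi> where "\<psi> \<in> function_field_isos g g" "\<psi> ^^ 4 \<noteq> id"
proof -
  \<comment> \<open>With p^2 = -1/10 the quintic is X (X^2 - p^2) (X^2 - 9 p^2).\<close>
  obtain p :: 'k where p: "p\<^sup>2 = - 1 / 10" using nth_root_exists[of 2 "- 1 / 10 :: 'k"] by auto
  have p0: "p \<noteq> 0" using p by auto
  have p4: "p ^ 4 = 1 / 100" using power_mult[of p 2 2] p by (simp add: power2_eq_square)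
  have g: "g = [:0, 9 * p ^ 4, 0, - 10 * p\<^sup>2, 0, 1:]" using assms p p4 by (simp add: mult.commute)
  \<comment> \<open>This transformation runs through the branch points in the cycle 0, p, 3p,
    infinity, -3p, -p, so it has order 6.\<close>
  define A where "A = Mat2 (- 3 * p) (- 3 * p\<^sup>2) 1 (- 3 * p)"
  have det: "det2 A = 12 * p\<^sup>2" by (simp add: A_def power2_eq_square)
  obtain e where e: "e\<^sup>2 = - 1728 * p ^ 6" using nth_root_exists[of 2 "- 1728 * p ^ 6"] by auto
  have e0: "e \<noteq> 0" using e p0 by auto
  have "subst6 A g = smult (e\<^sup>2) g"
    unfolding e by (simp add: g A_def eval_nat_numeral algebra_simps)
  moreover have "degree g \<le> 6" using assms by simp
  ultimately have "mobius_map A e \<in> function_field_isos g g"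
    using det p0 e0 by (intro mobius_map_iso) simp_all
  moreover have "mobius_map A e ^^ 4 \<noteq> id"
  proof
    assume "mobius_map A e ^^ 4 = id"
    then obtain l where "pow2 A 4 = diag2 l l"
      using mobius_map_funpow_eq_id[where A = A and e = e and n = 4] det p0 by auto
    \<comment> \<open>The upper right entry of A^4.\<close>
    hence "216 * p ^ 5 = 0" by (simp add: A_def diag2_def eval_nat_numeral algebra_simps)
    thus False using p0 by simp
  qed
  ultimately show ?thesis by (rule that)
qed

lemma sextic_exponent:
  fixes a c :: "'k::{alg_closed_field, field_char_0}"
  assumes "a \<noteq> 0" "c \<noteq> 0"
  obtains \<psi> where "\<psi> \<in> function_field_isos [:c, 0, 0, 0, 0, 0, a:] [:c, 0, 0, 0, 0, 0, a:]" "\<psi> ^^ 6 \<noteq> id"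
proof -
  let ?g = "[:c, 0, 0, 0, 0, 0, a:]"
  define k where "k = c / a"
  have k0: "k \<noteq> 0" using assms by (simp add: k_def)
  have c: "c = a * k" using assms by (simp add: k_def)
  obtain s where s: "s ^ 3 = k" using nth_root_exists[of 3 k] by auto
  have s0: "s \<noteq> 0" using s k0 by auto
  have s6: "s ^ 6 = k ^ 2" using power_mult[of s 3 2] s by simp
  obtain e where e: "e\<^sup>2 = k" using nth_root_exists[of 2 k] by auto
  have e0: "e \<noteq> 0" using e k0 by auto
  \<comment> \<open>This sends X to -s/X, and A^2 = -s. A trivial square would need e^2 = (-s)^3,
    but e^2 = s^3; so the square is the hyperelliptic involution and the order is 4.\<close>
  define A where "A = Mat2 0 (- s) 1 0"
  have det: "det2 A = s" by (simp add: A_def)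
  have "subst6 A ?g = [:a * s ^ 6, 0, 0, 0, 0, 0, c:]"
    by (simp add: A_def eval_nat_numeral algebra_simps)
  also have "\<dots> = smult (e\<^sup>2) ?g" unfolding e s6 by (simp add: c power2_eq_square)
  finally have "mobius_map A e \<in> function_field_isos ?g ?g"
    using det s0 e0 by (intro mobius_map_iso) simp_all
  moreover have "mobius_map A e ^^ 6 \<noteq> id"
  proof
    assume "mobius_map A e ^^ 6 = id"
    then obtain l where l: "pow2 A 6 = diag2 l l" "e ^ 6 = l ^ 3"
      using mobius_map_funpow_eq_id[where A = A and e = e and n = 6] det s0 by auto
    have "l = - (s ^ 3)" using l(1) by (simp add: A_def diag2_def eval_nat_numeral algebra_simps)
    hence "e ^ 6 = - (k ^ 3)" using l(2) s by simp
    moreover have "e ^ 6 = k ^ 3" using power_mult[of e 2 3] e by simp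
    ultimately have "2 * k ^ 3 = 0" by simp
    thus False using k0 by simp
  qed
  ultimately show ?thesis by (rule that)
qed

lemma octahedral_exponent:
  fixes g :: "'k::{alg_closed_field, field_char_0} poly"
  assumes "g = [:- 1 / 50, 0, 0, 1, 0, 0, 1:]"
  obtains \<psi> where "\<psi> \<in> function_field_isos g g" "\<psi> ^^ 6 \<noteq> id"
proof -
  obtain h :: 'k where h: "h\<^sup>2 = 3" using nth_root_exists[of 2 "3 :: 'k"] by auto
  \<comment> \<open>Let w be a primitive cube root of unity. The equation r^2 + 4 r + 1 = 0 says
    that the half turn fixing q and r q exchanges w q with w r q and w^2 q with w^2 r q. The
    resulting relation for r^3 corresponds to t = -1/50.\<close>
  define r where "r = h - 2"
  have r2: "r * r = - 4 * r - 1" using h by (simp add: r_def power2_eq_square algebra_simps)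
  have r3: "r ^ 3 = 15 * r + 4"
  proof -
    have "r ^ 3 = r * (r * r)" by (simp add: power3_eq_cube)
    also have "\<dots> = r * (- 4 * r - 1)" by (simp only: r2)
    also have "\<dots> = - 4 * (r * r) - r" by (simp add: algebra_simps)
    also have "\<dots> = 15 * r + 4" unfolding r2 by (simp add: algebra_simps)
    finally show ?thesis .
  qed
  have "(15 * r + 5) * (15 * r + 5) = - 50 * (15 * r + 4)"
  proof -
    have "(15 * r + 5) * (15 * r + 5) = 225 * (r * r) + 150 * r + 25" by (simp add: algebra_simps)
    thus ?thesis unfolding r2 by (simp add: algebra_simps)
  qed
  hence rel: "(1 + r ^ 3) * (1 + r ^ 3) = - 50 * r ^ 3" by (simp add: r3 algebra_simps)
  have r0: "r \<noteq> 0" using r2 by auto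
  have r3_1: "1 + r ^ 3 \<noteq> 0" using rel r0 by auto
  have r1: "r \<noteq> 1" using r2 by auto
  obtain q where "q ^ 3 = - 1 / (1 + r ^ 3)" using nth_root_exists[of 3 "- 1 / (1 + r ^ 3)"] by auto
  hence q: "q ^ 3 * (1 + r ^ 3) = - 1" using r3_1 by (simp add: field_simps)
  have q0: "q \<noteq> 0" using q by auto
  have "(q ^ 3 * (1 + r ^ 3)) * (q ^ 3 * (1 + r ^ 3)) = q ^ 6 * ((1 + r ^ 3) * (1 + r ^ 3))"
    by (simp add: algebra_simps flip: power_add)
  hence "1 = q ^ 6 * (- 50 * r ^ 3)" unfolding q rel by simp
  hence "50 * (r ^ 3 * q ^ 6) = - 1" by (simp add: minus_equation_iff mult_ac)
  hence "r ^ 3 * q ^ 6 = - 1 / 50" by (simp add: field_simps)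
  moreover have "- (q ^ 3) * (1 + r ^ 3) = 1" using q by simp
  \<comment> \<open>That is, g = (X^3 - q^3) (X^3 - r^3 q^3).\<close>
  ultimately have g: "g = [:r ^ 3 * q ^ 6, 0, 0, - (q ^ 3) * (1 + r ^ 3), 0, 0, 1:]" using assms by simp
  \<comment> \<open>The involution of the line with fixed points q and r q. Since A^2 = l and e^2 =
    -l^3, the automorphism again squares to the hyperelliptic involution.\<close>
  define A where "A = Mat2 ((1 + r) * q) (- 2 * r * q\<^sup>2) 2 (- (1 + r) * q)"
  define l where "l = q\<^sup>2 * (1 - r)\<^sup>2"
  have l0: "l \<noteq> 0" using q0 r1 by (simp add: l_def)
  have det: "det2 A = - l" by (simp add: A_def l_def power2_eq_square algebra_simps)
  have AA: "mul2 A A = diag2 l l" by (simp add: A_def l_def diag2_def power2_eq_square algebra_simps)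
  obtain e where e: "e\<^sup>2 = - (l ^ 3)" using nth_root_exists[of 2 "- (l ^ 3)"] by auto
  have e0: "e \<noteq> 0" using e l0 by auto
  have "subst6 A g = smult (e\<^sup>2) g"
    unfolding e l_def g A_def
  proof -
    have r2': "r * (r * x) = - 4 * (r * x) - x" for x
      unfolding mult.assoc[symmetric] r2 by (simp add: algebra_simps)
    show "subst6 (Mat2 ((1 + r) * q) (- 2 * r * q\<^sup>2) 2 (- (1 + r) * q)) [:r ^ 3 * q ^ 6, 0, 0, - (q ^ 3) * (1 + r ^ 3), 0, 0, 1:] =
        smult (- ((q\<^sup>2 * (1 - r)\<^sup>2) ^ 3)) [:r ^ 3 * q ^ 6, 0, 0, - (q ^ 3) * (1 + r ^ 3), 0, 0, 1:]"
      by (simp add: eval_nat_numeral) (simp add: algebra_simps r2 r2')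
  qed
  moreover have "degree g \<le> 6" using assms by simp
  ultimately have "mobius_map A e \<in> function_field_isos g g"
    using det l0 e0 by (intro mobius_map_iso) simp_all
  moreover have "mobius_map A e ^^ 6 \<noteq> id"
  proof
    assume "mobius_map A e ^^ 6 = id"
    then obtain m where m: "pow2 A 6 = diag2 m m" "e ^ 6 = m ^ 3"
      using mobius_map_funpow_eq_id[where A = A and e = e and n = 6] det l0 by auto
    have "pow2 A 6 = mul2 (mul2 A A) (mul2 (mul2 A A) (mul2 A A))"
      by (simp add: eval_nat_numeral mul2_assoc)
    hence "m = l ^ 3" using m(1) unfolding AA by (simp add: diag2_def power3_eq_cube)
    moreover have "e ^ 6 = - (l ^ 9)" using power_mult[of e 2 3] e by (simp flip: power_mult)
    ultimately have "2 * l ^ 9 = 0" using m(2) by (simp flip: power_mult)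
    thus False using l0 by simp
  qed
  ultimately show ?thesis by (rule that)
qed

subsection \<open>Curves with dihedral automorphism group\<close>

lemma genus2_smult:
  assumes "genus2 (smult \<kappa> g)" "\<kappa> \<noteq> 0"
  shows "genus2 g"
proof -
  have "is_unit p" if "p ^ 2 dvd g" for p
  proof -
    have "p ^ 2 dvd smult \<kappa> g" using that by (rule dvd_smult)
    thus ?thesis using assms(1) by (auto simp: genus2_def dest: squarefreeD)
  qed
  thus ?thesis using assms by (auto simp: genus2_def squarefree_def)
qed

text \<open>Scaling X by s with s^2 = b / a equalises the coefficients of X^5 and X^3 and leaves t =
  a c / b^2. Both b = 0 and t = 9/100 contradict exponent 4.\<close>

lemma D8_normal_form:
  fixes f :: "'k::{alg_closed_field, field_char_0} poly"
  assumes f: "genus2 f" and G: "Aut f \<cong> dihedral_group 4"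
  obtains M \<kappa> t where "det2 M \<noteq> 0" "\<kappa> \<noteq> 0" "subst6 M f = smult \<kappa> [:0, t, 0, 1, 0, 1:]" "t \<noteq> 9 / 100"
proof -
  have deg: "degree f \<le> 6" using f by (auto simp: genus2_def)
  obtain N a b c where N: "det2 N \<noteq> 0" and Nf: "subst6 N f = [:0, c, 0, b, 0, a:]" and a: "a \<noteq> 0" and c: "c \<noteq> 0"
    using D8_odd_form[OF f G] by metis
  have exp: "\<psi> ^^ 4 = id" if "curve_isomorphic f g" "\<psi> \<in> function_field_isos g g" for g and \<psi>
    using Aut_dihedral_exponent[OF G] exponent_transfer[OF _ that] by simp
  have b: "b \<noteq> 0"
  proof
    assume "b = 0"
    hence "subst6 N f = smult 1 [:0, c, 0, 0, 0, a:]" using Nf by simp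
    hence "curve_isomorphic f [:0, c, 0, 0, 0, a:]"
      by (rule subst6_imp_isomorphic[OF f N one_neq_zero])
    thus False using exp quintic_exponent[OF a, of c] by metis
  qed
  obtain s where s: "s\<^sup>2 = b / a" using nth_root_exists[of 2 "b / a"] by auto
  have s0: "s \<noteq> 0" using s a b by auto
  define t where "t = a * c / b\<^sup>2"
  define M where "M = mul2 N (diag2 s 1)"
  have M: "det2 M \<noteq> 0" using N s0 by (simp add: M_def det2_mul2)
  have "subst6 M f = subst6 (diag2 s 1) [:0, c, 0, b, 0, a:]"
    unfolding M_def Nf[symmetric] using N s0 deg by (intro subst6_subst6[symmetric]) simp_all
  also have "\<dots> = [:0, s * c, 0, s ^ 3 * b, 0, s ^ 5 * a:]"
    by (simp add: diag2_def eval_nat_numeral algebra_simps)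
  also have "\<dots> = smult (s ^ 3 * b) [:0, t, 0, 1, 0, 1:]"
  proof -
    have "s ^ 3 = s * (b / a)" "s ^ 5 = s ^ 3 * (b / a)"
      unfolding s[symmetric] by (simp_all add: eval_nat_numeral)
    thus ?thesis using a b by (simp add: t_def power2_eq_square field_simps)
  qed
  finally have Mf: "subst6 M f = smult (s ^ 3 * b) [:0, t, 0, 1, 0, 1:]" .
  have \<kappa>: "s ^ 3 * b \<noteq> 0" using s0 b by simp
  have "t \<noteq> 9 / 100"
  proof
    assume t: "t = 9 / 100"
    have "curve_isomorphic f [:0, t, 0, 1, 0, 1:]" by (rule subst6_imp_isomorphic[OF f M \<kappa> Mf])
    thus False using exp harmonic_exponent[OF refl] unfolding t by metis
  qed
  thus ?thesis using that M \<kappa> Mf by blast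
qed

text \<open>The scaling is s^3 = b / a here, and b = 0 and t = -1/50 contradict exponent 6.\<close>

lemma D12_normal_form:
  fixes f :: "'k::{alg_closed_field, field_char_0} poly"
  assumes f: "genus2 f" and G: "Aut f \<cong> dihedral_group 6"
  obtains M \<kappa> t where "det2 M \<noteq> 0" "\<kappa> \<noteq> 0" "subst6 M f = smult \<kappa> [:t, 0, 0, 1, 0, 0, 1:]" "t \<noteq> - 1 / 50"
proof -
  have deg: "degree f \<le> 6" using f by (auto simp: genus2_def)
  obtain N a b c where N: "det2 N \<noteq> 0" and Nf: "subst6 N f = [:c, 0, 0, b, 0, 0, a:]" and a: "a \<noteq> 0" and c: "c \<noteq> 0"
    using D12_cubic_form[OF f G] by metis
  have exp: "\<psi> ^^ 6 = id" if "curve_isomorphic f g" "\<psi> \<in> function_field_isos g g" for g and \<psi>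
    using Aut_dihedral_exponent[OF G] exponent_transfer[OF _ that] by simp
  have b: "b \<noteq> 0"
  proof
    assume "b = 0"
    hence "subst6 N f = smult 1 [:c, 0, 0, 0, 0, 0, a:]" using Nf by simp
    hence "curve_isomorphic f [:c, 0, 0, 0, 0, 0, a:]"
      by (rule subst6_imp_isomorphic[OF f N one_neq_zero])
    thus False using exp sextic_exponent[OF a c] by metis
  qed
  obtain s where s: "s ^ 3 = b / a" using nth_root_exists[of 3 "b / a"] by auto
  have s0: "s \<noteq> 0" using s a b by auto
  define t where "t = a * c / b\<^sup>2"
  define M where "M = mul2 N (diag2 s 1)"
  have M: "det2 M \<noteq> 0" using N s0 by (simp add: M_def det2_mul2)
  have "subst6 M f = subst6 (diag2 s 1) [:c, 0, 0, b, 0, 0, a:]"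
    unfolding M_def Nf[symmetric] using N s0 deg by (intro subst6_subst6[symmetric]) simp_all
  also have "\<dots> = [:c, 0, 0, s ^ 3 * b, 0, 0, s ^ 6 * a:]"
    by (simp add: diag2_def eval_nat_numeral algebra_simps)
  also have "\<dots> = smult (b\<^sup>2 / a) [:t, 0, 0, 1, 0, 0, 1:]"
  proof -
    have "s ^ 6 = (s ^ 3) ^ 2" by (simp flip: power_mult)
    thus ?thesis using a b by (simp add: s t_def power2_eq_square field_simps)
  qed
  finally have Mf: "subst6 M f = smult (b\<^sup>2 / a) [:t, 0, 0, 1, 0, 0, 1:]" .
  have \<kappa>: "b\<^sup>2 / a \<noteq> 0" using a b by simp
  have "t \<noteq> - 1 / 50"
  proof
    assume t: "t = - 1 / 50"
    have "curve_isomorphic f [:t, 0, 0, 1, 0, 0, 1:]" by (rule subst6_imp_isomorphic[OF f M \<kappa> Mf])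
    thus False using exp octahedral_exponent[OF refl] unfolding t by metis
  qed
  thus ?thesis using that M \<kappa> Mf by blast
qed

text \<open>Both products have the same roots on the projective line. A finite root is transferred
  by evaluation, one at infinity by the drop in degree; non-vanishing brackets make the assignment
  injective, hence a permutation.\<close>

lemma factorisation_unique:
  fixes x z x' z' :: "nat \<Rightarrow> 'k::{alg_closed_field, field_char_0}"
  assumes g: "genus2 (\<Prod>m\<in>{1..6::nat}. [:- x m, z m:])" and \<kappa>: "\<kappa> \<noteq> 0"
    and eq: "(\<Prod>m\<in>{1..6::nat}. [:- x m, z m:]) = smult \<kappa> (\<Prod>m\<in>{1..6}. [:- x' m, z' m:])"
  obtains \<pi> l where "\<pi> permutes {1..6}" "\<And>m. m \<in> {1..6} \<Longrightarrow> l m \<noteq> 0"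
    "\<And>m. m \<in> {1..6} \<Longrightarrow> x m = l m * x' (\<pi> m)" "\<And>m. m \<in> {1..6} \<Longrightarrow> z m = l m * z' (\<pi> m)"
proof -
  define f where "f = (\<Prod>m\<in>{1..6::nat}. [:- x m, z m:])"
  define f' where "f' = (\<Prod>m\<in>{1..6::nat}. [:- x' m, z' m:])"
  have ff': "f = smult \<kappa> f'" using eq by (simp add: f_def f'_def)
  have br: "bracket x z m n \<noteq> 0" if "m \<in> {1..6}" "n \<in> {1..6}" "m \<noteq> n" for m n
    using g that unfolding genus2_iff_brackets by blast
  have f0: "f \<noteq> 0" "f' \<noteq> 0" using g ff' by (auto simp: f_def genus2_def)
  have nz: "[:- x m, z m:] \<noteq> 0" "[:- x' m, z' m:] \<noteq> 0" if "m \<in> {1..6}" for m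
    using f0 that unfolding f_def f'_def by (auto simp: prod_zero_iff)
  have "\<exists>n\<in>{1..6}. \<exists>k. k \<noteq> 0 \<and> x m = k * x' n \<and> z m = k * z' n" if m: "m \<in> {1..6}" for m
  proof -
    have m0: "x m \<noteq> 0 \<or> z m \<noteq> 0" using nz(1)[OF m] by auto
    obtain n where n: "n \<in> {1..6}" "x m * z' n = x' n * z m"
    proof (cases "z m = 0")
      case False
      have "poly f (x m / z m) = 0"
        unfolding f_def poly_prod using m False by (intro prod_zero) (auto intro!: bexI[of _ m])
      hence "poly f' (x m / z m) = 0" using ff' \<kappa> by simp
      then obtain n where "n \<in> {1..6}" "poly [:- x' n, z' n:] (x m / z m) = 0"
        unfolding f'_def poly_prod by (auto simp: prod_zero_iff)
      thus ?thesis using that[of n] False by (simp add: field_simps)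
    next
      case True
      have "degree f < 6"
      proof -
        have "degree f = (\<Sum>k\<in>{1..6}. degree [:- x k, z k:])"
          unfolding f_def using nz by (intro degree_prod_eq_sum_degree) blast
        also have "\<dots> < (\<Sum>k\<in>{1..6::nat}. 1)" using True m by (intro sum_strict_mono_ex1) auto
        finally show ?thesis by simp
      qed
      hence "degree f' < 6" using ff' \<kappa> by simp
      have "\<not> (\<forall>n\<in>{1..6}. z' n \<noteq> 0)"
      proof
        assume "\<forall>n\<in>{1..6}. z' n \<noteq> 0"
        hence "(\<Sum>k\<in>{1..6}. degree [:- x' k, z' k:]) = (\<Sum>k\<in>{1..6::nat}. 1)" by (intro sum.cong) auto
        moreover have "degree f' = (\<Sum>k\<in>{1..6}. degree [:- x' k, z' k:])"
          unfolding f'_def using nz by (intro degree_prod_eq_sum_degree) blast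
        ultimately show False using \<open>degree f' < 6\<close> by simp
      qed
      then obtain n where "n \<in> {1..6}" "z' n = 0" by blast
      thus ?thesis using that[of n] True by simp
    qed
    have n0: "x' n \<noteq> 0 \<or> z' n \<noteq> 0" using nz(2)[OF n(1)] by auto
    show ?thesis
    proof (cases "z' n = 0")
      case True
      thus ?thesis using n m0 n0 by (intro bexI[OF _ n(1)] exI[of _ "x m / x' n"]) auto
    next
      case False
      thus ?thesis using n m0 n0 by (intro bexI[OF _ n(1)] exI[of _ "z m / z' n"]) (auto simp: field_simps)
    qed
  qed
  then obtain \<sigma> l where \<sigma>: "\<And>m. m \<in> {1..6} \<Longrightarrow> \<sigma> m \<in> {1..6} \<and> l m \<noteq> 0 \<and> x m = l m * x' (\<sigma> m) \<and> z m = l m * z' (\<sigma> m)"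
    by metis
  define \<pi> where "\<pi> m = (if m \<in> {1..6} then \<sigma> m else m)" for m
  have "inj_on \<pi> {1..6}"
  proof (rule inj_onI)
    fix m n :: nat assume mn: "m \<in> {1..6}" "n \<in> {1..6}" "\<pi> m = \<pi> n"
    hence "\<sigma> m = \<sigma> n" by (simp only: \<pi>_def if_True)
    hence "bracket x z m n = 0" using \<sigma>[OF mn(1)] \<sigma>[OF mn(2)] by (simp add: bracket_def)
    thus "m = n" using br mn by blast
  qed
  moreover have "\<pi> ` {1..6} \<subseteq> {1..6}" using \<sigma> by (auto simp: \<pi>_def)
  ultimately have "bij_betw \<pi> {1..6} {1..6}" by (simp add: bij_betw_def card_subset_eq card_image)
  hence "\<pi> permutes {1..6}" by (rule bij_imp_permutes) (auto simp: \<pi>_def)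
  moreover have "l m \<noteq> 0" "x m = l m * x' (\<pi> m)" "z m = l m * z' (\<pi> m)" if "m \<in> {1..6}" for m
    using \<sigma>[OF that] that by (auto simp only: \<pi>_def if_True)
  ultimately show ?thesis using that by blast
qed

subsection \<open>Sums over the relabellings of a graph on six points\<close>

definition edge_set :: "(nat \<times> nat) list \<Rightarrow> nat set set" where
  "edge_set es = (\<lambda>(i, j). {i, j}) ` set es"

definition relabel :: "nat list \<Rightarrow> (nat \<times> nat) list \<Rightarrow> (nat \<times> nat) list" where
  "relabel q es = map (\<lambda>(i, j). (q ! (i - 1), q ! (j - 1))) es"

text \<open>A canonical form of a graph: for i < j <= 6 the number 7 i + j determines the edge, and
  sorting forgets the order of the list. Equality of edge sets thus becomes equality of lists of
  numerals, which can be computed.\<close>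

definition edge_code :: "(nat \<times> nat) list \<Rightarrow> nat list" where
  "edge_code es = sort (map (\<lambda>(i, j). if i < j then 7 * i + j else 7 * j + i) es)"

definition graph6 :: "(nat \<times> nat) list \<Rightarrow> bool" where
  "graph6 es \<longleftrightarrow> (\<forall>(i, j)\<in>set es. i \<in> {1..6} \<and> j \<in> {1..6} \<and> i \<noteq> j) \<and>
     distinct (map (\<lambda>(i, j). {i, j}) es)"

definition perm6 :: "nat list \<Rightarrow> bool" where
  "perm6 q \<longleftrightarrow> length q = 6 \<and> distinct q \<and> set q \<subseteq> {1..6}"

definition edge_number :: "nat set \<Rightarrow> nat" where
  "edge_number e = 7 * Min e + Max e"

lemma edge_number_doubleton:
  "i \<noteq> j \<Longrightarrow> edge_number {i, j} = (if i < j then 7 * i + j else 7 * j + i)"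
  by (auto simp: edge_number_def min_def max_def)

lemma inj_on_edge_number: "inj_on edge_number {{i, j} |i j. i \<in> {1..6} \<and> j \<in> {1..6} \<and> i < j}"
proof (rule inj_onI)
  fix e e' :: "nat set"
  assume "e \<in> {{i, j} |i j. i \<in> {1..6} \<and> j \<in> {1..6} \<and> i < j}"
    and "e' \<in> {{i, j} |i j. i \<in> {1..6} \<and> j \<in> {1..6} \<and> i < j}" and eq: "edge_number e = edge_number e'"
  then obtain i j i' j' :: nat where e: "e = {i, j}" "i < j" "j \<in> {1..6}"
      and e': "e' = {i', j'}" "i' < j'" "j' \<in> {1..6}"
    by blast
  have eq': "7 * i + j = 7 * i' + j'" using eq e e' by (simp add: edge_number_doubleton)
  have "j < 7" "j' < 7" using e(3) e'(3) by auto
  hence "i = (7 * i + j) div 7" "i' = (7 * i' + j') div 7" by simp_all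
  hence "i = i'" using eq' by metis
  moreover from this have "j = j'" using eq' by simp
  ultimately show "e = e'" using e e' by simp
qed

lemma graph6_doubletons:
  assumes "graph6 es"
  shows "edge_set es \<subseteq> {{i, j} |i j. i \<in> {1..6} \<and> j \<in> {1..6} \<and> i < j}"
proof
  fix e assume "e \<in> edge_set es"
  then obtain i j where ij: "(i, j) \<in> set es" "e = {i, j}" by (auto simp: edge_set_def)
  hence *: "i \<in> {1..6}" "j \<in> {1..6}" "i \<noteq> j" using assms by (auto simp: graph6_def)
  show "e \<in> {{i, j} |i j. i \<in> {1..6} \<and> j \<in> {1..6} \<and> i < j}"
  proof (cases "i < j")
    case False
    hence "e = {j, i}" "j < i" using ij * by auto
    thus ?thesis using * by blast
  qed (use ij * in blast)
qed

lemma graph6_edge_code: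
  assumes "graph6 es"
  shows "edge_code es = sort (map edge_number (map (\<lambda>(i, j). {i, j}) es))"
proof -
  have "map (\<lambda>(i, j). if i < j then 7 * i + j else 7 * j + i) es = map edge_number (map (\<lambda>(i, j). {i, j}) es)"
    using assms by (auto simp: graph6_def edge_number_doubleton split: prod.splits)
  thus ?thesis by (simp only: edge_code_def)
qed

lemma graph6_distinct_edge_code:
  assumes "graph6 es"
  shows "distinct (edge_code es)"
proof -
  have "inj_on edge_number (set (map (\<lambda>(i, j). {i, j}) es))"
    using graph6_doubletons[OF assms] by (intro inj_on_subset[OF inj_on_edge_number]) (simp add: edge_set_def)
  thus ?thesis using assms unfolding graph6_edge_code[OF assms] distinct_sort
    by (subst distinct_map) (simp add: graph6_def)
qed

lemma edge_code_eq_iff: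
  assumes "graph6 es" "graph6 es'"
  shows "edge_code es = edge_code es' \<longleftrightarrow> edge_set es = edge_set es'"
proof -
  have set: "set (edge_code es) = edge_number ` edge_set es" if "graph6 es" for es
    unfolding graph6_edge_code[OF that] by (simp add: edge_set_def image_image case_prod_beta)
  have sorted: "sorted (edge_code es)" for es by (simp add: edge_code_def)
  have "edge_code es = edge_code es' \<longleftrightarrow> set (edge_code es) = set (edge_code es')"
    using sorted_distinct_set_unique[of "edge_code es" "edge_code es'"] sorted assms[THEN graph6_distinct_edge_code]
    by auto
  also have "\<dots> \<longleftrightarrow> edge_set es = edge_set es'"
    unfolding set[OF assms(1)] set[OF assms(2)]
    by (intro inj_on_image_eq_iff[OF inj_on_edge_number] graph6_doubletons assms)
  finally show ?thesis .
qed

lemma perm6_nth: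
  assumes "perm6 q" "i \<in> {1..6}" "j \<in> {1..6}"
  shows "q ! (i - 1) \<in> {1..6}" and "q ! (i - 1) = q ! (j - 1) \<longleftrightarrow> i = j"
proof -
  have lt: "i - 1 < length q" "j - 1 < length q" using assms by (auto simp: perm6_def)
  show "q ! (i - 1) \<in> {1..6}" using nth_mem[OF lt(1)] assms(1) unfolding perm6_def by blast
  show "q ! (i - 1) = q ! (j - 1) \<longleftrightarrow> i = j"
    using lt assms by (auto simp: perm6_def nth_eq_iff_index_eq)
qed

definition move :: "(nat \<Rightarrow> nat) \<Rightarrow> nat set set \<Rightarrow> nat set set" where
  "move p E = (\<lambda>e. p ` e) ` E"

lemma move_comp: "move p (move p' E) = move (p \<circ> p') E"
  by (simp add: move_def image_comp image_image)

lemma move_edge_set: "move p (edge_set es) = edge_set (map (map_prod p p) es)"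
  by (auto simp: move_def edge_set_def image_image case_prod_beta)

definition perm_of :: "nat list \<Rightarrow> nat \<Rightarrow> nat" where
  "perm_of q i = (if i \<in> {1..6} then q ! (i - 1) else i)"

lemma perm_of_permutes:
  assumes "perm6 q"
  shows "perm_of q permutes {1..6}"
proof -
  have "inj_on (perm_of q) {1..6}" 
    using perm6_nth(2)[OF assms] by (intro inj_onI) (simp only: perm_of_def if_True)
  moreover have "perm_of q ` {1..6} \<subseteq> {1..6}" using perm6_nth[OF assms] by (auto simp: perm_of_def)
  ultimately have "bij_betw (perm_of q) {1..6} {1..6}"
    by (simp add: bij_betw_def card_subset_eq card_image)
  thus ?thesis by (rule bij_imp_permutes) (auto simp: perm_of_def)
qed

lemma edge_set_relabel:
  assumes "graph6 es"
  shows "edge_set (relabel q es) = move (perm_of q) (edge_set es)"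
proof -
  have "relabel q es = map (map_prod (perm_of q) (perm_of q)) es"
    using assms by (auto simp: relabel_def perm_of_def graph6_def split: prod.splits)
  thus ?thesis by (simp add: move_edge_set)
qed

lemma graph6_move:
  assumes es: "graph6 es" and p: "p permutes {1..6}"
  shows "graph6 (map (map_prod p p) es)"
proof -
  have inj: "inj p" using p by (rule permutes_inj)
  have ends: "\<forall>(i, j)\<in>set (map (map_prod p p) es). i \<in> {1..6} \<and> j \<in> {1..6} \<and> i \<noteq> j"
  proof clarify
    fix a b assume "(a, b) \<in> set (map (map_prod p p) es)"
    then obtain i j where "(i, j) \<in> set es" "a = p i" "b = p j" by auto
    moreover from this have "i \<in> {1..6}" "j \<in> {1..6}" "i \<noteq> j" using es by (auto simp: graph6_def)
    ultimately show "a \<in> {1..6} \<and> b \<in> {1..6} \<and> a \<noteq> b"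
      by (auto simp only: permutes_in_image[OF p] inj_eq[OF inj])
  qed
  have "distinct (map ((`) p) (map (\<lambda>(i, j). {i, j}) es))"
  proof -
    have "inj ((`) p)" by (simp add: inj_def inj_image_eq_iff[OF inj])
    thus ?thesis
      using es by (subst distinct_map) (simp add: graph6_def inj_on_subset[OF _ subset_UNIV])
  qed
  also have "map ((`) p) (map (\<lambda>(i, j). {i, j}) es) = map (\<lambda>(i, j). {i, j}) (map (map_prod p p) es)"
    by auto
  finally show ?thesis using ends unfolding graph6_def by blast
qed

lemma relabel_perm6:
  assumes "graph6 es" "perm6 q"
  shows "graph6 (relabel q es)" and "length (relabel q es) = length es"
proof -
  have "relabel q es = map (map_prod (perm_of q) (perm_of q)) es"
    using assms by (auto simp: relabel_def perm_of_def graph6_def split: prod.splits)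
  thus "graph6 (relabel q es)" using graph6_move[OF assms(1) perm_of_permutes[OF assms(2)]] by simp
qed (simp add: relabel_def)

text \<open>
  \<open>qs\<close> lists one relabelling for every graph in the orbit of \<open>es\<close>. The transpositions
  \<open>(1 b)\<close> generate the symmetric group, so it suffices that they permute the listed graphs.
\<close>

definition orbit_list :: "nat list list \<Rightarrow> (nat \<times> nat) list \<Rightarrow> bool" where
  "orbit_list qs es \<longleftrightarrow> [1, 2, 3, 4, 5, 6] \<in> set qs \<and> (\<forall>q\<in>set qs. perm6 q) \<and>
     distinct (map (\<lambda>q. edge_code (relabel q es)) qs) \<and>
     (\<forall>q\<in>set qs. \<forall>b\<in>set [2, 3, 4, 5, 6]. edge_code (relabel (map (transpose 1 b) q) es)
        \<in> set (map (\<lambda>q. edge_code (relabel q es)) qs))"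

lemma permuted_orbit_list:
  assumes es: "graph6 es" and qs: "orbit_list qs es"
  shows "permuted (edge_set es) = (\<lambda>q. edge_set (relabel q es)) ` set qs"
    and "inj_on (\<lambda>q. edge_set (relabel q es)) (set qs)" and "distinct qs"
proof -
  define S where "S = (\<lambda>q. edge_set (relabel q es)) ` set qs"
  have perm: "perm6 q" if "q \<in> set qs" for q using qs that by (auto simp: orbit_list_def)
  have d: "distinct (map (\<lambda>q. edge_code (relabel q es)) qs)" using qs by (simp add: orbit_list_def)
  show "distinct qs" using d by (simp add: distinct_map)
  show "inj_on (\<lambda>q. edge_set (relabel q es)) (set qs)"
  proof (rule inj_onI)
    fix q q' assume q: "q \<in> set qs" "q' \<in> set qs" and eq: "edge_set (relabel q es) = edge_set (relabel q' es)"
    hence "edge_code (relabel q es) = edge_code (relabel q' es)"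
      using edge_code_eq_iff relabel_perm6[OF es] perm by blast
    thus "q = q'" using d q by (auto simp: distinct_map dest: inj_onD)
  qed
  have star: "move (transpose 1 b) E \<in> S" if E: "E \<in> S" and b: "b \<in> {1..6}" for E b
  proof (cases "b = 1")
    case True
    thus ?thesis using E by (simp add: move_def)
  next
    case False
    obtain q where q: "q \<in> set qs" "E = edge_set (relabel q es)" using E by (auto simp: S_def)
    have t: "transpose 1 b permutes {1..6}" using b by (intro permutes_swap_id) auto
    have "b \<in> set [2, 3, 4, 5, 6]" using b False by auto
    then obtain q' where q': "q' \<in> set qs"
        "edge_code (relabel (map (transpose 1 b) q) es) = edge_code (relabel q' es)"
      using qs q(1) unfolding orbit_list_def by fastforce
    have map: "relabel (map (transpose 1 b) q) es = map (map_prod (transpose 1 b) (transpose 1 b)) (relabel q es)"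
      using es perm[OF q(1)] by (auto simp: relabel_def graph6_def perm6_def)
    have "edge_set (relabel (map (transpose 1 b) q) es) = edge_set (relabel q' es)"
      using q' edge_code_eq_iff relabel_perm6(1)[OF es] perm q(1) graph6_move[OF _ t] unfolding map by metis
    hence "move (transpose 1 b) E = edge_set (relabel q' es)"
      unfolding q(2) move_edge_set map .
    thus ?thesis using q'(1) by (simp add: S_def)
  qed
  have transp: "move (transpose a b) E \<in> S" if E: "E \<in> S" and ab: "a \<in> {1..6}" "b \<in> {1..6}" "a \<noteq> b" for E a b
  proof (cases "a = 1 \<or> b = 1")
    case True
    thus ?thesis using star[OF E ab(1)] star[OF E ab(2)] by (metis transpose_commute)
  next
    case False
    \<comment> \<open>(a b) is the conjugate of (1 b) by (1 a).\<close>
    hence "transpose a b = transpose 1 a \<circ> (transpose 1 b \<circ> transpose 1 a)"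
      using ab(3) by (auto simp: fun_eq_iff transpose_def)
    thus ?thesis using star ab E by (simp flip: move_comp)
  qed
  have closed: "move p E \<in> S" if "p permutes {1..6}" "E \<in> S" for p E
    using that(1) finite_atLeastAtMost
  proof (induction p rule: permutes_induct)
    case id
    show ?case using that(2) by (simp add: move_def)
  next
    case (swap a b p)
    hence "move (transpose a b) (move p E) \<in> S" using transp[of "move p E" a b] by blast
    thus ?case by (simp only: move_comp)
  qed
  have "relabel [1, 2, 3, 4, 5, 6] es = es"
  proof -
    have "[1, 2, 3, 4, 5, 6] ! (i - 1) = i" if "i \<in> {1..6}" for i :: nat
    proof -
      have "i = 1 \<or> i = 2 \<or> i = 3 \<or> i = 4 \<or> i = 5 \<or> i = 6" using that by auto
      thus ?thesis by auto
    qed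
    hence "map (\<lambda>(i, j). ([1, 2, 3, 4, 5, 6] ! (i - 1), [1, 2, 3, 4, 5, 6] ! (j - 1))) es = map id es"
      using es by (intro map_cong refl) (auto simp: graph6_def simp del: atLeastAtMost_iff)
    thus ?thesis by (simp add: relabel_def)
  qed
  hence "edge_set es \<in> S" using qs by (force simp: S_def orbit_list_def)
  hence "permuted (edge_set es) \<subseteq> S" using closed by (auto simp: permuted_def move_def)
  moreover have "S \<subseteq> permuted (edge_set es)"
    using perm perm_of_permutes edge_set_relabel[OF es] unfolding S_def permuted_def move_def by blast
  ultimately show "permuted (edge_set es) = (\<lambda>q. edge_set (relabel q es)) ` set qs"
    by (simp add: S_def)
qed

section \<open>Bracket sums of a graph\<close>

definition bracket_prod :: "(nat \<Rightarrow> 'k::field) \<Rightarrow> (nat \<Rightarrow> 'k) \<Rightarrow> (nat \<times> nat) list \<Rightarrow> 'k" where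
  "bracket_prod x z es = (\<Prod>(i, j)\<leftarrow>es. (bracket x z i j)\<^sup>2)"

lemma bracket_min_max:
  assumes "i \<noteq> j"
  shows "(bracket x z (Min {i, j}) (Max {i, j}))\<^sup>2 = (bracket x z i j)\<^sup>2"
  using assms by (cases "i < j") (auto simp: bracket_def min_def max_def power2_eq_square algebra_simps)

lemma expr_edge_set:
  assumes "graph6 es"
  shows "expr x z (edge_set es) = bracket_prod x z es"
proof -
  have "edge_set es = set (map (\<lambda>(i, j). {i, j}) es)" by (simp add: edge_set_def)
  hence "expr x z (edge_set es) = prod_list (map (\<lambda>e. (bracket x z (Min e) (Max e))\<^sup>2) (map (\<lambda>(i, j). {i, j}) es))"
    using assms unfolding expr_def by (simp only: prod.distinct_set_conv_list graph6_def)
  also have "map (\<lambda>e. (bracket x z (Min e) (Max e))\<^sup>2) (map (\<lambda>(i, j). {i, j}) es) = map (\<lambda>(i, j). (bracket x z i j)\<^sup>2) es"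
  proof -
    have "(bracket x z (Min (case e of (i, j) \<Rightarrow> {i, j})) (Max (case e of (i, j) \<Rightarrow> {i, j})))\<^sup>2 =
        (case e of (i, j) \<Rightarrow> (bracket x z i j)\<^sup>2)" if "e \<in> set es" for e
    proof -
      obtain i j where "e = (i, j)" by (cases e)
      thus ?thesis using assms that bracket_min_max[of i j x z] by (auto simp only: graph6_def case_prod_conv)
    qed
    thus ?thesis by (simp only: map_map map_eq_conv o_def) blast
  qed
  finally show ?thesis by (simp add: bracket_prod_def)
qed

lemma sum_permuted:
  assumes "graph6 es" "orbit_list qs es"
  shows "(\<Sum>E\<in>permuted (edge_set es). expr x z E) = (\<Sum>q\<leftarrow>qs. bracket_prod x z (relabel q es))"
proof -
  note orbit = permuted_orbit_list[OF assms]
  have "(\<Sum>E\<in>permuted (edge_set es). expr x z E) = (\<Sum>q\<in>set qs. expr x z (edge_set (relabel q es)))"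
    unfolding orbit(1) by (rule sum.reindex[OF orbit(2), unfolded o_def])
  also have "\<dots> = (\<Sum>q\<in>set qs. bracket_prod x z (relabel q es))"
    using assms by (intro sum.cong refl expr_edge_set relabel_perm6) (auto simp: orbit_list_def)
  also have "\<dots> = (\<Sum>q\<leftarrow>qs. bracket_prod x z (relabel q es))"
    by (simp add: sum_list_distinct_conv_sum_set orbit(3))
  finally show ?thesis .
qed

text \<open>\<open>regular\<close> expresses that each vertex has degree r. So the scalars l
  contribute the 2r-th power of their product to every summand, the 3r edges contribute k^(6r), and
  \<pi> only permutes the summands.\<close>

lemma sum_permuted_equivariant:
  fixes x z x' z' :: "nat \<Rightarrow> 'k::field"
  assumes es: "graph6 es" and qs: "orbit_list qs es" and \<pi>: "\<pi> permutes {1..6}"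
    and br: "\<And>m n. m \<in> {1..6} \<Longrightarrow> n \<in> {1..6} \<Longrightarrow>
      bracket x' z' m n = k * l m * l n * bracket x z (\<pi> m) (\<pi> n)"
    and regular: "\<And>q. length q = 6 \<Longrightarrow> (\<Prod>(i, j)\<leftarrow>relabel q es. l i * l j) = prod_list (map l q) ^ r"
    and len: "length es = 3 * r"
  shows "(\<Sum>E\<in>permuted (edge_set es). expr x' z' E) =
    (k ^ 3 * (\<Prod>m\<in>{1..6}. l m)) ^ (2 * r) * (\<Sum>E\<in>permuted (edge_set es). expr x z E)"
proof -
  define C where "C = (k ^ 3 * (\<Prod>m\<in>{1..6}. l m)) ^ (2 * r)"
  have pull_out: "(\<Prod>(i, j)\<leftarrow>fs. (k * (l i * l j) * bracket x z (\<pi> i) (\<pi> j))\<^sup>2) =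
      (k ^ length fs * (\<Prod>(i, j)\<leftarrow>fs. l i * l j))\<^sup>2 * bracket_prod x z (map (map_prod \<pi> \<pi>) fs)" for fs
    unfolding bracket_prod_def by (induction fs) (auto simp: power_mult_distrib algebra_simps)
  have summand: "bracket_prod x' z' (relabel q es) = C * expr x z (move \<pi> (edge_set (relabel q es)))"
    if q: "q \<in> set qs" for q
  proof -
    have p: "perm6 q" using q qs by (auto simp: orbit_list_def)
    note g = relabel_perm6[OF es p]
    have "bracket_prod x' z' (relabel q es) =
        (\<Prod>(i, j)\<leftarrow>relabel q es. (k * (l i * l j) * bracket x z (\<pi> i) (\<pi> j))\<^sup>2)"
      unfolding bracket_prod_def using g(1) br
      by (intro arg_cong[of _ _ prod_list] map_cong refl) (auto simp: graph6_def mult.assoc simp del: atLeastAtMost_iff)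
    also have "\<dots> = (k ^ length es * (\<Prod>(i, j)\<leftarrow>relabel q es. l i * l j))\<^sup>2 *
        bracket_prod x z (map (map_prod \<pi> \<pi>) (relabel q es))"
      unfolding g(2)[symmetric] by (rule pull_out)
    also have "(\<Prod>(i, j)\<leftarrow>relabel q es. l i * l j) = prod_list (map l q) ^ r"
      using p by (intro regular) (simp add: perm6_def)
    also have "prod_list (map l q) = (\<Prod>m\<in>{1..6}. l m)"
    proof -
      have "set q = {1..6}" using p by (intro card_subset_eq) (auto simp: perm6_def distinct_card)
      thus ?thesis using p by (metis perm6_def prod.distinct_set_conv_list)
    qed
    also have "(k ^ length es * (\<Prod>m\<in>{1..6}. l m) ^ r)\<^sup>2 = C"
      by (simp add: C_def len power_mult_distrib mult.commute flip: power_mult)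
    also have "bracket_prod x z (map (map_prod \<pi> \<pi>) (relabel q es)) = expr x z (move \<pi> (edge_set (relabel q es)))"
      by (simp only: move_edge_set expr_edge_set[OF graph6_move[OF g(1) \<pi>]])
    finally show ?thesis .
  qed
  note orbit = permuted_orbit_list[OF es qs]
  have inj: "inj_on (move \<pi>) (permuted (edge_set es))"
  proof (rule inj_on_inverseI)
    fix E show "move (inv_into UNIV \<pi>) (move \<pi> E) = E"
      using permutes_inv_o(2)[OF \<pi>] by (simp add: move_comp) (simp add: move_def)
  qed
  have sub: "move p ` permuted (edge_set es) \<subseteq> permuted (edge_set es)" if "p permutes {1..6}" for p
  proof
    fix E assume "E \<in> move p ` permuted (edge_set es)"
    then obtain p' where p': "p' permutes {1..6}" "E = move p (move p' (edge_set es))"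
      by (auto simp: permuted_def move_def)
    hence "E = move (p \<circ> p') (edge_set es)" by (simp add: move_comp)
    thus "E \<in> permuted (edge_set es)"
      using permutes_compose[OF p'(1) that] unfolding permuted_def move_def by blast
  qed
  have fin: "finite (permuted (edge_set es))" unfolding orbit(1) by simp
  have img: "move \<pi> ` permuted (edge_set es) = permuted (edge_set es)"
    using sub[OF \<pi>] inj fin by (simp add: endo_inj_surj)
  have "(\<Sum>E\<in>permuted (edge_set es). expr x' z' E) = (\<Sum>q\<leftarrow>qs. C * expr x z (move \<pi> (edge_set (relabel q es))))"
    unfolding sum_permuted[OF es qs] using summand by (intro arg_cong[of _ _ sum_list] map_cong) auto
  also have "\<dots> = C * (\<Sum>q\<in>set qs. expr x z (move \<pi> (edge_set (relabel q es))))"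
    by (simp add: sum_list_const_mult sum_list_distinct_conv_sum_set orbit(3))
  also have "(\<Sum>q\<in>set qs. expr x z (move \<pi> (edge_set (relabel q es)))) =
      (\<Sum>E\<in>permuted (edge_set es). expr x z (move \<pi> E))"
    unfolding orbit(1) by (rule sum.reindex[OF orbit(2), unfolded o_def, symmetric])
  also have "\<dots> = (\<Sum>E\<in>permuted (edge_set es). expr x z E)"
    using sum.reindex[OF inj, of "expr x z"] by (simp add: img)
  finally show ?thesis by (simp add: C_def)
qed

subsection \<open>Explicit forms of the invariants\<close>

text \<open>The graphs behind J2, J4 and J6: a perfect matching, two triangles and a prism, regular
  of degree 1, 2 and 3. With 48, 72 and 12 symmetries they have 15, 10 and 60 relabellings.\<close>

abbreviation "matching_edges \<equiv> [(1, 2), (3, 4), (5, 6)] :: (nat \<times> nat) list"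
abbreviation "triangle_edges \<equiv> [(1, 2), (2, 3), (3, 1), (4, 5), (5, 6), (6, 4)] :: (nat \<times> nat) list"
abbreviation "prism_edges \<equiv> triangle_edges @ [(1, 4), (2, 5), (3, 6)]"

definition matching_perms :: "nat list list" where
  "matching_perms = [
  [1,2,3,4,5,6],[1,2,3,5,4,6],[1,2,3,6,4,5],[1,3,2,4,5,6],[1,3,2,5,4,6],[1,3,2,6,4,5],
   [1,4,2,3,5,6],[1,4,2,5,3,6],[1,4,2,6,3,5],[1,5,2,3,4,6],[1,5,2,4,3,6],[1,5,2,6,3,4],
   [1,6,2,3,4,5],[1,6,2,4,3,5],[1,6,2,5,3,4]]"

definition triangle_perms :: "nat list list" where
  "triangle_perms = [
  [1,2,3,4,5,6],[1,2,4,3,5,6],[1,2,5,3,4,6],[1,2,6,3,4,5],[1,3,4,2,5,6],[1,3,5,2,4,6],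
   [1,3,6,2,4,5],[1,4,5,2,3,6],[1,4,6,2,3,5],[1,5,6,2,3,4]]"

text \<open>The ten splittings into two triples, each with the six ways of joining the triples by a
  matching.\<close>

definition prism_perms :: "nat list list" where
  "prism_perms = [
  [1,2,3,4,5,6],[1,2,3,4,6,5],[1,2,3,5,4,6],[1,2,3,5,6,4],[1,2,3,6,4,5],[1,2,3,6,5,4],
   [1,2,4,3,5,6],[1,2,4,3,6,5],[1,2,4,5,3,6],[1,2,4,5,6,3],[1,2,4,6,3,5],[1,2,4,6,5,3],
   [1,2,5,3,4,6],[1,2,5,3,6,4],[1,2,5,4,3,6],[1,2,5,4,6,3],[1,2,5,6,3,4],[1,2,5,6,4,3],
   [1,2,6,3,4,5],[1,2,6,3,5,4],[1,2,6,4,3,5],[1,2,6,4,5,3],[1,2,6,5,3,4],[1,2,6,5,4,3],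
   [1,3,4,2,5,6],[1,3,4,2,6,5],[1,3,4,5,2,6],[1,3,4,5,6,2],[1,3,4,6,2,5],[1,3,4,6,5,2],
   [1,3,5,2,4,6],[1,3,5,2,6,4],[1,3,5,4,2,6],[1,3,5,4,6,2],[1,3,5,6,2,4],[1,3,5,6,4,2],
   [1,3,6,2,4,5],[1,3,6,2,5,4],[1,3,6,4,2,5],[1,3,6,4,5,2],[1,3,6,5,2,4],[1,3,6,5,4,2],
   [1,4,5,2,3,6],[1,4,5,2,6,3],[1,4,5,3,2,6],[1,4,5,3,6,2],[1,4,5,6,2,3],[1,4,5,6,3,2],
   [1,4,6,2,3,5],[1,4,6,2,5,3],[1,4,6,3,2,5],[1,4,6,3,5,2],[1,4,6,5,2,3],[1,4,6,5,3,2],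
   [1,5,6,2,3,4],[1,5,6,2,4,3],[1,5,6,3,2,4],[1,5,6,3,4,2],[1,5,6,4,2,3],[1,5,6,4,3,2]]"


lemma graph6_edges: "graph6 matching_edges" "graph6 triangle_edges" "graph6 prism_edges"
  by (simp_all add: graph6_def doubleton_eq_iff)

lemmas edge_code_simps = relabel_def edge_code_def sort_key_def transpose_def

lemma orbit_list_matching: "orbit_list matching_perms matching_edges"
  unfolding orbit_list_def
proof (intro conjI)
  \<comment> \<open>The codes are tabulated once, so that closure under transpositions is a lookup
    in a fixed list.\<close>
  have codes: "map (\<lambda>q. edge_code (relabel q matching_edges)) matching_perms = [
   [9,25,41],[9,26,34],[9,27,33],[10,18,41],[10,19,34],[10,20,33],[11,17,41],[11,19,27],
    [11,20,26],[12,17,34],[12,18,27],[12,20,25],[13,17,33],[13,18,26],[13,19,25]]"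
    unfolding matching_perms_def list.map by (simp add: edge_code_simps)
  show "\<forall>q\<in>set matching_perms. \<forall>b\<in>set [2, 3, 4, 5, 6]. edge_code (relabel (map (transpose 1 b) q) matching_edges)
      \<in> set (map (\<lambda>q. edge_code (relabel q matching_edges)) matching_perms)"
    unfolding codes unfolding matching_perms_def list.set ball_simps list.map by (simp add: edge_code_simps)
  show "distinct (map (\<lambda>q. edge_code (relabel q matching_edges)) matching_perms)"
    unfolding codes by simp
qed (simp_all add: matching_perms_def perm6_def)

lemma orbit_list_triangle: "orbit_list triangle_perms triangle_edges"
  unfolding orbit_list_def
proof (intro conjI)
  have codes: "map (\<lambda>q. edge_code (relabel q triangle_edges)) triangle_perms = [
   [9,10,17,33,34,41],[9,11,18,26,27,41],[9,12,19,25,27,34],[9,13,20,25,26,33],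
    [10,11,19,20,25,41],[10,12,18,20,26,34],[10,13,18,19,27,33],[11,12,17,20,27,33],
    [11,13,17,19,26,34],[12,13,17,18,25,41]]"
    unfolding triangle_perms_def list.map by (simp add: edge_code_simps)
  show "\<forall>q\<in>set triangle_perms. \<forall>b\<in>set [2, 3, 4, 5, 6]. edge_code (relabel (map (transpose 1 b) q) triangle_edges)
      \<in> set (map (\<lambda>q. edge_code (relabel q triangle_edges)) triangle_perms)"
    unfolding codes unfolding triangle_perms_def list.set ball_simps list.map by (simp add: edge_code_simps)
  show "distinct (map (\<lambda>q. edge_code (relabel q triangle_edges)) triangle_perms)"
    unfolding codes by simp
qed (simp_all add: triangle_perms_def perm6_def)

lemma orbit_list_prism: "orbit_list prism_perms prism_edges"
  unfolding orbit_list_def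
proof (intro conjI)
  have codes: "map (\<lambda>q. edge_code (relabel q prism_edges)) prism_perms = [
   [9,10,11,17,19,27,33,34,41],[9,10,11,17,20,26,33,34,41],[9,10,12,17,18,27,33,34,41],
    [9,10,12,17,20,25,33,34,41],[9,10,13,17,18,26,33,34,41],[9,10,13,17,19,25,33,34,41],
    [9,10,11,18,19,26,27,34,41],[9,10,11,18,20,26,27,33,41],[9,11,12,17,18,26,27,34,41],
    [9,11,12,18,20,25,26,27,41],[9,11,13,17,18,26,27,33,41],[9,11,13,18,19,25,26,27,41],
    [9,10,12,18,19,25,27,34,41],[9,10,12,19,20,25,27,33,34],[9,11,12,17,19,25,27,34,41],
    [9,11,12,19,20,25,26,27,34],[9,12,13,17,19,25,27,33,34],[9,12,13,18,19,25,26,27,34],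
    [9,10,13,18,20,25,26,33,41],[9,10,13,19,20,25,26,33,34],[9,11,13,17,20,25,26,33,41],
    [9,11,13,19,20,25,26,27,33],[9,12,13,17,20,25,26,33,34],[9,12,13,18,20,25,26,27,33],
    [9,10,11,19,20,25,26,34,41],[9,10,11,19,20,25,27,33,41],[10,11,12,17,19,20,25,34,41],
    [10,11,12,18,19,20,25,27,41],[10,11,13,17,19,20,25,33,41],[10,11,13,18,19,20,25,26,41],
    [9,10,12,18,20,25,26,34,41],[9,10,12,18,20,26,27,33,34],[10,11,12,17,18,20,26,34,41],
    [10,11,12,18,19,20,26,27,34],[10,12,13,17,18,20,26,33,34],[10,12,13,18,19,20,25,26,34],
    [9,10,13,18,19,25,27,33,41],[9,10,13,18,19,26,27,33,34],[10,11,13,17,18,19,27,33,41],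
    [10,11,13,18,19,20,26,27,33],[10,12,13,17,18,19,27,33,34],[10,12,13,18,19,20,25,27,33],
    [9,11,12,17,20,25,27,33,41],[9,11,12,17,20,26,27,33,34],[10,11,12,17,18,20,27,33,41],
    [10,11,12,17,19,20,27,33,34],[11,12,13,17,18,20,26,27,33],[11,12,13,17,19,20,25,27,33],
    [9,11,13,17,19,25,26,34,41],[9,11,13,17,19,26,27,33,34],[10,11,13,17,18,19,26,34,41],
    [10,11,13,17,19,20,26,33,34],[11,12,13,17,18,19,26,27,34],[11,12,13,17,19,20,25,26,34],
    [9,12,13,17,18,25,26,34,41],[9,12,13,17,18,25,27,33,41],[10,12,13,17,18,19,25,34,41],
    [10,12,13,17,18,20,25,33,41],[11,12,13,17,18,19,25,27,41],[11,12,13,17,18,20,25,26,41]]"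
    unfolding prism_perms_def list.map by (simp add: edge_code_simps)
  show "\<forall>q\<in>set prism_perms. \<forall>b\<in>set [2, 3, 4, 5, 6]. edge_code (relabel (map (transpose 1 b) q) prism_edges)
      \<in> set (map (\<lambda>q. edge_code (relabel q prism_edges)) prism_perms)"
    unfolding codes unfolding prism_perms_def list.set ball_simps list.map by (simp add: edge_code_simps)
  show "distinct (map (\<lambda>q. edge_code (relabel q prism_edges)) prism_perms)"
    unfolding codes by simp
qed (simp_all add: prism_perms_def perm6_def)

lemma bracket_sums:
  "inv2 x z = (\<Sum>q\<leftarrow>matching_perms. bracket_prod x z (relabel q matching_edges))"
  "inv4 x z = (\<Sum>q\<leftarrow>triangle_perms. bracket_prod x z (relabel q triangle_edges))"
  "inv6 x z = (\<Sum>q\<leftarrow>prism_perms. bracket_prod x z (relabel q prism_edges))"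
  unfolding sum_permuted[OF graph6_edges(1) orbit_list_matching, symmetric]
    sum_permuted[OF graph6_edges(2) orbit_list_triangle, symmetric]
    sum_permuted[OF graph6_edges(3) orbit_list_prism, symmetric]
  by (simp_all add: inv2_def inv4_def inv6_def edge_set_def)

text \<open>One scalar C serves all three degrees, as the weighted scaling of classical invariants
  demands.\<close>

lemma invariants_equivariant:
  fixes x z x' z' :: "nat \<Rightarrow> 'k::field"
  assumes "\<pi> permutes {1..6}"
    and "\<And>m n. m \<in> {1..6} \<Longrightarrow> n \<in> {1..6} \<Longrightarrow>
      bracket x' z' m n = k * l m * l n * bracket x z (\<pi> m) (\<pi> n)"
  defines "C \<equiv> k ^ 3 * (\<Prod>m\<in>{1..6}. l m)"
  shows "inv2 x' z' = C ^ 2 * inv2 x z" "inv4 x' z' = C ^ 4 * inv4 x z" "inv6 x' z' = C ^ 6 * inv6 x z"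
proof -
  have len6: "\<exists>a b c d e f. q = [a, b, c, d, e, f]" if "length q = 6" for q :: "nat list"
    using that by (auto simp: length_Suc_conv eval_nat_numeral)
  have reg: "(\<Prod>(i, j)\<leftarrow>relabel q matching_edges. l i * l j) = prod_list (map l q) ^ 1"
      "(\<Prod>(i, j)\<leftarrow>relabel q triangle_edges. l i * l j) = prod_list (map l q) ^ 2"
      "(\<Prod>(i, j)\<leftarrow>relabel q prism_edges. l i * l j) = prod_list (map l q) ^ 3"
    if q: "length q = 6" for q
    using len6[OF q] by (auto simp: relabel_def power2_eq_square power3_eq_cube mult_ac)
  show "inv2 x' z' = C ^ 2 * inv2 x z"
    using sum_permuted_equivariant[OF graph6_edges(1) orbit_list_matching assms(1,2) reg(1)]
    by (simp add: C_def inv2_def edge_set_def)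
  show "inv4 x' z' = C ^ 4 * inv4 x z"
    using sum_permuted_equivariant[OF graph6_edges(2) orbit_list_triangle assms(1,2) reg(2)]
    by (simp add: C_def inv4_def edge_set_def)
  show "inv6 x' z' = C ^ 6 * inv6 x z"
    using sum_permuted_equivariant[OF graph6_edges(3) orbit_list_prism assms(1,2) reg(3)]
    by (simp add: C_def inv6_def edge_set_def)
qed

text \<open>The points are the roots 0, infinity, p, -p, q, -q of X (X^2 - p^2) (X^2 - q^2). Thus s
  is the square of the coefficient of X^3, and c is the coefficient of X.\<close>

lemma invariants_symmetric_quintic:
  fixes p q :: "'k::field"
  defines "x \<equiv> \<lambda>m. [0, 1, p, - p, q, - q] ! (m - 1)" and "z \<equiv> \<lambda>m. [1, 0, 1, 1, 1, 1] ! (m - 1)"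
  defines "s \<equiv> (p\<^sup>2 + q\<^sup>2)\<^sup>2" and "c \<equiv> p\<^sup>2 * q\<^sup>2"
  shows "inv2 x z = 6 * s + 40 * c"
    and "inv4 x z = 36 * s * c - 80 * c\<^sup>2"
    and "inv6 x z = 72 * s\<^sup>2 * c + 176 * s * c\<^sup>2 - 320 * c ^ 3"
proof -
  define P where "P = p\<^sup>2"
  define Q where "Q = q\<^sup>2"
  define U where "U = (p - q)\<^sup>2"
  define V where "V = (p + q)\<^sup>2"
  have sq:
    "(bracket x z 1 2)\<^sup>2 = 1" "(bracket x z 2 1)\<^sup>2 = 1"
    "(bracket x z 1 3)\<^sup>2 = P" "(bracket x z 3 1)\<^sup>2 = P"
    "(bracket x z 1 4)\<^sup>2 = P" "(bracket x z 4 1)\<^sup>2 = P"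
    "(bracket x z 1 5)\<^sup>2 = Q" "(bracket x z 5 1)\<^sup>2 = Q"
    "(bracket x z 1 6)\<^sup>2 = Q" "(bracket x z 6 1)\<^sup>2 = Q"
    "(bracket x z 2 3)\<^sup>2 = 1" "(bracket x z 3 2)\<^sup>2 = 1"
    "(bracket x z 2 4)\<^sup>2 = 1" "(bracket x z 4 2)\<^sup>2 = 1"
    "(bracket x z 2 5)\<^sup>2 = 1" "(bracket x z 5 2)\<^sup>2 = 1"
    "(bracket x z 2 6)\<^sup>2 = 1" "(bracket x z 6 2)\<^sup>2 = 1"
    "(bracket x z 3 4)\<^sup>2 = 4 * P" "(bracket x z 4 3)\<^sup>2 = 4 * P"
    "(bracket x z 3 5)\<^sup>2 = U" "(bracket x z 5 3)\<^sup>2 = U"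
    "(bracket x z 3 6)\<^sup>2 = V" "(bracket x z 6 3)\<^sup>2 = V"
    "(bracket x z 4 5)\<^sup>2 = V" "(bracket x z 5 4)\<^sup>2 = V"
    "(bracket x z 4 6)\<^sup>2 = U" "(bracket x z 6 4)\<^sup>2 = U"
    "(bracket x z 5 6)\<^sup>2 = 4 * Q" "(bracket x z 6 5)\<^sup>2 = 4 * Q"
    unfolding x_def z_def bracket_def P_def Q_def U_def V_def
    by (simp_all add: power2_eq_square algebra_simps)
  \<comment> \<open>U and V are exchanged by r to -r; odd powers of r cancel in the sums, and even
    ones are rewritten by r^2 = P Q.\<close>
  define r where "r = p * q"
  have U: "U = P + Q - 2 * r" and V: "V = P + Q + 2 * r" and r: "r * r = P * Q"
    by (simp_all add: U_def V_def P_def Q_def r_def power2_eq_square algebra_simps)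
  have r': "r * (r * y) = P * Q * y" for y by (simp add: mult.assoc[symmetric] r)
  have sc: "s = (P + Q) * (P + Q)" "c = P * Q" by (simp_all add: s_def c_def P_def Q_def power2_eq_square)
  show "inv2 x z = 6 * s + 40 * c"
    unfolding bracket_sums matching_perms_def list.map sum_list.Cons sum_list.Nil
    by (simp add: relabel_def bracket_prod_def sq[unfolded One_nat_def])
       (simp add: U V sc algebra_simps r r')
  show "inv4 x z = 36 * s * c - 80 * c\<^sup>2"
    unfolding bracket_sums triangle_perms_def list.map sum_list.Cons sum_list.Nil
    by (simp add: relabel_def bracket_prod_def sq[unfolded One_nat_def])
       (simp add: U V sc power2_eq_square algebra_simps r r')
  show "inv6 x z = 72 * s\<^sup>2 * c + 176 * s * c\<^sup>2 - 320 * c ^ 3"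
    unfolding bracket_sums prism_perms_def list.map sum_list.Cons sum_list.Nil
    by (simp add: relabel_def bracket_prod_def sq[unfolded One_nat_def])
       (simp add: U V sc power2_eq_square power3_eq_cube algebra_simps r r')
qed

text \<open>The points are the roots of (X^3 - p^3) (X^3 - q^3), so s is the square of the
  coefficient of X^3 and c the constant term. The sums are first collected into symmetric functions
  of three squared brackets, whose elementary symmetric functions are free of w.\<close>

lemma invariants_cubic_sextic:
  fixes p q w :: "'k::field"
  assumes w: "w\<^sup>2 + w + 1 = 0"
  defines "x \<equiv> \<lambda>m. [p, w * p, w\<^sup>2 * p, q, w * q, w\<^sup>2 * q] ! (m - 1)" and "z \<equiv> \<lambda>m. [1, 1, 1, 1, 1, 1] ! (m - 1)"
  defines "s \<equiv> (p ^ 3 + q ^ 3)\<^sup>2" and "c \<equiv> p ^ 3 * q ^ 3"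
  shows "inv2 x z = 6 * s - 240 * c"
    and "inv4 x z = 324 * s * c + 1620 * c\<^sup>2"
    and "inv6 x z = 162 * s\<^sup>2 * c - 10044 * s * c\<^sup>2 - 119880 * c ^ 3"
proof -
  have w2: "w * w = - w - 1" using w by (simp add: power2_eq_square eq_neg_iff_add_eq_0 algebra_simps)
  have w2': "w * (w * y) = - (w * y) - y" for y
    by (simp add: mult.assoc[symmetric] w2 algebra_simps)
  have w3: "w * (w * w) = 1" "w * (w * (w * y)) = y" for y
    by (simp_all add: w2 w2' algebra_simps)
  define a where "a = p\<^sup>2"
  define d where "d = q\<^sup>2"
  define r where "r = p * q"
  \<comment> \<open>These are the squared brackets (1 4)^2, (2 6)^2 and (3 5)^2, equal to w^(2j) a -
    2 r + w^j d for j = 0, 1, 2. Every other bracket joining the two triples has a square that is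
    one of them times a power of w.\<close>
  define X where "X = (p - q)\<^sup>2"
  define Y where "Y = w\<^sup>2 * (p - w * q)\<^sup>2"
  define Z where "Z = w * (p - w\<^sup>2 * q)\<^sup>2"
  have sq:
    "(bracket x z 1 2)\<^sup>2 = - (3 * (w * a))" "(bracket x z 2 1)\<^sup>2 = - (3 * (w * a))"
    "(bracket x z 1 3)\<^sup>2 = - (3 * (w * (w * a)))" "(bracket x z 3 1)\<^sup>2 = - (3 * (w * (w * a)))"
    "(bracket x z 1 4)\<^sup>2 = X" "(bracket x z 4 1)\<^sup>2 = X"
    "(bracket x z 1 5)\<^sup>2 = w * Y" "(bracket x z 5 1)\<^sup>2 = w * Y"
    "(bracket x z 1 6)\<^sup>2 = w * (w * Z)" "(bracket x z 6 1)\<^sup>2 = w * (w * Z)"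
    "(bracket x z 2 3)\<^sup>2 = - (3 * a)" "(bracket x z 3 2)\<^sup>2 = - (3 * a)"
    "(bracket x z 2 4)\<^sup>2 = w * Z" "(bracket x z 4 2)\<^sup>2 = w * Z"
    "(bracket x z 2 5)\<^sup>2 = w * (w * X)" "(bracket x z 5 2)\<^sup>2 = w * (w * X)"
    "(bracket x z 2 6)\<^sup>2 = Y" "(bracket x z 6 2)\<^sup>2 = Y"
    "(bracket x z 3 4)\<^sup>2 = w * (w * Y)" "(bracket x z 4 3)\<^sup>2 = w * (w * Y)"
    "(bracket x z 3 5)\<^sup>2 = Z" "(bracket x z 5 3)\<^sup>2 = Z"
    "(bracket x z 3 6)\<^sup>2 = w * X" "(bracket x z 6 3)\<^sup>2 = w * X"
    "(bracket x z 4 5)\<^sup>2 = - (3 * (w * d))" "(bracket x z 5 4)\<^sup>2 = - (3 * (w * d))"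
    "(bracket x z 4 6)\<^sup>2 = - (3 * (w * (w * d)))" "(bracket x z 6 4)\<^sup>2 = - (3 * (w * (w * d)))"
    "(bracket x z 5 6)\<^sup>2 = - (3 * d)" "(bracket x z 6 5)\<^sup>2 = - (3 * d)"
    unfolding x_def z_def bracket_def a_def d_def X_def Y_def Z_def
    by (simp_all add: power2_eq_square algebra_simps w2 w2')
  define e1 where "e1 = X + Y + Z"
  define e2 where "e2 = X * Y + Y * Z + Z * X"
  define e3 where "e3 = X * Y * Z"
  have ad: "a * d = r * r" by (simp add: a_def d_def r_def power2_eq_square)
  have elem: "e1 = - 6 * r" "e2 = 9 * (r * r)" "e3 = s - 4 * (r * r * r)" "c = r * r * r"
    by (simp_all add: e1_def e2_def e3_def X_def Y_def Z_def r_def s_def c_def power2_eq_square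
        power3_eq_cube algebra_simps w2 w2')
  have p3: "X * X * X + Y * Y * Y + Z * Z * Z = e1 * e1 * e1 - 3 * e1 * e2 + 3 * e3"
    and p22: "X * X * Y * Y + Y * Y * Z * Z + Z * Z * X * X = e2 * e2 - 2 * e1 * e3"
    and p32: "X * X * Y * Y * (X + Y) + Y * Y * Z * Z * (Y + Z) + Z * Z * X * X * (Z + X) =
      e1 * e2 * e2 - 2 * e1 * e1 * e3 - e2 * e3"
    by (simp_all add: e1_def e2_def e3_def algebra_simps)
  have "inv2 x z = (X * X * X + Y * Y * Y + Z * Z * Z) + 3 * e3 + 27 * (a * d) * e1"
    unfolding bracket_sums matching_perms_def list.map sum_list.Cons sum_list.Nil e1_def e3_def
    by (simp add: relabel_def bracket_prod_def sq[unfolded One_nat_def])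
       (simp add: algebra_simps w3)
  thus "inv2 x z = 6 * s - 240 * c"
    unfolding p3 ad elem by (simp add: algebra_simps)
  have "inv4 x z = 729 * ((a * d) * (a * d) * (a * d)) + 27 * (a * d) * (X * X * Y * Y + Y * Y * Z * Z + Z * Z * X * X)"
    unfolding bracket_sums triangle_perms_def list.map sum_list.Cons sum_list.Nil
    by (simp add: relabel_def bracket_prod_def sq[unfolded One_nat_def])
       (simp add: algebra_simps w3)
  thus "inv4 x z = 324 * s * c + 1620 * c\<^sup>2"
    unfolding p22 ad elem by (simp add: power2_eq_square algebra_simps)
  have "inv6 x z = 729 * ((a * d) * (a * d) * (a * d)) * ((X * X * X + Y * Y * Y + Z * Z * Z) + 3 * e3) +
      243 * ((a * d) * (a * d)) * (X * X * Y * Y * (X + Y) + Y * Y * Z * Z * (Y + Z) + Z * Z * X * X * (Z + X)) +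
      486 * ((a * d) * (a * d)) * (e2 * e3) +
      27 * (a * d) * (e3 * (X * X * Y * Y + Y * Y * Z * Z + Z * Z * X * X) + e3 * e3 * e1)"
    unfolding bracket_sums prism_perms_def list.map sum_list.Cons sum_list.Nil e1_def e2_def e3_def
    by (simp add: relabel_def bracket_prod_def sq[unfolded One_nat_def])
       (simp add: algebra_simps w3)
  thus "inv6 x z = 162 * s\<^sup>2 * c - 10044 * s * c\<^sup>2 - 119880 * c ^ 3"
    unfolding p3 p22 p32 ad elem by (simp add: power2_eq_square power3_eq_cube algebra_simps)
qed

subsection \<open>The absolute invariants of the normal forms\<close>

text \<open>Moving the roots by A multiplies brackets by det A, and comparison with another
  factorisation permutes and rescales the factors, \<kappa> included. All this only changes the
  scalar C, so the roots of a normal form compute the invariants of f.\<close>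

lemma classical_invariants_subst6:
  fixes f :: "'k::{alg_closed_field, field_char_0} poly"
  assumes f: "genus2 f" and J: "classical_invariants f J2 J4 J6 J10"
    and A: "det2 A \<noteq> 0" and \<kappa>: "\<kappa> \<noteq> 0" and Af: "subst6 A f = smult \<kappa> (\<Prod>m\<in>{1..6::nat}. [:- X m, Z m:])"
  obtains C where "C \<noteq> 0" "J2 = C ^ 2 * inv2 X Z" "J4 = C ^ 4 * inv4 X Z" "J6 = C ^ 6 * inv6 X Z"
proof -
  obtain x z k where fx: "f = (\<Prod>m\<in>{1..6::nat}. [:- x m, z m:])" and k: "k \<noteq> 0"
    and J246: "J2 = k ^ 2 * inv2 x z" "J4 = k ^ 4 * inv4 x z" "J6 = k ^ 6 * inv6 x z"
    using J unfolding classical_invariants_def by blast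
  obtain a b c d where M: "A = Mat2 a b c d" by (cases A)
  define x' where "x' m = d * x m - b * z m" for m
  define z' where "z' m = a * z m - c * x m" for m
  have Af': "subst6 A f = (\<Prod>m\<in>{1..6::nat}. [:- x' m, z' m:])"
    using A unfolding M fx x'_def z'_def by (rule subst6_prod)
  have g: "genus2 (\<Prod>m\<in>{1..6::nat}. [:- x' m, z' m:])"
    using genus2_subst6[OF f A] unfolding Af' .
  obtain \<pi> l where \<pi>: "\<pi> permutes {1..6}" and l: "\<And>m. m \<in> {1..6} \<Longrightarrow> l m \<noteq> 0"
      "\<And>m. m \<in> {1..6} \<Longrightarrow> x' m = l m * X (\<pi> m)" "\<And>m. m \<in> {1..6} \<Longrightarrow> z' m = l m * Z (\<pi> m)"
    using factorisation_unique[OF g \<kappa> Af[unfolded Af']] by blast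
  have br: "bracket x z m n = 1 / det2 A * l m * l n * bracket X Z (\<pi> m) (\<pi> n)" if "m \<in> {1..6}" "n \<in> {1..6}" for m n
  proof -
    have "det2 A * bracket x z m n = bracket x' z' m n"
      by (simp add: M x'_def z'_def bracket_def algebra_simps)
    also have "\<dots> = l m * l n * bracket X Z (\<pi> m) (\<pi> n)"
      using l(2,3)[OF that(1)] l(2,3)[OF that(2)] by (simp add: bracket_def algebra_simps)
    finally show ?thesis using A by (simp add: field_simps)
  qed
  define K where "K = (1 / det2 A) ^ 3 * (\<Prod>m\<in>{1..6}. l m)"
  have inv: "inv2 x z = K ^ 2 * inv2 X Z" "inv4 x z = K ^ 4 * inv4 X Z" "inv6 x z = K ^ 6 * inv6 X Z"
    unfolding K_def by (rule invariants_equivariant[OF \<pi>], rule br, assumption+)+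
  define C where "C = k * K"
  have "C \<noteq> 0" using k A l(1) by (simp add: C_def K_def)
  moreover have "J2 = C ^ 2 * inv2 X Z" "J4 = C ^ 4 * inv4 X Z" "J6 = C ^ 6 * inv6 X Z"
    unfolding J246 inv C_def by (simp_all only: power_mult_distrib mult.assoc)
  ultimately show ?thesis by (rule that)
qed

lemma prod_six: "(\<Prod>m\<in>{1..6::nat}. F m) = F 1 * F 2 * F 3 * F 4 * F 5 * F 6"
proof -
  have "{1..6::nat} = {1, 2, 3, 4, 5, 6}" by auto
  thus ?thesis by (simp add: mult.assoc)
qed

text \<open>With R = 6 + 40 t the invariants give i1 = a / R^2 and i2 = b / R^3, and R^5 clears all
  denominators of num and den. As polynomials in t the two results differ by the factor -(4/3) t,
  and den is non-zero because t differs from 9/100.\<close>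

lemma quintic_parameter:
  fixes f :: "'k::{alg_closed_field, field_char_0} poly"
  assumes f: "genus2 f" and J: "classical_invariants f J2 J4 J6 J10" and J2: "J2 \<noteq> 0"
    and A: "det2 A \<noteq> 0" and \<kappa>: "\<kappa> \<noteq> 0" and Af: "subst6 A f = smult \<kappa> [:0, t, 0, 1, 0, 1:]"
    and t: "t \<noteq> 9 / 100"
    and i1: "i1 = 144 * (J4 / J2 ^ 2)" and i2: "i2 = - 1728 * ((J2 * J4 - 3 * J6) / J2 ^ 3)"
  defines "num \<equiv> 345 * i1 ^ 2 + 50 * i1 * i2 - 90 * i2 - 1296 * i1"
    and "den \<equiv> 2925 * i1 ^ 2 + 250 * i1 * i2 - 9450 * i2 - 54000 * i1 + 139968"
  shows "den \<noteq> 0" "- (3 / 4) * (num / den) = t"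
proof -
  \<comment> \<open>p and q are chosen with p^2 + q^2 = -1 and p^2 q^2 = t, so that X (X^2 - p^2)
    (X^2 - q^2) is the normal form.\<close>
  obtain p :: 'k where "poly [:t, 0, 1, 0, 1:] p = 0"
    using alg_closed_imp_poly_has_root[of "[:t, 0, 1, 0, 1:]"] by auto
  hence p: "t = - (p\<^sup>2) * (1 + p\<^sup>2)"
    by (simp add: power2_eq_square algebra_simps eq_neg_iff_add_eq_0)
  obtain q where q: "q\<^sup>2 = - 1 - p\<^sup>2" using nth_root_exists[of 2 "- 1 - p\<^sup>2"] by auto
  define X where "X = (\<lambda>m::nat. [0, 1, p, - p, q, - q] ! (m - 1))"
  define Z where "Z = (\<lambda>m::nat. [1, 0, 1, 1, 1, 1 :: 'k] ! (m - 1))"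
  have s: "(p\<^sup>2 + q\<^sup>2)\<^sup>2 = 1" and c: "p\<^sup>2 * q\<^sup>2 = t"
    unfolding q p by (simp_all add: algebra_simps power2_eq_square)
  have "(\<Prod>m\<in>{1..6::nat}. [:- X m, Z m:]) = [:0, - (p\<^sup>2 * q\<^sup>2), 0, p\<^sup>2 + q\<^sup>2, 0, - 1:]"
    unfolding prod_six X_def Z_def by (simp add: power2_eq_square algebra_simps)
  \<comment> \<open>The sign comes from the point (1 : 0), whose factor at Z = 1 is -1.\<close>
  also have "\<dots> = smult (- 1) [:0, t, 0, 1, 0, 1:]" unfolding c by (simp add: q)
  finally have "subst6 A f = smult (- \<kappa>) (\<Prod>m\<in>{1..6::nat}. [:- X m, Z m:])" using Af by simp
  then obtain C where C: "C \<noteq> 0" "J2 = C ^ 2 * inv2 X Z" "J4 = C ^ 4 * inv4 X Z" "J6 = C ^ 6 * inv6 X Z"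
    using classical_invariants_subst6[OF f J A, of "- \<kappa>"] \<kappa> by auto
  define R where "R = 6 + 40 * t"
  define a where "a = 144 * (36 * t - 80 * t\<^sup>2)"
  define b where "b = - 1728 * (R * (36 * t - 80 * t\<^sup>2) - 3 * (72 * t + 176 * t\<^sup>2 - 320 * t ^ 3))"
  have J': "J2 = C ^ 2 * R" "J4 = C ^ 4 * (36 * t - 80 * t\<^sup>2)" "J6 = C ^ 6 * (72 * t + 176 * t\<^sup>2 - 320 * t ^ 3)"
    using C invariants_symmetric_quintic[of p q] unfolding X_def Z_def s c R_def by simp_all
  have R: "R \<noteq> 0" using J2 J'(1) by auto
  have i: "i1 = a / R ^ 2" "i2 = b / R ^ 3"
    unfolding i1 i2 J' a_def b_def using C(1) R by (simp_all add: field_simps eval_nat_numeral)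
  have "num * R ^ 5 = 345 * a\<^sup>2 * R + 50 * a * b - 90 * b * R\<^sup>2 - 1296 * a * R ^ 3"
    unfolding num_def i using R by (simp add: field_simps eval_nat_numeral)
  also have "\<dots> = - 17915904 * t * (9 - 100 * t)\<^sup>2"
    by (simp add: a_def b_def R_def algebra_simps eval_nat_numeral)
  finally have num: "num * R ^ 5 = - 17915904 * t * (9 - 100 * t)\<^sup>2" .
  have "den * R ^ 5 = 2925 * a\<^sup>2 * R + 250 * a * b - 9450 * b * R\<^sup>2 - 54000 * a * R ^ 3 + 139968 * R ^ 5"
    unfolding den_def i using R by (simp add: field_simps eval_nat_numeral)
  also have "\<dots> = 13436928 * (9 - 100 * t)\<^sup>2"
    by (simp add: a_def b_def R_def algebra_simps eval_nat_numeral)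
  finally have den: "den * R ^ 5 = 13436928 * (9 - 100 * t)\<^sup>2" .
  have "9 - 100 * t \<noteq> 0" using t by (simp add: field_simps)
  thus d0: "den \<noteq> 0" using den by auto
  have "(- 3 * num) * R ^ 5 = - 3 * (num * R ^ 5)" by simp
  also have "\<dots> = 4 * t * (den * R ^ 5)" unfolding num den by simp
  also have "\<dots> = (4 * den * t) * R ^ 5" by simp
  finally have "(- 3 * num) * R ^ 5 = (4 * den * t) * R ^ 5" .
  hence "- 3 * num = 4 * den * t" using R by (metis mult_right_cancel power_not_zero)
  thus "- (3 / 4) * (num / den) = t" using d0 by (simp add: field_simps)
qed

text \<open>As for the quintic, now with R = 6 - 240 t; the quotient num / den is 4 t, and t
  \<noteq> -1/50 keeps the common factor 1 + 50 t away from 0.\<close>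

lemma sextic_parameter:
  fixes f :: "'k::{alg_closed_field, field_char_0} poly"
  assumes f: "genus2 f" and J: "classical_invariants f J2 J4 J6 J10" and J2: "J2 \<noteq> 0"
    and A: "det2 A \<noteq> 0" and \<kappa>: "\<kappa> \<noteq> 0" and Af: "subst6 A f = smult \<kappa> [:t, 0, 0, 1, 0, 0, 1:]"
    and t: "t \<noteq> - 1 / 50"
    and i1: "i1 = 144 * (J4 / J2 ^ 2)" and i2: "i2 = - 1728 * ((J2 * J4 - 3 * J6) / J2 ^ 3)"
  defines "num \<equiv> 540 * i1 ^ 2 + 100 * i1 * i2 - 1782 * i1 + 45 * i2"
    and "den \<equiv> 2700 * i1 ^ 2 + 1000 * i1 * i2 + 204525 * i1 + 40950 * i2 - 708588"
  shows "den \<noteq> 0" "1 / 4 * (num / den) = t"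
proof -
  obtain w :: 'k where w: "w\<^sup>2 + w + 1 = 0"
    using alg_closed_imp_poly_has_root[of "[:1, 1, 1 :: 'k:]"]
    by (auto simp: power2_eq_square algebra_simps)
  have w2: "w * w = - w - 1" using w by (simp add: power2_eq_square eq_neg_iff_add_eq_0 algebra_simps)
  have w2': "w * (w * y) = - (w * y) - y" for y by (simp add: mult.assoc[symmetric] w2 algebra_simps)
  obtain y :: 'k where "poly [:t, 1, 1:] y = 0" using alg_closed_imp_poly_has_root[of "[:t, 1, 1:]"] by auto
  hence y: "t = - y * (1 + y)" by (simp add: algebra_simps eq_neg_iff_add_eq_0)
  \<comment> \<open>p^3 and q^3 are the two roots of y^2 + y + t, so that (X^3 - p^3) (X^3 - q^3) is
    the normal form.\<close>
  obtain p where p: "p ^ 3 = y" using nth_root_exists[of 3 y] by auto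
  obtain q where q: "q ^ 3 = - 1 - y" using nth_root_exists[of 3 "- 1 - y"] by auto
  define X where "X = (\<lambda>m::nat. [p, w * p, w\<^sup>2 * p, q, w * q, w\<^sup>2 * q] ! (m - 1))"
  define Z where "Z = (\<lambda>m::nat. [1, 1, 1, 1, 1, 1 :: 'k] ! (m - 1))"
  have s: "(p ^ 3 + q ^ 3)\<^sup>2 = 1" and c: "p ^ 3 * q ^ 3 = t"
    unfolding p q y by (simp_all add: algebra_simps)
  have cube: "[:- v, 1:] * [:- (w * v), 1:] * [:- (w\<^sup>2 * v), 1:] = [:- (v ^ 3), 0, 0, 1:]" for v
    by (simp add: power2_eq_square power3_eq_cube algebra_simps w2 w2')
  have "(\<Prod>m\<in>{1..6::nat}. [:- X m, Z m:]) =
      ([:- p, 1:] * [:- (w * p), 1:] * [:- (w\<^sup>2 * p), 1:]) * ([:- q, 1:] * [:- (w * q), 1:] * [:- (w\<^sup>2 * q), 1:])"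
    unfolding prod_six X_def Z_def by (simp add: mult.assoc del: mult_pCons_left mult_pCons_right)
  also have "\<dots> = [:p ^ 3 * q ^ 3, 0, 0, - (p ^ 3 + q ^ 3), 0, 0, 1:]" unfolding cube by simp
  also have "\<dots> = [:t, 0, 0, 1, 0, 0, 1:]" unfolding c by (simp add: p q)
  finally have "subst6 A f = smult \<kappa> (\<Prod>m\<in>{1..6::nat}. [:- X m, Z m:])" using Af by simp
  then obtain C where C: "C \<noteq> 0" "J2 = C ^ 2 * inv2 X Z" "J4 = C ^ 4 * inv4 X Z" "J6 = C ^ 6 * inv6 X Z"
    using classical_invariants_subst6[OF f J A \<kappa>] by blast
  define R where "R = 6 - 240 * t"
  define a where "a = 144 * (324 * t + 1620 * t\<^sup>2)"
  define b where "b = - 1728 * (R * (324 * t + 1620 * t\<^sup>2) - 3 * (162 * t - 10044 * t\<^sup>2 - 119880 * t ^ 3))"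
  have J': "J2 = C ^ 2 * R" "J4 = C ^ 4 * (324 * t + 1620 * t\<^sup>2)" "J6 = C ^ 6 * (162 * t - 10044 * t\<^sup>2 - 119880 * t ^ 3)"
    using C invariants_cubic_sextic[OF w, of p q] unfolding X_def Z_def s c R_def by simp_all
  have R: "R \<noteq> 0" using J2 J'(1) by auto
  have i: "i1 = a / R ^ 2" "i2 = b / R ^ 3"
    unfolding i1 i2 J' a_def b_def using C(1) R by (simp_all add: field_simps eval_nat_numeral)
  have "num * R ^ 5 = 540 * a\<^sup>2 * R + 100 * a * b - 1782 * a * R ^ 3 + 45 * b * R\<^sup>2"
    unfolding num_def i using R by (simp add: field_simps eval_nat_numeral)
  also have "\<dots> = - 22039921152 * t * (1 + 50 * t)\<^sup>2"
    by (simp add: a_def b_def R_def algebra_simps eval_nat_numeral)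
  finally have num: "num * R ^ 5 = - 22039921152 * t * (1 + 50 * t)\<^sup>2" .
  have "den * R ^ 5 = 2700 * a\<^sup>2 * R + 1000 * a * b + 204525 * a * R ^ 3 + 40950 * b * R\<^sup>2 - 708588 * R ^ 5"
    unfolding den_def i using R by (simp add: field_simps eval_nat_numeral)
  also have "\<dots> = - 5509980288 * (1 + 50 * t)\<^sup>2"
    by (simp add: a_def b_def R_def algebra_simps eval_nat_numeral)
  finally have den: "den * R ^ 5 = - 5509980288 * (1 + 50 * t)\<^sup>2" .
  have "1 + 50 * t \<noteq> 0" using t by (auto simp: field_simps eq_neg_iff_add_eq_0)
  thus d0: "den \<noteq> 0" using den by auto
  have "num * R ^ 5 = 4 * t * (den * R ^ 5)" unfolding num den by simp
  also have "\<dots> = (4 * den * t) * R ^ 5" by simp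
  finally have "num * R ^ 5 = (4 * den * t) * R ^ 5" .
  hence "num = 4 * den * t" using R by simp
  thus "1 / 4 * (num / den) = t" using d0 by (simp add: field_simps)
qed

theorem lemma5:
  fixes f :: "'k::{alg_closed_field, field_char_0} poly"
    and J2 J4 J6 J10 i1 i2 i3 :: 'k
  assumes "genus2 f"
    and "classical_invariants f J2 J4 J6 J10"
    and "J2 \<noteq> 0"
    and "i1 = 144 * (J4 / J2 ^ 2)"
    and "i2 = - 1728 * ((J2 * J4 - 3 * J6) / J2 ^ 3)"
    and "i3 = 486 * (J10 / J2 ^ 5)"
  shows
    "(Aut f \<cong> dihedral_group 4 \<longrightarrow>
       (let num = 345 * i1 ^ 2 + 50 * i1 * i2 - 90 * i2 - 1296 * i1;
            den = 2925 * i1 ^ 2 + 250 * i1 * i2 - 9450 * i2 - 54000 * i1 + 139968;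
            t = - (3 / 4) * (num / den);
            g = [:0, t, 0, 1, 0, 1:]
        in den \<noteq> 0 \<and> genus2 g \<and> curve_isomorphic f g)) \<and>
     (Aut f \<cong> dihedral_group 6 \<longrightarrow>
       (let num = 540 * i1 ^ 2 + 100 * i1 * i2 - 1782 * i1 + 45 * i2;
            den = 2700 * i1 ^ 2 + 1000 * i1 * i2 + 204525 * i1 + 40950 * i2 - 708588;
            t = 1 / 4 * (num / den);
            g = [:t, 0, 0, 1, 0, 0, 1:]
        in den \<noteq> 0 \<and> genus2 g \<and> curve_isomorphic f g))"
proof -
  \<comment> \<open>Squarefreeness of g is inherited from f through the substitution, without
    computing a discriminant.\<close>
  have good: "genus2 g \<and> curve_isomorphic f g"
    if "det2 A \<noteq> 0" "\<kappa> \<noteq> 0" "subst6 A f = smult \<kappa> g" for A \<kappa> g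
    using genus2_subst6[OF assms(1) that(1)] subst6_imp_isomorphic[OF assms(1) that] that genus2_smult
    by metis
  show ?thesis
  proof (intro conjI impI)
    assume "Aut f \<cong> dihedral_group 4"
    then obtain A \<kappa> t where A: "det2 A \<noteq> 0" "\<kappa> \<noteq> 0" "subst6 A f = smult \<kappa> [:0, t, 0, 1, 0, 1:]" and "t \<noteq> 9 / 100"
      using D8_normal_form[OF assms(1)] by metis
    note t = quintic_parameter[OF assms(1-3) this assms(4,5)]
    show "let num = 345 * i1 ^ 2 + 50 * i1 * i2 - 90 * i2 - 1296 * i1;
            den = 2925 * i1 ^ 2 + 250 * i1 * i2 - 9450 * i2 - 54000 * i1 + 139968;
            t = - (3 / 4) * (num / den);
            g = [:0, t, 0, 1, 0, 1:]
        in den \<noteq> 0 \<and> genus2 g \<and> curve_isomorphic f g"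
      unfolding Let_def t(2) using t(1) good[OF A] by blast
  next
    assume "Aut f \<cong> dihedral_group 6"
    then obtain A \<kappa> t where A: "det2 A \<noteq> 0" "\<kappa> \<noteq> 0" "subst6 A f = smult \<kappa> [:t, 0, 0, 1, 0, 0, 1:]" and "t \<noteq> - 1 / 50"
      using D12_normal_form[OF assms(1)] by metis
    note t = sextic_parameter[OF assms(1-3) this assms(4,5)]
    show "let num = 540 * i1 ^ 2 + 100 * i1 * i2 - 1782 * i1 + 45 * i2;
            den = 2700 * i1 ^ 2 + 1000 * i1 * i2 + 204525 * i1 + 40950 * i2 - 708588;
            t = 1 / 4 * (num / den);
            g = [:t, 0, 0, 1, 0, 0, 1:]
        in den \<noteq> 0 \<and> genus2 g \<and> curve_isomorphic f g"
      unfolding Let_def t(2) using t(1) good[OF A] by blast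
  qed
qed

end
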